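(* Let $F$ be an infinite field. Then the interpretation $F[x,x^{-1}]\cong\Gamma_0(\mathbb S(F,\mathbb N))$ described in the context gives rise to a regular bi-interpretation of the ring of Laurent polynomials $F[x,x^{-1}]$ and the list superstructure $\mathbb S(F,\mathbb N)$ in each other.
   Context: $\mathbb S(F,\mathbb N)=\langle F,\mathrm{List}(F),\mathbb N;t,\ell\rangle$ is the three-sorted structure with sorts the field $F$, the set of finite tuples over $F$, and the arithmetic $\langle\mathbb N;+,\cdot,0,1\rangle$; $\ell(s)$ is the length of $s$ and $t(s,a,i)$ says the $i$-th component of $s$ is $a$. $\Gamma_0$ represents the Laurent polynomial $a_{-m}x^{-m}+\dots+a_nx^n$ ($m,n\ge0$) by the pair of tuples $(a_0,\ldots,a_n),(a_{-1},\ldots,a_{-m})$, each modulo appending zeros, with the natural first-order formulas for $0,1$, addition and multiplication. Interpretations: a regular interpretation $(\Gamma,\phi)$ of $\mathbb A$ in $\mathbb B$ is a code of $L(\mathbb B)$-formulas with parameters $\bar y$ defining a subset of $B^n$, an equivalence relation and the operations of $\mathbb A$ on the quotient, and a formula $\phi(\bar y)$, $\phi(\mathbb B)\neq\emptyset$, such that the resulting $\Gamma(\mathbb B,\bar p)\cong\mathbb A$ for all $\bar p\in\phi(\mathbb B)$; a coordinate map is a surjection from the defined subset onto $A$ inducing such an isomorphism. $\mathbb A$ and $\mathbb B$ are regularly bi-interpretable if there exist regular interpretations $(\Gamma,\phi)$ of $\mathbb A$ in $\mathbb B$ and $(\Delta,\psi)$ of $\mathbb B$ in $\mathbb A$ and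 formulas $\theta_{\mathbb A}$, $\theta_{\mathbb B}$ such that for every admissible parameter tuple $\bar r_0$ of the composite interpretation $\Gamma\circ\Delta$ of $\mathbb A$ in itself, $\theta_{\mathbb A}(\bar u,x,\bar r_0)$ defines a coordinate map $\Gamma\circ\Delta(\mathbb A,\bar r_0)\to\mathbb A$, and symmetrically $\theta_{\mathbb B}$ defines a coordinate map $\Delta\circ\Gamma(\mathbb B,\bar t_0)\to\mathbb B$ for every admissible $\bar t_0$. *)

theory Defs
  imports "HOL-Library.Poly_Mapping"
begin

section \<open>Many-sorted first-order logic\<close>

text \<open>Every element of \<open>'s\<close> is a sort; \<open>funs\<close> and \<open>rels\<close> are the symbols of the language
  (function symbols without arguments are the constants).\<close>

record ('s, 'f, 'r) lang =
  funs :: "'f set"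
  rels :: "'r set"
  fun_type :: "'f \<Rightarrow> 's list \<times> 's"
  rel_type :: "'r \<Rightarrow> 's list"

record ('s, 'f, 'r, 'u) model =
  Carrier :: "'s \<Rightarrow> 'u set"
  FunI :: "'f \<Rightarrow> 'u list \<Rightarrow> 'u"
  RelI :: "'r \<Rightarrow> 'u list \<Rightarrow> bool"

text \<open>Variables are de Bruijn indices. A formula is read over a tuple of values, \<open>Var i\<close>
  being its entry \<open>i\<close>; \<open>Exi s\<close> puts an element of sort \<open>s\<close> in front of the tuple.\<close>

datatype 'f trm = Var nat | App 'f "'f trm list"

datatype ('s, 'f, 'r) fm =
    Tru
  | Eq 's "'f trm" "'f trm"
  | Rel 'r "'f trm list"
  | Neg "('s, 'f, 'r) fm"
  | And "('s, 'f, 'r) fm" "('s, 'f, 'r) fm"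
  | Exi 's "('s, 'f, 'r) fm"

definition Or :: "('s, 'f, 'r) fm \<Rightarrow> ('s, 'f, 'r) fm \<Rightarrow> ('s, 'f, 'r) fm" where
  "Or \<phi> \<psi> = Neg (And (Neg \<phi>) (Neg \<psi>))"

definition Imp :: "('s, 'f, 'r) fm \<Rightarrow> ('s, 'f, 'r) fm \<Rightarrow> ('s, 'f, 'r) fm" where
  "Imp \<phi> \<psi> = Neg (And \<phi> (Neg \<psi>))"

definition Iff :: "('s, 'f, 'r) fm \<Rightarrow> ('s, 'f, 'r) fm \<Rightarrow> ('s, 'f, 'r) fm" where
  "Iff \<phi> \<psi> = And (Imp \<phi> \<psi>) (Imp \<psi> \<phi>)"

definition Fall :: "'s \<Rightarrow> ('s, 'f, 'r) fm \<Rightarrow> ('s, 'f, 'r) fm" where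
  "Fall s \<phi> = Neg (Exi s (Neg \<phi>))"

primrec Ands :: "('s, 'f, 'r) fm list \<Rightarrow> ('s, 'f, 'r) fm" where
  "Ands [] = Tru"
| "Ands (\<phi> # \<phi>s) = And \<phi> (Ands \<phi>s)"

inductive has_sort :: "('s, 'f, 'r) lang \<Rightarrow> 's list \<Rightarrow> 'f trm \<Rightarrow> 's \<Rightarrow> bool"
  for L :: "('s, 'f, 'r) lang" and \<Sigma> :: "'s list" where
  "i < length \<Sigma> \<Longrightarrow> has_sort L \<Sigma> (Var i) (\<Sigma> ! i)"
| "f \<in> funs L \<Longrightarrow> list_all2 (has_sort L \<Sigma>) ts (fst (fun_type L f)) \<Longrightarrow>
     has_sort L \<Sigma> (App f ts) (snd (fun_type L f))"

text \<open>\<open>wff L \<Sigma> \<phi>\<close>: \<open>\<phi>\<close> is an \<open>L\<close>-formula whose free variables are among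
  \<open>Var 0, Var 1, \<dots>\<close>, of the sorts listed in \<open>\<Sigma>\<close>.\<close>

primrec wff :: "('s, 'f, 'r) lang \<Rightarrow> 's list \<Rightarrow> ('s, 'f, 'r) fm \<Rightarrow> bool" where
  "wff L \<Sigma> Tru \<longleftrightarrow> True"
| "wff L \<Sigma> (Eq s t u) \<longleftrightarrow> has_sort L \<Sigma> t s \<and> has_sort L \<Sigma> u s"
| "wff L \<Sigma> (Rel r ts) \<longleftrightarrow> r \<in> rels L \<and> list_all2 (has_sort L \<Sigma>) ts (rel_type L r)"
| "wff L \<Sigma> (Neg \<phi>) \<longleftrightarrow> wff L \<Sigma> \<phi>"
| "wff L \<Sigma> (And \<phi> \<psi>) \<longleftrightarrow> wff L \<Sigma> \<phi> \<and> wff L \<Sigma> \<psi>"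
| "wff L \<Sigma> (Exi s \<phi>) \<longleftrightarrow> wff L (s # \<Sigma>) \<phi>"

primrec tval :: "('s, 'f, 'r, 'u) model \<Rightarrow> 'u list \<Rightarrow> 'f trm \<Rightarrow> 'u" where
  "tval M xs (Var i) = xs ! i"
| "tval M xs (App f ts) = FunI M f (map (tval M xs) ts)"

primrec sat :: "('s, 'f, 'r, 'u) model \<Rightarrow> 'u list \<Rightarrow> ('s, 'f, 'r) fm \<Rightarrow> bool" where
  "sat M xs Tru \<longleftrightarrow> True"
| "sat M xs (Eq s t u) \<longleftrightarrow> tval M xs t = tval M xs u"
| "sat M xs (Rel r ts) \<longleftrightarrow> RelI M r (map (tval M xs) ts)"
| "sat M xs (Neg \<phi>) \<longleftrightarrow> \<not> sat M xs \<phi>"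
| "sat M xs (And \<phi> \<psi>) \<longleftrightarrow> sat M xs \<phi> \<and> sat M xs \<psi>"
| "sat M xs (Exi s \<phi>) \<longleftrightarrow> (\<exists>x\<in>Carrier M s. sat M (x # xs) \<phi>)"

text \<open>Capture-avoiding renaming of the free variables; \<open>inst [i\<^sub>0, i\<^sub>1, \<dots>] \<phi>\<close> is
  \<open>\<phi>(v\<^bsub>i\<^sub>0\<^esub>, v\<^bsub>i\<^sub>1\<^esub>, \<dots>)\<close>.\<close>

primrec ren_trm :: "(nat \<Rightarrow> nat) \<Rightarrow> 'f trm \<Rightarrow> 'f trm" where
  "ren_trm \<rho> (Var i) = Var (\<rho> i)"
| "ren_trm \<rho> (App f ts) = App f (map (ren_trm \<rho>) ts)"

primrec ren :: "(nat \<Rightarrow> nat) \<Rightarrow> ('s, 'f, 'r) fm \<Rightarrow> ('s, 'f, 'r) fm" where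
  "ren \<rho> Tru = Tru"
| "ren \<rho> (Eq s t u) = Eq s (ren_trm \<rho> t) (ren_trm \<rho> u)"
| "ren \<rho> (Rel r ts) = Rel r (map (ren_trm \<rho>) ts)"
| "ren \<rho> (Neg \<phi>) = Neg (ren \<rho> \<phi>)"
| "ren \<rho> (And \<phi> \<psi>) = And (ren \<rho> \<phi>) (ren \<rho> \<psi>)"
| "ren \<rho> (Exi s \<phi>) = Exi s (ren (case_nat 0 (\<lambda>i. Suc (\<rho> i))) \<phi>)"

definition inst :: "nat list \<Rightarrow> ('s, 'f, 'r) fm \<Rightarrow> ('s, 'f, 'r) fm" where
  "inst vs \<phi> = ren (\<lambda>i. vs ! i) \<phi>"

definition tuples :: "('s \<Rightarrow> 'u set) \<Rightarrow> 's list \<Rightarrow> 'u list set" where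
  "tuples C ss = {xs. list_all2 (\<lambda>x s. x \<in> C s) xs ss}"

definition is_iso ::
  "('s, 'f, 'r) lang \<Rightarrow> ('s, 'f, 'r, 'u) model \<Rightarrow> ('s, 'f, 'r, 'v) model \<Rightarrow> ('s \<Rightarrow> 'u \<Rightarrow> 'v) \<Rightarrow> bool" where
  "is_iso L M N h \<longleftrightarrow>
     (\<forall>s. bij_betw (h s) (Carrier M s) (Carrier N s)) \<and>
     (\<forall>f\<in>funs L. \<forall>xs\<in>tuples (Carrier M) (fst (fun_type L f)).
        h (snd (fun_type L f)) (FunI M f xs) = FunI N f (map2 h (fst (fun_type L f)) xs)) \<and>
     (\<forall>r\<in>rels L. \<forall>xs\<in>tuples (Carrier M) (rel_type L r).
        RelI M r xs \<longleftrightarrow> RelI N r (map2 h (rel_type L r) xs))"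


section \<open>Interpretations\<close>

text \<open>A code interpreting a language with sorts \<open>'s\<close> and symbols \<open>'f\<close>, \<open>'r\<close> by formulas of a
  language with sorts \<open>'t\<close> and symbols \<open>'g\<close>, \<open>'q\<close>. An element of sort \<open>s\<close> is represented by a
  tuple of sorts \<open>coord s\<close>; \<open>params\<close> are the sorts of the parameters. In each formula the
  representing tuples come first, in order, and the parameters last. Function symbols are
  interpreted through their graphs, with the value after the arguments.\<close>

record ('s, 'f, 'r, 't, 'g, 'q) code =
  params :: "'t list"
  coord :: "'s \<Rightarrow> 't list"
  DomC :: "'s \<Rightarrow> ('t, 'g, 'q) fm"
  EquC :: "'s \<Rightarrow> ('t, 'g, 'q) fm"
  FunC :: "'f \<Rightarrow> ('t, 'g, 'q) fm"
  RelC :: "'r \<Rightarrow> ('t, 'g, 'q) fm"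

abbreviation coords :: "('s, 'f, 'r, 't, 'g, 'q) code \<Rightarrow> 's list \<Rightarrow> 't list" where
  "coords \<Gamma> ss \<equiv> concat (map (coord \<Gamma>) ss)"

definition wf_code ::
  "('s, 'f, 'r) lang \<Rightarrow> ('t, 'g, 'q) lang \<Rightarrow> ('s, 'f, 'r, 't, 'g, 'q) code \<Rightarrow> bool" where
  "wf_code LA LB \<Gamma> \<longleftrightarrow>
     (\<forall>s. wff LB (coord \<Gamma> s @ params \<Gamma>) (DomC \<Gamma> s)) \<and>
     (\<forall>s. wff LB (coord \<Gamma> s @ coord \<Gamma> s @ params \<Gamma>) (EquC \<Gamma> s)) \<and>
     (\<forall>f\<in>funs LA. wff LB (coords \<Gamma> (fst (fun_type LA f)) @ coord \<Gamma> (snd (fun_type LA f)) @ params \<Gamma>)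
        (FunC \<Gamma> f)) \<and>
     (\<forall>r\<in>rels LA. wff LB (coords \<Gamma> (rel_type LA r) @ params \<Gamma>) (RelC \<Gamma> r))"

definition dom_set ::
  "('s, 'f, 'r, 't, 'g, 'q) code \<Rightarrow> ('t, 'g, 'q, 'u) model \<Rightarrow> 'u list \<Rightarrow> 's \<Rightarrow> 'u list set" where
  "dom_set \<Gamma> B p s = {u \<in> tuples (Carrier B) (coord \<Gamma> s). sat B (u @ p) (DomC \<Gamma> s)}"

definition equ_rel ::
  "('s, 'f, 'r, 't, 'g, 'q) code \<Rightarrow> ('t, 'g, 'q, 'u) model \<Rightarrow> 'u list \<Rightarrow> 's \<Rightarrow> ('u list \<times> 'u list) set" where
  "equ_rel \<Gamma> B p s =
     {(u, v). u \<in> dom_set \<Gamma> B p s \<and> v \<in> dom_set \<Gamma> B p s \<and> sat B (u @ v @ p) (EquC \<Gamma> s)}"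

text \<open>The formulas of \<open>\<Gamma>\<close> with parameters \<open>p\<close> define, for each sort, an equivalence relation on
  the defined subset, and relations and operations on the quotients.\<close>

definition well_defined ::
  "('s, 'f, 'r) lang \<Rightarrow> ('s, 'f, 'r, 't, 'g, 'q) code \<Rightarrow> ('t, 'g, 'q, 'u) model \<Rightarrow> 'u list \<Rightarrow> bool" where
  "well_defined L \<Gamma> B p \<longleftrightarrow>
     (\<forall>s. equiv (dom_set \<Gamma> B p s) (equ_rel \<Gamma> B p s)) \<and>
     (\<forall>f\<in>funs L. \<forall>ps\<in>tuples (equ_rel \<Gamma> B p) (fst (fun_type L f)).
        \<forall>(v, v')\<in>equ_rel \<Gamma> B p (snd (fun_type L f)).
        sat B (concat (map fst ps) @ v @ p) (FunC \<Gamma> f) \<longleftrightarrow>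
        sat B (concat (map snd ps) @ v' @ p) (FunC \<Gamma> f)) \<and>
     (\<forall>f\<in>funs L. \<forall>us\<in>tuples (dom_set \<Gamma> B p) (fst (fun_type L f)).
        (\<exists>v\<in>dom_set \<Gamma> B p (snd (fun_type L f)). sat B (concat us @ v @ p) (FunC \<Gamma> f)) \<and>
        (\<forall>v\<in>dom_set \<Gamma> B p (snd (fun_type L f)). \<forall>v'\<in>dom_set \<Gamma> B p (snd (fun_type L f)).
           sat B (concat us @ v @ p) (FunC \<Gamma> f) \<longrightarrow> sat B (concat us @ v' @ p) (FunC \<Gamma> f) \<longrightarrow>
           (v, v') \<in> equ_rel \<Gamma> B p (snd (fun_type L f)))) \<and>
     (\<forall>r\<in>rels L. \<forall>ps\<in>tuples (equ_rel \<Gamma> B p) (rel_type L r).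
        sat B (concat (map fst ps) @ p) (RelC \<Gamma> r) \<longleftrightarrow>
        sat B (concat (map snd ps) @ p) (RelC \<Gamma> r))"

text \<open>The structure \<open>\<Gamma>(B, p)\<close>; meaningful only if \<open>well_defined L \<Gamma> B p\<close>.\<close>

definition interp ::
  "('s, 'f, 'r) lang \<Rightarrow> ('s, 'f, 'r, 't, 'g, 'q) code \<Rightarrow> ('t, 'g, 'q, 'u) model \<Rightarrow> 'u list \<Rightarrow>
   ('s, 'f, 'r, 'u list set) model" where
  "interp L \<Gamma> B p =
     \<lparr> Carrier = (\<lambda>s. dom_set \<Gamma> B p s // equ_rel \<Gamma> B p s),
       FunI = (\<lambda>f Xs. THE Y. Y \<in> dom_set \<Gamma> B p (snd (fun_type L f)) // equ_rel \<Gamma> B p (snd (fun_type L f)) \<and>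
          (\<exists>us v. list_all2 (\<in>) us Xs \<and> v \<in> Y \<and> sat B (concat us @ v @ p) (FunC \<Gamma> f))),
       RelI = (\<lambda>r Xs. \<exists>us. list_all2 (\<in>) us Xs \<and> sat B (concat us @ p) (RelC \<Gamma> r)) \<rparr>"

definition coordinate_map ::
  "('s, 'f, 'r) lang \<Rightarrow> ('s, 'f, 'r, 't, 'g, 'q) code \<Rightarrow> ('t, 'g, 'q, 'u) model \<Rightarrow> 'u list \<Rightarrow>
   ('s, 'f, 'r, 'v) model \<Rightarrow> ('s \<Rightarrow> 'u list \<Rightarrow> 'v) \<Rightarrow> bool" where
  "coordinate_map L \<Gamma> B p A \<mu> \<longleftrightarrow>
     well_defined L \<Gamma> B p \<and>
     (\<forall>s. \<mu> s ` dom_set \<Gamma> B p s = Carrier A s) \<and>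
     (\<exists>h. is_iso L (interp L \<Gamma> B p) A h \<and>
        (\<forall>s. \<forall>u\<in>dom_set \<Gamma> B p s. \<mu> s u = h s (equ_rel \<Gamma> B p s `` {u})))"

definition regular_interpretation ::
  "('s, 'f, 'r) lang \<Rightarrow> ('s, 'f, 'r, 'v) model \<Rightarrow> ('t, 'g, 'q) lang \<Rightarrow> ('t, 'g, 'q, 'u) model \<Rightarrow>
   ('s, 'f, 'r, 't, 'g, 'q) code \<Rightarrow> ('t, 'g, 'q) fm \<Rightarrow> bool" where
  "regular_interpretation LA A LB B \<Gamma> \<phi> \<longleftrightarrow>
     wf_code LA LB \<Gamma> \<and> wff LB (params \<Gamma>) \<phi> \<and>
     (\<exists>p\<in>tuples (Carrier B) (params \<Gamma>). sat B p \<phi>) \<and>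
     (\<forall>p\<in>tuples (Carrier B) (params \<Gamma>). sat B p \<phi> \<longrightarrow>
        well_defined LA \<Gamma> B p \<and> (\<exists>h. is_iso LA (interp LA \<Gamma> B p) A h))"


section \<open>Translation of formulas and composition of codes\<close>

text \<open>In the translation along a code \<open>\<Delta>\<close>, the free variable \<open>i\<close> becomes the block \<open>\<sigma> ! i\<close> of
  variables and \<open>\<pi>\<close> is the block of parameters. \<open>blocks \<Delta> ss n\<close> lists the consecutive blocks for
  variables of sorts \<open>ss\<close>, starting at variable \<open>n\<close>.\<close>

primrec blocks :: "('s, 'f, 'r, 't, 'g, 'q) code \<Rightarrow> 's list \<Rightarrow> nat \<Rightarrow> nat list list" where
  "blocks \<Delta> [] n = []"
| "blocks \<Delta> (s # ss) n = [n..<n + length (coord \<Delta> s)] # blocks \<Delta> ss (n + length (coord \<Delta> s))"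

text \<open>\<open>Exs [s\<^sub>0, s\<^sub>1, \<dots>] \<phi>\<close> binds \<open>Var 0, Var 1, \<dots>\<close> of sorts \<open>s\<^sub>0, s\<^sub>1, \<dots>\<close>.\<close>

definition Exs :: "'s list \<Rightarrow> ('s, 'f, 'r) fm \<Rightarrow> ('s, 'f, 'r) fm" where
  "Exs ss \<phi> = fold Exi ss \<phi>"

text \<open>\<open>graft \<Delta> T \<sigma> \<pi> \<rho> ss ts \<chi>\<close> expresses that \<open>\<chi>\<close> holds of representatives of the values of the
  terms \<open>ts\<close> (of sorts \<open>ss\<close>), followed by the block \<open>\<rho>\<close> and the parameters; \<open>T \<sigma> \<pi> \<beta> s t\<close>
  expresses that the block \<open>\<beta>\<close> represents the value of \<open>t\<close>.\<close>

definition graft ::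
  "('s, 'f, 'r, 't, 'g, 'q) code \<Rightarrow>
   (nat list list \<Rightarrow> nat list \<Rightarrow> nat list \<Rightarrow> 's \<Rightarrow> 'f trm \<Rightarrow> ('t, 'g, 'q) fm) \<Rightarrow>
   nat list list \<Rightarrow> nat list \<Rightarrow> nat list \<Rightarrow> 's list \<Rightarrow> 'f trm list \<Rightarrow> ('t, 'g, 'q) fm \<Rightarrow> ('t, 'g, 'q) fm" where
  "graft \<Delta> T \<sigma> \<pi> \<rho> ss ts \<chi> =
     (let bs = blocks \<Delta> ss 0; up = map (\<lambda>i. i + length (coords \<Delta> ss)) in
      Exs (coords \<Delta> ss)
        (And (Ands (map (\<lambda>(t, s, b). And (inst (b @ up \<pi>) (DomC \<Delta> s)) (T (map up \<sigma>) (up \<pi>) b s t))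
                (zip ts (zip ss bs))))
             (inst (concat bs @ up \<rho> @ up \<pi>) \<chi>)))"

lemma graft_cong [fundef_cong]:
  assumes "\<Delta> = \<Delta>'" "\<sigma> = \<sigma>'" "\<pi> = \<pi>'" "\<rho> = \<rho>'" "ss = ss'" "ts = ts'" "\<chi> = \<chi>'"
    and "\<And>\<sigma> \<pi> b s t. t \<in> set ts' \<Longrightarrow> T \<sigma> \<pi> b s t = T' \<sigma> \<pi> b s t"
  shows "graft \<Delta> T \<sigma> \<pi> \<rho> ss ts \<chi> = graft \<Delta>' T' \<sigma>' \<pi>' \<rho>' ss' ts' \<chi>'"
proof -
  have "map (\<lambda>(t, s, b). And (inst (b @ \<pi>2) (DomC \<Delta> s)) (T \<sigma>2 \<pi>2 b s t)) (zip ts xs) =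
        map (\<lambda>(t, s, b). And (inst (b @ \<pi>2) (DomC \<Delta> s)) (T' \<sigma>2 \<pi>2 b s t)) (zip ts xs)" for \<pi>2 \<sigma>2 xs
    using assms(6,8) by (auto dest: set_zip_leftD)
  then show ?thesis
    unfolding graft_def Let_def assms(1-7)[symmetric] by (simp only:)
qed

fun trans_trm ::
  "('s, 'f, 'r) lang \<Rightarrow> ('s, 'f, 'r, 't, 'g, 'q) code \<Rightarrow> nat list list \<Rightarrow> nat list \<Rightarrow> nat list \<Rightarrow>
   's \<Rightarrow> 'f trm \<Rightarrow> ('t, 'g, 'q) fm" where
  "trans_trm L \<Delta> \<sigma> \<pi> \<beta> s (Var i) = inst (\<sigma> ! i @ \<beta> @ \<pi>) (EquC \<Delta> s)"
| "trans_trm L \<Delta> \<sigma> \<pi> \<beta> s (App f ts) =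
     graft \<Delta> (\<lambda>\<sigma>' \<pi>' \<beta>' s' t. trans_trm L \<Delta> \<sigma>' \<pi>' \<beta>' s' t) \<sigma> \<pi> \<beta> (fst (fun_type L f)) ts (FunC \<Delta> f)"

primrec trans_fm ::
  "('s, 'f, 'r) lang \<Rightarrow> ('s, 'f, 'r, 't, 'g, 'q) code \<Rightarrow> nat list list \<Rightarrow> nat list \<Rightarrow>
   ('s, 'f, 'r) fm \<Rightarrow> ('t, 'g, 'q) fm" where
  "trans_fm L \<Delta> \<sigma> \<pi> Tru = Tru"
| "trans_fm L \<Delta> \<sigma> \<pi> (Eq s t u) = graft \<Delta> (trans_trm L \<Delta>) \<sigma> \<pi> [] [s, s] [t, u] (EquC \<Delta> s)"
| "trans_fm L \<Delta> \<sigma> \<pi> (Rel r ts) = graft \<Delta> (trans_trm L \<Delta>) \<sigma> \<pi> [] (rel_type L r) ts (RelC \<Delta> r)"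
| "trans_fm L \<Delta> \<sigma> \<pi> (Neg \<phi>) = Neg (trans_fm L \<Delta> \<sigma> \<pi> \<phi>)"
| "trans_fm L \<Delta> \<sigma> \<pi> (And \<phi> \<psi>) = And (trans_fm L \<Delta> \<sigma> \<pi> \<phi>) (trans_fm L \<Delta> \<sigma> \<pi> \<psi>)"
| "trans_fm L \<Delta> \<sigma> \<pi> (Exi s \<phi>) =
     (let d = length (coord \<Delta> s); up = map (\<lambda>i. i + d) in
      Exs (coord \<Delta> s)
        (And (inst ([0..<d] @ up \<pi>) (DomC \<Delta> s)) (trans_fm L \<Delta> ([0..<d] # map up \<sigma>) (up \<pi>) \<phi>)))"

text \<open>The translation \<open>\<phi>\<^sub>\<Delta>\<close> of a formula \<open>\<phi>\<close> in variables of sorts \<open>ss\<close>. Its variables are the blocks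
  for those of \<open>\<phi>\<close>, which are required to lie in the domains of \<open>\<Delta>\<close>, and then the parameters.\<close>

definition translate ::
  "('s, 'f, 'r) lang \<Rightarrow> ('s, 'f, 'r, 't, 'g, 'q) code \<Rightarrow> 's list \<Rightarrow> ('s, 'f, 'r) fm \<Rightarrow> ('t, 'g, 'q) fm" where
  "translate L \<Delta> ss \<phi> =
     (let bs = blocks \<Delta> ss 0; n = length (coords \<Delta> ss); \<pi> = [n..<n + length (params \<Delta>)] in
      And (Ands (map (\<lambda>(s, b). inst (b @ \<pi>) (DomC \<Delta> s)) (zip ss bs))) (trans_fm L \<Delta> bs \<pi> \<phi>))"

text \<open>\<open>comp_code LA LB \<Gamma> \<Delta>\<close> is \<open>\<Gamma> \<circ> \<Delta>\<close>, where \<open>\<Gamma>\<close> interprets \<open>LA\<close> in \<open>LB\<close>. Its parameters are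
  representatives of the parameters of \<open>\<Gamma>\<close>, followed by the parameters of \<open>\<Delta>\<close>.\<close>

definition comp_code ::
  "('s, 'f, 'r) lang \<Rightarrow> ('t, 'g, 'q) lang \<Rightarrow> ('s, 'f, 'r, 't, 'g, 'q) code \<Rightarrow>
   ('t, 'g, 'q, 'w, 'h, 'k) code \<Rightarrow> ('s, 'f, 'r, 'w, 'h, 'k) code" where
  "comp_code LA LB \<Gamma> \<Delta> =
     \<lparr> params = coords \<Delta> (params \<Gamma>) @ params \<Delta>,
       coord = (\<lambda>s. coords \<Delta> (coord \<Gamma> s)),
       DomC = (\<lambda>s. translate LB \<Delta> (coord \<Gamma> s @ params \<Gamma>) (DomC \<Gamma> s)),
       EquC = (\<lambda>s. translate LB \<Delta> (coord \<Gamma> s @ coord \<Gamma> s @ params \<Gamma>) (EquC \<Gamma> s)),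
       FunC = (\<lambda>f. translate LB \<Delta>
                 (coords \<Gamma> (fst (fun_type LA f)) @ coord \<Gamma> (snd (fun_type LA f)) @ params \<Gamma>) (FunC \<Gamma> f)),
       RelC = (\<lambda>r. translate LB \<Delta> (coords \<Gamma> (rel_type LA r) @ params \<Gamma>) (RelC \<Gamma> r)) \<rparr>"

text \<open>The formula \<open>\<phi>\<^sub>\<Delta> \<and> \<psi>\<close> defining the admissible parameters of \<open>(\<Gamma>, \<phi>) \<circ> (\<Delta>, \<psi>)\<close>.\<close>

definition comp_adm ::
  "('t, 'g, 'q) lang \<Rightarrow> ('s, 'f, 'r, 't, 'g, 'q) code \<Rightarrow> ('t, 'g, 'q) fm \<Rightarrow>
   ('t, 'g, 'q, 'w, 'h, 'k) code \<Rightarrow> ('w, 'h, 'k) fm \<Rightarrow> ('w, 'h, 'k) fm" where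
  "comp_adm LB \<Gamma> \<phi> \<Delta> \<psi> =
     (let n = length (coords \<Delta> (params \<Gamma>)) in
      And (translate LB \<Delta> (params \<Gamma>) \<phi>) (inst [n..<n + length (params \<Delta>)] \<psi>))"

text \<open>Uniformly in the parameters \<open>r\<close> admitted by \<open>\<alpha>\<close>, the formulas \<open>\<theta> s (u, x, r)\<close> define (the
  graph of) a coordinate map from \<open>\<Xi>(A, r)\<close> to \<open>A\<close> itself.\<close>

definition defines_coordinate_maps ::
  "('s, 'f, 'r) lang \<Rightarrow> ('s, 'f, 'r, 'v) model \<Rightarrow> ('s, 'f, 'r, 's, 'f, 'r) code \<Rightarrow> ('s, 'f, 'r) fm \<Rightarrow>
   ('s \<Rightarrow> ('s, 'f, 'r) fm) \<Rightarrow> bool" where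
  "defines_coordinate_maps L A \<Xi> \<alpha> \<theta> \<longleftrightarrow>
     (\<forall>s. wff L (coord \<Xi> s @ [s] @ params \<Xi>) (\<theta> s)) \<and>
     (\<forall>r\<in>tuples (Carrier A) (params \<Xi>). sat A r \<alpha> \<longrightarrow>
        (\<exists>\<mu>. coordinate_map L \<Xi> A r A \<mu> \<and>
           (\<forall>s. \<forall>u\<in>tuples (Carrier A) (coord \<Xi> s). \<forall>x\<in>Carrier A s.
              sat A (u @ [x] @ r) (\<theta> s) \<longleftrightarrow> u \<in> dom_set \<Xi> A r s \<and> \<mu> s u = x)))"

definition regular_bi_interpretation ::
  "('s, 'f, 'r) lang \<Rightarrow> ('s, 'f, 'r, 'v) model \<Rightarrow> ('t, 'g, 'q) lang \<Rightarrow> ('t, 'g, 'q, 'u) model \<Rightarrow>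
   ('s, 'f, 'r, 't, 'g, 'q) code \<Rightarrow> ('t, 'g, 'q) fm \<Rightarrow> ('t, 'g, 'q, 's, 'f, 'r) code \<Rightarrow> ('s, 'f, 'r) fm \<Rightarrow>
   ('s \<Rightarrow> ('s, 'f, 'r) fm) \<Rightarrow> ('t \<Rightarrow> ('t, 'g, 'q) fm) \<Rightarrow> bool" where
  "regular_bi_interpretation LA A LB B \<Gamma> \<phi> \<Delta> \<psi> \<theta>A \<theta>B \<longleftrightarrow>
     regular_interpretation LA A LB B \<Gamma> \<phi> \<and>
     regular_interpretation LB B LA A \<Delta> \<psi> \<and>
     defines_coordinate_maps LA A (comp_code LA LB \<Gamma> \<Delta>) (comp_adm LB \<Gamma> \<phi> \<Delta> \<psi>) \<theta>A \<and>
     defines_coordinate_maps LB B (comp_code LB LA \<Delta> \<Gamma>) (comp_adm LA \<Delta> \<psi> \<Gamma> \<phi>) \<theta>B"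


section \<open>The ring of Laurent polynomials\<close>

datatype ring_fun = RZero | ROne | RAdd | RMul

definition ring_lang :: "(unit, ring_fun, unit) lang" where
  "ring_lang =
     \<lparr> funs = UNIV, rels = {},
       fun_type = (\<lambda>f. case f of RZero \<Rightarrow> ([], ()) | ROne \<Rightarrow> ([], ())
                              | RAdd \<Rightarrow> ([(), ()], ()) | RMul \<Rightarrow> ([(), ()], ())),
       rel_type = (\<lambda>_. []) \<rparr>"

text \<open>\<open>int \<Rightarrow>\<^sub>0 'a\<close> with its convolution product is the ring of Laurent polynomials, the
  monomial \<open>a x\<^sup>k\<close> being \<open>Poly_Mapping.single k a\<close>.\<close>

fun laurent_fun :: "ring_fun \<Rightarrow> (int \<Rightarrow>\<^sub>0 'a::field) list \<Rightarrow> (int \<Rightarrow>\<^sub>0 'a)" where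
  "laurent_fun RZero [] = 0"
| "laurent_fun ROne [] = 1"
| "laurent_fun RAdd [f, g] = f + g"
| "laurent_fun RMul [f, g] = f * g"
| "laurent_fun _ _ = undefined"

definition laurent_ring :: "(unit, ring_fun, unit, int \<Rightarrow>\<^sub>0 'a::field) model" where
  "laurent_ring = \<lparr> Carrier = (\<lambda>_. UNIV), FunI = laurent_fun, RelI = (\<lambda>_ _. False) \<rparr>"


section \<open>The list superstructure\<close>

datatype list_sort = FieldS | ListS | NatS

datatype list_fun = FZero | FOne | FAdd | FMul | NZero | NOne | NAdd | NMul | Len

datatype list_rel = At

definition list_lang :: "(list_sort, list_fun, list_rel) lang" where
  "list_lang =
     \<lparr> funs = UNIV, rels = UNIV,
       fun_type = (\<lambda>f. case f of
            FZero \<Rightarrow> ([], FieldS) | FOne \<Rightarrow> ([], FieldS)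
          | FAdd \<Rightarrow> ([FieldS, FieldS], FieldS) | FMul \<Rightarrow> ([FieldS, FieldS], FieldS)
          | NZero \<Rightarrow> ([], NatS) | NOne \<Rightarrow> ([], NatS)
          | NAdd \<Rightarrow> ([NatS, NatS], NatS) | NMul \<Rightarrow> ([NatS, NatS], NatS)
          | Len \<Rightarrow> ([ListS], NatS)),
       rel_type = (\<lambda>_. [ListS, FieldS, NatS]) \<rparr>"

datatype 'a list_elem = Fld 'a | Lst "'a list" | Num nat

fun super_fun :: "list_fun \<Rightarrow> 'a::field list_elem list \<Rightarrow> 'a list_elem" where
  "super_fun FZero [] = Fld 0"
| "super_fun FOne [] = Fld 1"
| "super_fun FAdd [Fld a, Fld b] = Fld (a + b)"
| "super_fun FMul [Fld a, Fld b] = Fld (a * b)"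
| "super_fun NZero [] = Num 0"
| "super_fun NOne [] = Num 1"
| "super_fun NAdd [Num m, Num n] = Num (m + n)"
| "super_fun NMul [Num m, Num n] = Num (m * n)"
| "super_fun Len [Lst s] = Num (length s)"
| "super_fun _ _ = undefined"

text \<open>The predicate \<open>t(s, a, i)\<close>; components of a tuple are numbered from 1.\<close>

fun super_rel :: "list_rel \<Rightarrow> 'a list_elem list \<Rightarrow> bool" where
  "super_rel At [Lst s, Fld a, Num i] \<longleftrightarrow> 1 \<le> i \<and> i \<le> length s \<and> s ! (i - 1) = a"
| "super_rel At _ \<longleftrightarrow> False"

definition list_super :: "(list_sort, list_fun, list_rel, 'a::field list_elem) model" where
  "list_super =
     \<lparr> Carrier = (\<lambda>s. case s of FieldS \<Rightarrow> range Fld | ListS \<Rightarrow> range Lst | NatS \<Rightarrow> range Num),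
       FunI = super_fun, RelI = super_rel \<rparr>"


section \<open>The interpretation of Laurent polynomials by pairs of tuples\<close>

type_synonym list_fm = "(list_sort, list_fun, list_rel) fm"

abbreviation n_succ :: "list_fun trm \<Rightarrow> list_fun trm" where
  "n_succ t \<equiv> App NAdd [t, App NOne []]"

text \<open>Free variables \<open>s, i, a\<close>: the \<open>i\<close>-th component of \<open>s\<close>, prolonged by zeros, is \<open>a\<close>.\<close>

definition entry_fm :: list_fm where
  "entry_fm =
     Or (Rel At [Var 0, Var 2, Var 1])
        (And (Eq FieldS (Var 2) (App FZero [])) (Neg (Exi FieldS (Rel At [Var 1, Var 0, Var 2]))))"

text \<open>Free variables \<open>p, q, k, l, a\<close>: the coefficient of \<open>x\<^bsup>k - l\<^esup>\<close> in the Laurent polynomial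
  represented by \<open>(p, q)\<close> is \<open>a\<close>. If \<open>l \<le> k\<close>, it is the component \<open>k - l + 1\<close> of \<open>p\<close>, otherwise
  the component \<open>l - k\<close> of \<open>q\<close>.\<close>

definition coeff_fm :: list_fm where
  "coeff_fm =
     Or (Exi NatS (Ands [Neg (Eq NatS (Var 0) (App NZero [])),
            Eq NatS (n_succ (Var 3)) (App NAdd [Var 4, Var 0]), inst [1, 0, 5] entry_fm]))
        (Exi NatS (Ands [Neg (Eq NatS (Var 0) (App NZero [])),
            Eq NatS (Var 4) (App NAdd [Var 3, Var 0]), inst [2, 0, 5] entry_fm]))"

text \<open>Free variables \<open>s, s'\<close>: equality up to appending zeros.\<close>

definition pad_eq_fm :: list_fm where
  "pad_eq_fm = Fall NatS (Fall FieldS (Iff (inst [2, 1, 0] entry_fm) (inst [3, 1, 0] entry_fm)))"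

definition zero_fm :: list_fm where
  "zero_fm = Fall NatS (Fall NatS (Fall FieldS
     (Imp (inst [3, 4, 2, 1, 0] coeff_fm) (Eq FieldS (Var 0) (App FZero [])))))"

definition one_fm :: list_fm where
  "one_fm = Fall NatS (Fall NatS (Fall FieldS
     (Imp (inst [3, 4, 2, 1, 0] coeff_fm)
       (Or (And (Eq NatS (Var 2) (Var 1)) (Eq FieldS (Var 0) (App FOne [])))
           (And (Neg (Eq NatS (Var 2) (Var 1))) (Eq FieldS (Var 0) (App FZero [])))))))"

text \<open>Free variables \<open>p\<^sub>1, q\<^sub>1, p\<^sub>2, q\<^sub>2, p\<^sub>3, q\<^sub>3\<close>; bound variables \<open>k, l, a, b, c\<close>, from the outside.\<close>

definition add_fm :: list_fm where
  "add_fm = Fall NatS (Fall NatS (Fall FieldS (Fall FieldS (Fall FieldS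
     (Imp (Ands [inst [5, 6, 4, 3, 2] coeff_fm, inst [7, 8, 4, 3, 1] coeff_fm,
                 inst [9, 10, 4, 3, 0] coeff_fm])
          (Eq FieldS (Var 0) (App FAdd [Var 2, Var 1])))))))"

text \<open>Free variables \<open>p\<^sub>1, q\<^sub>1, p\<^sub>2, q\<^sub>2, p\<^sub>3, q\<^sub>3\<close>. For every \<open>M\<close> that bounds the lengths of \<open>q\<^sub>1\<close> and
  \<open>q\<^sub>2\<close>, and every \<open>w\<close>, the coefficient \<open>c\<close> of \<open>x\<^bsup>w - 2M\<^esup>\<close> in the third polynomial is the sum over
  \<open>u + v = w\<close> of the products of the coefficients of \<open>x\<^bsup>u - M\<^esup>\<close> and \<open>x\<^bsup>v - M\<^esup>\<close> in the first two. A tuple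
  \<open>s\<close> of length at least \<open>w + 2\<close>, starting with 0, records the partial sums. The bound variables
  are, from the outside, \<open>M\<close>; \<open>w, m = 2M, c\<close>; \<open>s\<close>; \<open>u, v\<close>; \<open>a, b, y\<close>.\<close>

definition mul_fm :: list_fm where
  "mul_fm = Fall NatS
     (Imp (And (Exi NatS (Eq NatS (App NAdd [App Len [Var 3], Var 0]) (Var 1)))
               (Exi NatS (Eq NatS (App NAdd [App Len [Var 5], Var 0]) (Var 1))))
      (Fall NatS (Fall NatS (Fall FieldS
        (Imp (And (Eq NatS (Var 1) (App NAdd [Var 3, Var 3])) (inst [8, 9, 2, 1, 0] coeff_fm))
         (Exi ListS (Ands
           [Rel At [Var 0, App FZero [], App NOne []],
            Rel At [Var 0, Var 1, n_succ (n_succ (Var 3))],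
            Fall NatS (Fall NatS (Imp (Eq NatS (App NAdd [Var 1, Var 0]) (Var 5))
              (Exi FieldS (Exi FieldS (Exi FieldS (Ands
                [inst [10, 11, 4, 9, 2] coeff_fm,
                 inst [12, 13, 3, 9, 1] coeff_fm,
                 Rel At [Var 5, Var 0, n_succ (Var 4)],
                 Rel At [Var 5, App FAdd [Var 0, App FMul [Var 2, Var 1]], n_succ (n_succ (Var 4))]
                ]))))))])))))))"

text \<open>The first tuple of a pair is \<open>(a\<^sub>0, \<dots>, a\<^sub>n)\<close>, hence nonempty, while the second one may be
  empty. There are no parameters.\<close>

definition Gamma0 :: "(unit, ring_fun, unit, list_sort, list_fun, list_rel) code" where
  "Gamma0 =
     \<lparr> params = [],
       coord = (\<lambda>_. [ListS, ListS]),
       DomC = (\<lambda>_. Neg (Eq NatS (App Len [Var 0]) (App NZero []))),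
       EquC = (\<lambda>_. And (inst [0, 2] pad_eq_fm) (inst [1, 3] pad_eq_fm)),
       FunC = (\<lambda>f. case f of RZero \<Rightarrow> zero_fm | ROne \<Rightarrow> one_fm | RAdd \<Rightarrow> add_fm | RMul \<Rightarrow> mul_fm),
       RelC = (\<lambda>_. Tru) \<rparr>"

fun laurent_of :: "'a::field list_elem list \<Rightarrow> (int \<Rightarrow>\<^sub>0 'a)" where
  "laurent_of [Lst p, Lst q] =
     (\<Sum>i<length p. Poly_Mapping.single (int i) (p ! i)) +
     (\<Sum>j<length q. Poly_Mapping.single (- int (j + 1)) (q ! j))"
| "laurent_of _ = undefined"

end

theory Submission
  imports Defs
begin

text \<open>
  Fix a generator \<open>t = x\<close> of \<open>F[x, x\<^sup>-\<^sup>1]\<close>; the other admissible parameters \<open>c x\<^sup>\<plusminus>\<^sup>1\<close> are its images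
  under automorphisms. The field is definable through units, and a number \<open>n\<close> is represented by
  \<open>t\<^sup>n\<close>: addition is multiplication, divisibility of exponents is divisibility of \<open>t\<^sup>k - 1\<close>, and
  this suffices to define squares and hence products. A list \<open>a\<^sub>1, \<dots>, a\<^sub>n\<close> over \<open>F\<close> is coded by
  \<open>(f, h, t\<^sup>n)\<close> with \<open>f \<equiv> a\<^sub>i\<close> modulo \<open>1 + t\<^sup>i h\<close>; these moduli are pairwise comaximal as soon as \<open>h\<close>
  is divisible by all \<open>t\<^sup>d - 1\<close> with \<open>1 \<le> d < n\<close>, so every list has a code by the Chinese remainder
  theorem. Finite sets of exponents are coded likewise, which separates \<open>\<nat>\<close> from \<open>\<int>\<close>.

  An element of the ring is recovered from its coded coefficient lists by comparing values at all
  nonzero \<open>\<alpha> \<in> F\<close>, computed by Horner's scheme inside the list superstructure; here \<open>F\<close> has to be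
  infinite. In the other direction, \<open>n\<close> is read off from the support of \<open>t\<^sup>n\<close>.
\<close>

section \<open>Renaming and well-formedness\<close>

text \<open>The automorphisms x |-> c x^\<epsilon> with \<epsilon> = +-1 preserve the truth of every
  formula, so no formula without parameters can single out x. This forces the parameter t and also
  pays for it: a formula verified at t = x is correct at every admissible t, with the coordinate map
  conjugated by an automorphism. On the list side the parameter is a pair of tuples representing c
  x^\<epsilon>, and the defining formulas have to recover \<epsilon> while disregarding c. A list
  code is not asked to have the moduli of the construction; it is enough that each index has exactly
  one constant residue. Uniqueness rests on nonzero constants being units and moduli being
  non-units, which is the second demand on h beside comaximality. Quotients are confined to a single
  step. The predicate \<open>realizes\<close> speaks about representatives only; it survives
  composition of codes and transport along automorphisms, and it yields a coordinate map at the
  end.\<close>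

lemma has_sort_Var [simp]: "has_sort L \<Sigma> (Var i) s \<longleftrightarrow> i < length \<Sigma> \<and> s = \<Sigma> ! i"
  by (subst has_sort.simps) auto

lemma has_sort_App [simp]:
  "has_sort L \<Sigma> (App f ts) s \<longleftrightarrow>
     f \<in> funs L \<and> list_all2 (has_sort L \<Sigma>) ts (fst (fun_type L f)) \<and> s = snd (fun_type L f)"
  by (subst has_sort.simps) auto

lemma list_all2_set1: "list_all2 P xs ys \<Longrightarrow> x \<in> set xs \<Longrightarrow> \<exists>y. P x y"
  by (auto simp: list_all2_conv_all_nth in_set_conv_nth)

lemma tval_ren:
  assumes "has_sort L \<Sigma> t s" and "\<And>i. i < length \<Sigma> \<Longrightarrow> xs ! \<rho> i = ys ! i"
  shows "tval M xs (ren_trm \<rho> t) = tval M ys t"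
  using assms
proof (induction t arbitrary: s)
  case (App f ts)
  have "\<forall>t\<in>set ts. tval M xs (ren_trm \<rho> t) = tval M ys t"
    using App.prems App.IH by (metis has_sort_App list_all2_set1)
  then show ?case by (simp add: comp_def cong: map_cong)
qed auto

lemma has_sort_ren:
  assumes "has_sort L \<Sigma> t s" and "\<And>i. i < length \<Sigma> \<Longrightarrow> \<rho> i < length \<Sigma>' \<and> \<Sigma>' ! \<rho> i = \<Sigma> ! i"
  shows "has_sort L \<Sigma>' (ren_trm \<rho> t) s"
  using assms by (induction t arbitrary: s) (auto simp: list_all2_conv_all_nth)

text \<open>Agreement is required only below \<open>length \<Sigma>\<close>: the renamings in use
  have the form \<open>\<lambda>i. vs ! i\<close>, which is unspecified beyond the list, and
  well-formedness guarantees that no such index occurs.\<close>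

lemma sat_ren:
  assumes "wff L \<Sigma> \<phi>" and "\<And>i. i < length \<Sigma> \<Longrightarrow> xs ! \<rho> i = ys ! i"
  shows "sat M xs (ren \<rho> \<phi>) \<longleftrightarrow> sat M ys \<phi>"
  using assms
proof (induction \<phi> arbitrary: \<Sigma> \<rho> xs ys)
  case (Eq s t u)
  then show ?case using tval_ren[of L \<Sigma> t s xs \<rho> ys M] tval_ren[of L \<Sigma> u s xs \<rho> ys M] by simp
next
  case (Rel r ts)
  then have "\<forall>t\<in>set ts. tval M xs (ren_trm \<rho> t) = tval M ys t"
    by (metis wff.simps(3) list_all2_set1 tval_ren)
  then show ?case by (simp add: comp_def cong: map_cong)
next
  case (Exi s \<phi>)
  have "sat M (x # xs) (ren (case_nat 0 (\<lambda>i. Suc (\<rho> i))) \<phi>) \<longleftrightarrow> sat M (x # ys) \<phi>" for x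
    using Exi.prems by (intro Exi.IH[of "s # \<Sigma>"]) (auto split: nat.splits simp: nth_Cons)
  then show ?case by simp
next
  case (And \<phi>1 \<phi>2)
  then show ?case by (metis wff.simps(5) ren.simps(5) sat.simps(5))
next
  case (Neg \<phi>)
  then show ?case by (metis wff.simps(4) ren.simps(4) sat.simps(4))
qed auto

lemma wff_ren:
  assumes "wff L \<Sigma> \<phi>" and "\<And>i. i < length \<Sigma> \<Longrightarrow> \<rho> i < length \<Sigma>' \<and> \<Sigma>' ! \<rho> i = \<Sigma> ! i"
  shows "wff L \<Sigma>' (ren \<rho> \<phi>)"
  using assms
proof (induction \<phi> arbitrary: \<Sigma> \<Sigma>' \<rho>)
  case (Exi s \<phi>)
  show ?case
    using Exi.prems by (auto intro!: Exi.IH[of "s # \<Sigma>"] simp: nth_Cons split: nat.splits)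
qed (auto simp: list_all2_conv_all_nth intro!: has_sort_ren)

text \<open>Makes every named formula a black box: once its truth on its own list of free variables
  is known, each later occurrence under quantifiers is evaluated by looking up the listed
  positions.\<close>

lemma sat_inst:
  assumes "wff L \<Sigma> \<phi>" and "length vs = length \<Sigma>"
  shows "sat M xs (inst vs \<phi>) \<longleftrightarrow> sat M (map ((!) xs) vs) \<phi>"
  unfolding inst_def using assms by (intro sat_ren) auto

lemma wff_inst:
  assumes "wff L \<Sigma> \<phi>" and "list_all2 (\<lambda>v s. v < length \<Sigma>' \<and> \<Sigma>' ! v = s) vs \<Sigma>"
  shows "wff L \<Sigma>' (inst vs \<phi>)"
  unfolding inst_def using assms by (intro wff_ren) (auto simp: list_all2_conv_all_nth)

lemma sat_connectives [simp]:
  "sat M xs (Or \<phi> \<psi>) \<longleftrightarrow> sat M xs \<phi> \<or> sat M xs \<psi>"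
  "sat M xs (Imp \<phi> \<psi>) \<longleftrightarrow> (sat M xs \<phi> \<longrightarrow> sat M xs \<psi>)"
  "sat M xs (Iff \<phi> \<psi>) \<longleftrightarrow> (sat M xs \<phi> \<longleftrightarrow> sat M xs \<psi>)"
  "sat M xs (Fall s \<phi>) \<longleftrightarrow> (\<forall>x\<in>Carrier M s. sat M (x # xs) \<phi>)"
  by (auto simp: Or_def Imp_def Iff_def Fall_def)

lemma sat_Ands [simp]: "sat M xs (Ands \<phi>s) \<longleftrightarrow> (\<forall>\<phi>\<in>set \<phi>s. sat M xs \<phi>)"
  by (induction \<phi>s) auto

lemma wff_connectives [simp]:
  "wff L \<Sigma> (Or \<phi> \<psi>) \<longleftrightarrow> wff L \<Sigma> \<phi> \<and> wff L \<Sigma> \<psi>"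
  "wff L \<Sigma> (Imp \<phi> \<psi>) \<longleftrightarrow> wff L \<Sigma> \<phi> \<and> wff L \<Sigma> \<psi>"
  "wff L \<Sigma> (Iff \<phi> \<psi>) \<longleftrightarrow> wff L \<Sigma> \<phi> \<and> wff L \<Sigma> \<psi>"
  "wff L \<Sigma> (Fall s \<phi>) \<longleftrightarrow> wff L (s # \<Sigma>) \<phi>"
  by (auto simp: Or_def Imp_def Iff_def Fall_def)

lemma wff_Ands [simp]: "wff L \<Sigma> (Ands \<phi>s) \<longleftrightarrow> (\<forall>\<phi>\<in>set \<phi>s. wff L \<Sigma> \<phi>)"
  by (induction \<phi>s) auto

section \<open>Tuples of sorted elements and blocks of quantifiers\<close>

lemma tuples_Nil [simp]: "tuples C [] = {[]}"
  by (auto simp: tuples_def)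

lemma Cons_in_tuples [simp]: "x # xs \<in> tuples C (s # ss) \<longleftrightarrow> x \<in> C s \<and> xs \<in> tuples C ss"
  by (simp add: tuples_def)

lemma in_tuples_Cons: "xs \<in> tuples C (s # ss) \<longleftrightarrow> (\<exists>y ys. xs = y # ys \<and> y \<in> C s \<and> ys \<in> tuples C ss)"
  by (auto simp: tuples_def list_all2_Cons2)

lemma in_tuples_append:
  "xs \<in> tuples C (ss @ ts) \<longleftrightarrow> (\<exists>ys zs. xs = ys @ zs \<and> ys \<in> tuples C ss \<and> zs \<in> tuples C ts)"
proof (induction ss arbitrary: xs)
  case (Cons s ss)
  show ?case by (auto simp: in_tuples_Cons Cons.IH) (metis append_Cons)+
qed simp

lemma append_in_tuples:
  "ys \<in> tuples C ss \<Longrightarrow> zs \<in> tuples C ts \<Longrightarrow> ys @ zs \<in> tuples C (ss @ ts)"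
  by (auto simp: in_tuples_append)

lemma append_in_tuples_iff:
  "length ys = length ss \<Longrightarrow> ys @ zs \<in> tuples C (ss @ ts) \<longleftrightarrow> ys \<in> tuples C ss \<and> zs \<in> tuples C ts"
  by (simp add: tuples_def list_all2_append)

lemma length_tuples: "xs \<in> tuples C ss \<Longrightarrow> length xs = length ss"
  by (auto simp: tuples_def dest: list_all2_lengthD)

lemma Exs_Nil [simp]: "Exs [] \<phi> = \<phi>" and Exs_Cons: "Exs (s # ss) \<phi> = Exs ss (Exi s \<phi>)"
  by (simp_all add: Exs_def)

text \<open>\<open>Exs\<close> folds from the left, so the first sort is bound innermost and is
  \<open>Var 0\<close>; the witnesses therefore stand in front of the valuation as one tuple in the
  given order.\<close>

lemma sat_Exs: "sat M xs (Exs ss \<phi>) \<longleftrightarrow> (\<exists>ys\<in>tuples (Carrier M) ss. sat M (ys @ xs) \<phi>)"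
proof (induction ss arbitrary: \<phi>)
  case (Cons s ss)
  show ?case
    by (simp add: Exs_Cons Cons.IH in_tuples_Cons Bex_def) (metis append_Cons)
qed simp

lemma wff_Exs: "wff L \<Sigma> (Exs ss \<phi>) \<longleftrightarrow> wff L (ss @ \<Sigma>) \<phi>"
  by (induction ss arbitrary: \<phi>) (auto simp: Exs_Cons)

section \<open>Semantic description of an interpretation\<close>

text \<open>Working form of a coordinate map, phrased through representatives alone. Quotient
  classes and definite descriptions enter only when a coordinate map is extracted from it.\<close>

definition realizes ::
  "('s, 'f, 'r) lang \<Rightarrow> ('s, 'f, 'r, 't, 'g, 'q) code \<Rightarrow> ('t, 'g, 'q, 'u) model \<Rightarrow> 'u list \<Rightarrow>
   ('s, 'f, 'r, 'v) model \<Rightarrow> ('s \<Rightarrow> 'u list \<Rightarrow> 'v) \<Rightarrow> bool" where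
  "realizes L \<Gamma> B p A \<mu> \<longleftrightarrow>
     (\<forall>s. \<mu> s ` dom_set \<Gamma> B p s = Carrier A s) \<and>
     (\<forall>s. \<forall>u\<in>dom_set \<Gamma> B p s. \<forall>v\<in>dom_set \<Gamma> B p s.
        sat B (u @ v @ p) (EquC \<Gamma> s) \<longleftrightarrow> \<mu> s u = \<mu> s v) \<and>
     (\<forall>f\<in>funs L. \<forall>us\<in>tuples (dom_set \<Gamma> B p) (fst (fun_type L f)).
        \<forall>v\<in>dom_set \<Gamma> B p (snd (fun_type L f)).
          sat B (concat us @ v @ p) (FunC \<Gamma> f) \<longleftrightarrow>
          \<mu> (snd (fun_type L f)) v = FunI A f (map2 \<mu> (fst (fun_type L f)) us)) \<and>
     (\<forall>f\<in>funs L. \<forall>xs\<in>tuples (Carrier A) (fst (fun_type L f)).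
        FunI A f xs \<in> Carrier A (snd (fun_type L f))) \<and>
     (\<forall>r\<in>rels L. \<forall>us\<in>tuples (dom_set \<Gamma> B p) (rel_type L r).
        sat B (concat us @ p) (RelC \<Gamma> r) \<longleftrightarrow> RelI A r (map2 \<mu> (rel_type L r) us))"

lemma realizesD:
  assumes "realizes L \<Gamma> B p A \<mu>"
  shows realizes_image: "\<mu> s ` dom_set \<Gamma> B p s = Carrier A s"
    and realizes_Equ: "u \<in> dom_set \<Gamma> B p s \<Longrightarrow> v \<in> dom_set \<Gamma> B p s \<Longrightarrow>
          sat B (u @ v @ p) (EquC \<Gamma> s) \<longleftrightarrow> \<mu> s u = \<mu> s v"
    and realizes_Fun: "f \<in> funs L \<Longrightarrow> us \<in> tuples (dom_set \<Gamma> B p) (fst (fun_type L f)) \<Longrightarrow>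
          v \<in> dom_set \<Gamma> B p (snd (fun_type L f)) \<Longrightarrow>
          sat B (concat us @ v @ p) (FunC \<Gamma> f) \<longleftrightarrow>
          \<mu> (snd (fun_type L f)) v = FunI A f (map2 \<mu> (fst (fun_type L f)) us)"
    and realizes_closed: "f \<in> funs L \<Longrightarrow> xs \<in> tuples (Carrier A) (fst (fun_type L f)) \<Longrightarrow>
          FunI A f xs \<in> Carrier A (snd (fun_type L f))"
    and realizes_Rel: "r \<in> rels L \<Longrightarrow> us \<in> tuples (dom_set \<Gamma> B p) (rel_type L r) \<Longrightarrow>
          sat B (concat us @ p) (RelC \<Gamma> r) \<longleftrightarrow> RelI A r (map2 \<mu> (rel_type L r) us)"
  using assms by (auto simp: realizes_def)

lemma map2_in_tuples:
  assumes "us \<in> tuples D ss" and "\<And>s u. u \<in> D s \<Longrightarrow> \<mu> s u \<in> C s"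
  shows "map2 \<mu> ss us \<in> tuples C ss"
  using assms by (auto simp: tuples_def list_all2_conv_all_nth)

lemma tuples_imageE:
  assumes "xs \<in> tuples C ss" and "\<And>s. C s \<subseteq> \<mu> s ` D s"
  obtains us where "us \<in> tuples D ss" "map2 \<mu> ss us = xs"
proof -
  have "\<exists>us. us \<in> tuples D ss \<and> map2 \<mu> ss us = xs"
    using assms(1)
  proof (induction ss arbitrary: xs)
    case (Cons s ss)
    then obtain y ys where y: "xs = y # ys" "y \<in> C s" "ys \<in> tuples C ss" by (auto simp: in_tuples_Cons)
    from Cons.IH[OF y(3)] obtain us where us: "us \<in> tuples D ss" "map2 \<mu> ss us = ys" by blast
    from y(2) assms(2) obtain u where "u \<in> D s" "\<mu> s u = y" by blast
    with us y show ?case by (intro exI[of _ "u # us"]) simp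
  qed simp
  then show ?thesis using that by blast
qed

text \<open>The equivalence relation of the code is the kernel of \<open>\<mu>\<close>, so
  \<open>\<mu>\<close> factors through the quotient and the induced map is the isomorphism. The
  congruence conditions hold because both sides depend on \<open>\<mu>\<close>-values only.\<close>

lemma realizes_imp_coordinate_map:
  assumes R: "realizes L \<Gamma> B p A \<mu>"
  shows "coordinate_map L \<Gamma> B p A \<mu>"
proof -
  let ?D = "dom_set \<Gamma> B p" and ?E = "equ_rel \<Gamma> B p"
  note im = realizes_image[OF R] and eq = realizes_Equ[OF R] and fn = realizes_Fun[OF R]
    and cl = realizes_closed[OF R] and rl = realizes_Rel[OF R]
  have mem: "\<mu> s u \<in> Carrier A s" if "u \<in> ?D s" for s u using im that by blast
  have E: "?E s = {(u, v). u \<in> ?D s \<and> v \<in> ?D s \<and> \<mu> s u = \<mu> s v}" for s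
    unfolding equ_rel_def using eq by blast
  have equiv: "equiv (?D s) (?E s)" for s
    unfolding E by (auto intro!: equivI simp: refl_on_def sym_def trans_def)
  have pairs: "map fst ps \<in> tuples ?D ss \<and> map snd ps \<in> tuples ?D ss \<and>
      map2 \<mu> ss (map fst ps) = map2 \<mu> ss (map snd ps)" if "ps \<in> tuples ?E ss" for ps ss
    using that by (auto simp: tuples_def list_all2_conv_all_nth E intro!: nth_equalityI)
  have wd: "well_defined L \<Gamma> B p"
    unfolding well_defined_def
  proof (intro conjI allI ballI)
    show "equiv (?D s) (?E s)" for s by (rule equiv)
  next
    fix f ps x assume *: "f \<in> funs L" "ps \<in> tuples ?E (fst (fun_type L f))" "x \<in> ?E (snd (fun_type L f))"
    then obtain v v' where x: "x = (v, v')" "v \<in> ?D (snd (fun_type L f))" "v' \<in> ?D (snd (fun_type L f))"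
      "\<mu> (snd (fun_type L f)) v = \<mu> (snd (fun_type L f)) v'" by (auto simp: E)
    show "case x of (v, v') \<Rightarrow> sat B (concat (map fst ps) @ v @ p) (FunC \<Gamma> f) =
             sat B (concat (map snd ps) @ v' @ p) (FunC \<Gamma> f)"
      using pairs[OF *(2)] fn[OF *(1)] x by simp
  next
    fix f us assume *: "f \<in> funs L" "us \<in> tuples ?D (fst (fun_type L f))"
    have "FunI A f (map2 \<mu> (fst (fun_type L f)) us) \<in> Carrier A (snd (fun_type L f))"
      using * mem by (intro cl map2_in_tuples) auto
    then obtain v where "v \<in> ?D (snd (fun_type L f))"
      "\<mu> (snd (fun_type L f)) v = FunI A f (map2 \<mu> (fst (fun_type L f)) us)" using im by (metis imageE)
    then show "\<exists>v\<in>?D (snd (fun_type L f)). sat B (concat us @ v @ p) (FunC \<Gamma> f)" using fn * by blast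
  next
    fix f us v v' assume *: "f \<in> funs L" "us \<in> tuples ?D (fst (fun_type L f))"
      "v \<in> ?D (snd (fun_type L f))" "v' \<in> ?D (snd (fun_type L f))"
    show "sat B (concat us @ v @ p) (FunC \<Gamma> f) \<longrightarrow> sat B (concat us @ v' @ p) (FunC \<Gamma> f) \<longrightarrow>
           (v, v') \<in> ?E (snd (fun_type L f))" using fn * by (simp add: E)
  next
    fix r ps assume *: "r \<in> rels L" "ps \<in> tuples ?E (rel_type L r)"
    show "sat B (concat (map fst ps) @ p) (RelC \<Gamma> r) = sat B (concat (map snd ps) @ p) (RelC \<Gamma> r)"
      using pairs[OF *(2)] rl[OF *(1)] by simp
  qed
  \<comment> \<open>Any choice of representative serves, because \<open>\<mu>\<close> is constant on
    classes.\<close>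
  define h where "h s X = \<mu> s (SOME u. u \<in> X)" for s X
  have cls: "?E s `` {u} = {v \<in> ?D s. \<mu> s v = \<mu> s u}" if "u \<in> ?D s" for s u
    using that by (auto simp: E)
  have h: "h s X = \<mu> s u" if X: "X \<in> ?D s // ?E s" and u: "u \<in> X" for s X u
  proof -
    obtain w where w: "w \<in> ?D s" "X = ?E s `` {w}" using X by (auto elim: quotientE)
    have "(SOME u. u \<in> X) \<in> X" using u by (rule someI)
    with u show ?thesis unfolding h_def w cls[OF w(1)] by simp
  qed
  have sub: "u \<in> ?D s" if "X \<in> ?D s // ?E s" "u \<in> X" for s X u
    using that by (auto elim!: quotientE simp: E)
  have hu: "\<mu> s u = h s (?E s `` {u})" if "u \<in> ?D s" for s u
    using that h[OF quotientI[OF that], of u] by (simp add: cls)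
  have bij: "bij_betw (h s) (?D s // ?E s) (Carrier A s)" for s
  proof (intro bij_betw_imageI inj_onI)
    fix X Y assume XY: "X \<in> ?D s // ?E s" "Y \<in> ?D s // ?E s" "h s X = h s Y"
    obtain u v where "X = ?E s `` {u}" "Y = ?E s `` {v}" "u \<in> ?D s" "v \<in> ?D s"
      using XY by (auto elim!: quotientE)
    moreover from calculation have "\<mu> s u = \<mu> s v" using XY(3) hu by metis
    ultimately show "X = Y" by (simp add: cls)
  next
    show "h s ` (?D s // ?E s) = Carrier A s"
    proof (intro equalityI subsetI)
      fix a assume "a \<in> h s ` (?D s // ?E s)"
      then obtain u where "u \<in> ?D s" "a = h s (?E s `` {u})" by (auto elim!: quotientE)
      then show "a \<in> Carrier A s" using mem hu by metis
    next
      fix a assume "a \<in> Carrier A s"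
      then obtain u where "u \<in> ?D s" "a = \<mu> s u" using im by (metis imageE)
      then show "a \<in> h s ` (?D s // ?E s)" using hu by (metis imageI quotientI)
    qed
  qed
  have reps: "us \<in> tuples ?D ss \<and> map2 \<mu> ss us = map2 h ss Xs"
    if "Xs \<in> tuples (\<lambda>s. ?D s // ?E s) ss" "list_all2 (\<in>) us Xs" for us Xs ss
    using that by (auto simp: tuples_def list_all2_conv_all_nth h sub intro!: nth_equalityI)
  have exreps: "\<exists>us. list_all2 (\<in>) us Xs" if "Xs \<in> tuples (\<lambda>s. ?D s // ?E s) ss" for Xs ss
  proof -
    have "\<forall>X\<in>set Xs. \<exists>u. u \<in> X"
    proof
      fix X assume "X \<in> set Xs"
      with that obtain s where "X \<in> ?D s // ?E s"
        unfolding tuples_def by (auto dest: list_all2_set1)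
      then show "\<exists>u. u \<in> X" using in_quotient_imp_non_empty[OF equiv] by blast
    qed
    then obtain c where "\<forall>X\<in>set Xs. c X \<in> X" by metis
    then show ?thesis by (intro exI[of _ "map c Xs"]) (auto simp: list_all2_conv_all_nth)
  qed
  have iso: "is_iso L (interp L \<Gamma> B p) A h"
    unfolding is_iso_def
  proof (intro conjI ballI allI)
    show "bij_betw (h s) (Carrier (interp L \<Gamma> B p) s) (Carrier A s)" for s
      using bij by (simp add: interp_def)
  next
    fix f Xs assume f: "f \<in> funs L" and "Xs \<in> tuples (Carrier (interp L \<Gamma> B p)) (fst (fun_type L f))"
    then have Xs: "Xs \<in> tuples (\<lambda>s. ?D s // ?E s) (fst (fun_type L f))" by (simp add: interp_def)
    let ?s = "snd (fun_type L f)"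
    let ?a = "FunI A f (map2 h (fst (fun_type L f)) Xs)"
    let ?P = "\<lambda>Y. Y \<in> ?D ?s // ?E ?s \<and>
          (\<exists>us v. list_all2 (\<in>) us Xs \<and> v \<in> Y \<and> sat B (concat us @ v @ p) (FunC \<Gamma> f))"
    \<comment> \<open>The condition on representatives becomes an equation for \<open>h\<close>, so
      bijectivity of \<open>h\<close> supplies the unique class that \<open>THE\<close> asks
      for.\<close>
    have P: "?P Y \<longleftrightarrow> Y \<in> ?D ?s // ?E ?s \<and> h ?s Y = ?a" for Y
    proof
      assume "?P Y"
      then obtain us v where *: "Y \<in> ?D ?s // ?E ?s" "list_all2 (\<in>) us Xs" "v \<in> Y"
        "sat B (concat us @ v @ p) (FunC \<Gamma> f)" by (elim conjE exE)
      have "v \<in> ?D ?s" using sub[OF *(1,3)] .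
      then have "\<mu> ?s v = ?a" using reps[OF Xs *(2)] fn[OF f, of us v] *(4) by simp
      then show "Y \<in> ?D ?s // ?E ?s \<and> h ?s Y = ?a" using *(1) h[OF *(1,3)] by simp
    next
      assume *: "Y \<in> ?D ?s // ?E ?s \<and> h ?s Y = ?a"
      obtain us where us: "list_all2 (\<in>) us Xs" using exreps[OF Xs] by blast
      obtain v where v: "v \<in> Y" using in_quotient_imp_non_empty[OF equiv] * by blast
      have "sat B (concat us @ v @ p) (FunC \<Gamma> f)"
      proof -
        have "v \<in> ?D ?s" "\<mu> ?s v = ?a"
          using sub[OF conjunct1[OF *] v] h[OF conjunct1[OF *] v] * by auto
        then show ?thesis using reps[OF Xs us] fn[OF f, of us v] by simp
      qed
      with conjunct1[OF *] us v show "?P Y" by (intro conjI exI)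
    qed
    have "map2 h (fst (fun_type L f)) Xs \<in> tuples (Carrier A) (fst (fun_type L f))"
      using Xs by (rule map2_in_tuples) (rule bij_betw_apply[OF bij])
    then have "?a \<in> Carrier A ?s" by (rule cl[OF f])
    then have "?a \<in> h ?s ` (?D ?s // ?E ?s)" by (simp only: bij_betw_imp_surj_on[OF bij])
    then obtain Y where Y: "Y \<in> ?D ?s // ?E ?s" "h ?s Y = ?a" by (elim imageE) simp
    have "(THE Y. ?P Y) = Y"
      unfolding P
    proof (rule the_equality)
      show "Y \<in> ?D ?s // ?E ?s \<and> h ?s Y = ?a" using Y by simp
      show "Z = Y" if "Z \<in> ?D ?s // ?E ?s \<and> h ?s Z = ?a" for Z
        using inj_onD[OF bij_betw_imp_inj_on[OF bij], of ?s Z Y] that Y by simp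
    qed
    then show "h ?s (FunI (interp L \<Gamma> B p) f Xs) = ?a"
      using Y(2) unfolding interp_def by simp
  next
    fix r Xs assume r: "r \<in> rels L" and "Xs \<in> tuples (Carrier (interp L \<Gamma> B p)) (rel_type L r)"
    then have Xs: "Xs \<in> tuples (\<lambda>s. ?D s // ?E s) (rel_type L r)" by (simp add: interp_def)
    show "RelI (interp L \<Gamma> B p) r Xs \<longleftrightarrow> RelI A r (map2 h (rel_type L r) Xs)"
    proof -
      have *: "sat B (concat us @ p) (RelC \<Gamma> r) \<longleftrightarrow> RelI A r (map2 h (rel_type L r) Xs)"
        if "list_all2 (\<in>) us Xs" for us
        using reps[OF Xs that] rl[OF r, of us] by simp
      obtain us where "list_all2 (\<in>) us Xs" using exreps[OF Xs] by blast
      with * show ?thesis unfolding interp_def by auto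
    qed
  qed
  show ?thesis
    unfolding coordinate_map_def using wd im iso hu by blast
qed

section \<open>Translation and composition\<close>

lemma nth_append_plus_length: "(ys @ xs) ! (i + length ys) = xs ! i"
  by (metis add.commute nth_append_length_plus)

lemma map_nth_shift: "map ((!) (ys @ xs)) (map (\<lambda>i. i + length ys) vs) = map ((!) xs) vs"
  by (simp add: comp_def nth_append_plus_length)

lemma map_nth_upt_append: "map ((!) (ys @ us @ xs)) [length ys..<length ys + length us] = us"
  by (auto intro!: nth_equalityI simp: nth_append)

lemma map_nth_upt: "map ((!) (us @ xs)) [0..<length us] = us"
  using map_nth_upt_append[of "[]" us xs] by simp

lemma length_blocks [simp]: "length (blocks \<Delta> ss n) = length ss"
  by (induction ss arbitrary: n) auto

text \<open>The prefix \<open>ys\<close> makes the induction go through: a block that has been read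
  joins the prefix.\<close>

lemma map_nth_blocks:
  assumes "list_all2 (\<lambda>u s. length u = length (coord \<Delta> s)) us ss"
  shows "map (map ((!) (ys @ concat us @ xs))) (blocks \<Delta> ss (length ys)) = us"
  using assms
proof (induction us ss arbitrary: ys rule: list_all2_induct)
  case (Cons u us s ss)
  have "map (map ((!) ((ys @ u) @ concat us @ xs))) (blocks \<Delta> ss (length (ys @ u))) = us"
    by (rule Cons.IH)
  moreover have "map ((!) (ys @ u @ concat us @ xs)) [length ys..<length ys + length u] = u"
    by (rule map_nth_upt_append)
  ultimately show ?case using Cons.hyps by simp
qed simp

lemma list_all2_upt_wf:
  "list_all2 (\<lambda>v t. v < length (\<Sigma>0 @ ss @ \<Sigma>1) \<and> (\<Sigma>0 @ ss @ \<Sigma>1) ! v = t)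
     [length \<Sigma>0..<length \<Sigma>0 + length ss] ss"
  by (auto simp: list_all2_conv_all_nth nth_append)

lemma blocks_wf:
  "list_all2 (\<lambda>b s. list_all2 (\<lambda>v t. v < length (\<Sigma>0 @ coords \<Delta> ss @ \<Sigma>) \<and>
      (\<Sigma>0 @ coords \<Delta> ss @ \<Sigma>) ! v = t) b (coord \<Delta> s)) (blocks \<Delta> ss (length \<Sigma>0)) ss"
proof (induction ss arbitrary: \<Sigma>0)
  case (Cons s ss)
  show ?case
    using Cons.IH[of "\<Sigma>0 @ coord \<Delta> s"] list_all2_upt_wf[of \<Sigma>0 "coord \<Delta> s" "coords \<Delta> ss @ \<Sigma>"]
    by simp
qed simp

lemma list_all2_shift:
  assumes "list_all2 (\<lambda>v t. v < length \<Sigma> \<and> \<Sigma> ! v = t) vs ss" "length \<Sigma>' = n"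
  shows "list_all2 (\<lambda>v t. v < length (\<Sigma>' @ \<Sigma>) \<and> (\<Sigma>' @ \<Sigma>) ! v = t) (map (\<lambda>i. i + n) vs) ss"
  using assms by (auto simp: list_all2_conv_all_nth nth_append)

lemma list_all2_concat_blocks:
  "list_all2 (\<lambda>b s. list_all2 P b (c s)) bs ss \<Longrightarrow> list_all2 P (concat bs) (concat (map c ss))"
  by (induction bs ss rule: list_all2_induct) (auto intro: list_all2_appendI)

lemma wf_codeD:
  assumes "wf_code LA LB \<Gamma>"
  shows wf_code_Dom: "wff LB (coord \<Gamma> s @ params \<Gamma>) (DomC \<Gamma> s)"
    and wf_code_Equ: "wff LB (coord \<Gamma> s @ coord \<Gamma> s @ params \<Gamma>) (EquC \<Gamma> s)"
    and wf_code_Fun: "f \<in> funs LA \<Longrightarrow>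
      wff LB (coords \<Gamma> (fst (fun_type LA f)) @ coord \<Gamma> (snd (fun_type LA f)) @ params \<Gamma>) (FunC \<Gamma> f)"
    and wf_code_Rel: "r \<in> rels LA \<Longrightarrow> wff LB (coords \<Gamma> (rel_type LA r) @ params \<Gamma>) (RelC \<Gamma> r)"
  using assms by (auto simp: wf_code_def)

lemma dom_set_tuples: "u \<in> dom_set \<Delta> A q s \<Longrightarrow> u \<in> tuples (Carrier A) (coord \<Delta> s)"
  by (simp add: dom_set_def)

lemma length_dom_set: "u \<in> dom_set \<Delta> A q s \<Longrightarrow> length u = length (coord \<Delta> s)"
  by (blast dest: dom_set_tuples length_tuples)

lemma tuples_coordsE:
  assumes "ys \<in> tuples C (concat (map c ss))"
  obtains us where "ys = concat us" "us \<in> tuples (\<lambda>s. tuples C (c s)) ss"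
proof -
  have "\<exists>us. ys = concat us \<and> us \<in> tuples (\<lambda>s. tuples C (c s)) ss"
    using assms
  proof (induction ss arbitrary: ys)
    case (Cons s ss)
    then obtain u zs where u: "ys = u @ zs" "u \<in> tuples C (c s)" "zs \<in> tuples C (concat (map c ss))"
      by (auto simp: in_tuples_append)
    with Cons.IH[OF u(3)] obtain us where "zs = concat us" "us \<in> tuples (\<lambda>s. tuples C (c s)) ss" by blast
    with u show ?case by (intro exI[of _ "u # us"]) simp
  qed simp
  then show ?thesis using that by blast
qed

lemma concat_in_tuples:
  "us \<in> tuples (\<lambda>s. tuples C (c s)) ss \<Longrightarrow> concat us \<in> tuples C (concat (map c ss))"
  by (induction ss arbitrary: us) (auto simp: in_tuples_Cons intro!: append_in_tuples)

lemma tuples_mono: "us \<in> tuples D ss \<Longrightarrow> (\<And>s. D s \<subseteq> D' s) \<Longrightarrow> us \<in> tuples D' ss"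
  by (auto simp: tuples_def elim!: list_all2_mono)

lemma tuples_length_list_all2:
  "us \<in> tuples (dom_set \<Delta> A q) ss \<Longrightarrow> list_all2 (\<lambda>u s. length u = length (coord \<Delta> s)) us ss"
  by (auto simp: tuples_def length_dom_set elim!: list_all2_mono)

lemma length_concat_coords:
  "list_all2 (\<lambda>u s. length u = length (coord \<Delta> s)) us ss \<Longrightarrow> length (concat us) = length (coords \<Delta> ss)"
  by (induction us ss rule: list_all2_induct) auto

lemma ball_set_zip3:
  assumes "length ts = n" "length ss = n" "length bs = n"
  shows "(\<forall>x\<in>set (map g (zip ts (zip ss bs))). P x) \<longleftrightarrow> (\<forall>i<n. P (g (ts ! i, ss ! i, bs ! i)))"
  using assms by (simp only: all_set_conv_all_nth) simp

lemma map_nth_concat: "map ((!) xs) (concat bs) = concat (map (map ((!) xs)) bs)"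
  by (simp add: map_concat)

text \<open>Closes each existential over representatives: some representative exists, and the
  formula depends only on the value represented.\<close>

lemma bex_reps:
  "x \<in> S \<Longrightarrow> g x = k \<Longrightarrow> (\<And>x. x \<in> S \<Longrightarrow> P x \<longleftrightarrow> Q (g x)) \<Longrightarrow> (\<exists>x\<in>S. g x = k \<and> P x) \<longleftrightarrow> Q k"
  by blast

section \<open>The reduction theorem for one code at fixed parameters\<close>

locale realization =
  fixes L :: "('s, 'f, 'r) lang" and LA :: "('t, 'g, 'q) lang" and \<Delta> :: "('s, 'f, 'r, 't, 'g, 'q) code"
    and A :: "('t, 'g, 'q, 'u) model" and q :: "'u list" and B :: "('s, 'f, 'r, 'v) model"
    and \<nu> :: "'s \<Rightarrow> 'u list \<Rightarrow> 'v"
  assumes wf: "wf_code L LA \<Delta>" and real: "realizes L \<Delta> A q B \<nu>"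
    and q: "q \<in> tuples (Carrier A) (params \<Delta>)"
begin

abbreviation "D \<equiv> dom_set \<Delta> A q"

lemma image_D: "\<nu> s ` D s = Carrier B s"
  by (rule realizes_image[OF real])

lemma sat_Dom:
  assumes "map ((!) xs) b = u" "map ((!) xs) \<pi> = q" "u \<in> tuples (Carrier A) (coord \<Delta> s)"
  shows "sat A xs (inst (b @ \<pi>) (DomC \<Delta> s)) \<longleftrightarrow> u \<in> D s"
proof -
  have "length (b @ \<pi>) = length (coord \<Delta> s @ params \<Delta>)"
    using assms q by (auto dest!: length_tuples)
  from sat_inst[OF wf_code_Dom[OF wf] this, of A xs] show ?thesis using assms by (simp add: dom_set_def)
qed

text \<open>\<open>T\<close> and \<open>val\<close> stay abstract so that the same statement serves
  the recursion on terms, where only the subterms are understood, and the atomic formulas, where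
  \<open>trans_trm\<close> is understood completely.\<close>

lemma sat_graft:
  assumes len: "length ts = length ss" and \<pi>: "map ((!) xs) \<pi> = q"
    and \<chi>: "wff LA (coords \<Delta> ss @ \<Sigma> @ params \<Delta>) \<chi>" "length \<rho> = length \<Sigma>"
    and T: "\<And>i us. i < length ss \<Longrightarrow> us \<in> tuples D ss \<Longrightarrow>
      sat A (concat us @ xs) (T (map (map (\<lambda>i. i + length (coords \<Delta> ss))) \<sigma>)
        (map (\<lambda>i. i + length (coords \<Delta> ss)) \<pi>) (blocks \<Delta> ss 0 ! i) (ss ! i) (ts ! i)) \<longleftrightarrow>
      \<nu> (ss ! i) (us ! i) = val (ts ! i)"
  shows "sat A xs (graft \<Delta> T \<sigma> \<pi> \<rho> ss ts \<chi>) \<longleftrightarrow>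
    (\<exists>us\<in>tuples D ss. map2 \<nu> ss us = map val ts \<and> sat A (concat us @ map ((!) xs) \<rho> @ q) \<chi>)"
proof -
  let ?up = "map (\<lambda>i. i + length (coords \<Delta> ss))"
  let ?body = "And (Ands (map (\<lambda>(t, s, b). And (inst (b @ ?up \<pi>) (DomC \<Delta> s)) (T (map ?up \<sigma>) (?up \<pi>) b s t))
                (zip ts (zip ss (blocks \<Delta> ss 0)))))
             (inst (concat (blocks \<Delta> ss 0) @ ?up \<rho> @ ?up \<pi>) \<chi>)"
  have body: "sat A (concat us @ xs) ?body \<longleftrightarrow>
      us \<in> tuples D ss \<and> map2 \<nu> ss us = map val ts \<and> sat A (concat us @ map ((!) xs) \<rho> @ q) \<chi>"
    if us: "us \<in> tuples (\<lambda>s. tuples (Carrier A) (coord \<Delta> s)) ss" for us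
  proof -
    have l2: "list_all2 (\<lambda>u s. length u = length (coord \<Delta> s)) us ss"
      using us by (auto simp: tuples_def[of _ ss] length_tuples elim!: list_all2_mono)
    then have lenc: "length (concat us) = length (coords \<Delta> ss)" and lenu: "length us = length ss"
      by (auto dest: length_concat_coords list_all2_lengthD)
    have bl: "map (map ((!) (concat us @ xs))) (blocks \<Delta> ss 0) = us"
      using map_nth_blocks[OF l2, of "[]" xs] by simp
    have bli: "map ((!) (concat us @ xs)) (blocks \<Delta> ss 0 ! i) = us ! i" if "i < length ss" for i
      using that bl by (metis length_blocks nth_map)
    have up: "map ((!) (concat us @ xs)) (?up vs) = map ((!) xs) vs" for vs
      using map_nth_shift[of "concat us" xs vs] lenc by simp
    have lb: "length (concat (blocks \<Delta> ss 0)) = length (coords \<Delta> ss)"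
      using bl lenc by (metis length_map map_nth_concat)
    have D: "sat A (concat us @ xs) (inst (blocks \<Delta> ss 0 ! i @ ?up \<pi>) (DomC \<Delta> (ss ! i))) \<longleftrightarrow> us ! i \<in> D (ss ! i)"
      if i: "i < length ss" for i
      using bli[OF i] up[of \<pi>] \<pi> us i by (intro sat_Dom) (auto simp: tuples_def[of _ ss] list_all2_conv_all_nth)
    have "sat A (concat us @ xs) (inst (concat (blocks \<Delta> ss 0) @ ?up \<rho> @ ?up \<pi>) \<chi>) \<longleftrightarrow>
        sat A (concat us @ map ((!) xs) \<rho> @ q) \<chi>"
    proof -
      have "length (concat (blocks \<Delta> ss 0) @ ?up \<rho> @ ?up \<pi>) = length (coords \<Delta> ss @ \<Sigma> @ params \<Delta>)"
        using lb \<chi>(2) \<pi> length_tuples[OF q] by auto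
      from sat_inst[OF \<chi>(1) this, of A "concat us @ xs"] show ?thesis
        by (simp only: map_append map_nth_concat bl up \<pi>)
    qed
    moreover have "sat A (concat us @ xs)
        (Ands (map (\<lambda>(t, s, b). And (inst (b @ ?up \<pi>) (DomC \<Delta> s)) (T (map ?up \<sigma>) (?up \<pi>) b s t))
                (zip ts (zip ss (blocks \<Delta> ss 0))))) \<longleftrightarrow>
        us \<in> tuples D ss \<and> map2 \<nu> ss us = map val ts" (is "?L \<longleftrightarrow> _")
    proof -
      have "?L \<longleftrightarrow> (\<forall>i<length ss. us ! i \<in> D (ss ! i) \<and> sat A (concat us @ xs)
          (T (map ?up \<sigma>) (?up \<pi>) (blocks \<Delta> ss 0 ! i) (ss ! i) (ts ! i)))"
        using D by (simp only: sat_Ands ball_set_zip3[OF len refl length_blocks] prod.case sat.simps)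
          (simp only: D cong: conj_cong imp_cong)
      also have "\<dots> \<longleftrightarrow> us \<in> tuples D ss \<and> (\<forall>i<length ss. sat A (concat us @ xs)
          (T (map ?up \<sigma>) (?up \<pi>) (blocks \<Delta> ss 0 ! i) (ss ! i) (ts ! i)))"
        using lenu by (auto simp: tuples_def list_all2_conv_all_nth)
      also have "\<dots> \<longleftrightarrow> us \<in> tuples D ss \<and> (\<forall>i<length ss. \<nu> (ss ! i) (us ! i) = val (ts ! i))"
        using T by blast
      also have "\<dots> \<longleftrightarrow> us \<in> tuples D ss \<and> map2 \<nu> ss us = map val ts"
        using len lenu by (auto simp: list_eq_iff_nth_eq)
      finally show ?thesis .
    qed
    ultimately show ?thesis by simp
  qed
  have sub: "us \<in> tuples (\<lambda>s. tuples (Carrier A) (coord \<Delta> s)) ss" if "us \<in> tuples D ss" for us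
    using that by (rule tuples_mono) (auto simp: dom_set_tuples)
  have "sat A xs (graft \<Delta> T \<sigma> \<pi> \<rho> ss ts \<chi>) \<longleftrightarrow>
      (\<exists>ys\<in>tuples (Carrier A) (coords \<Delta> ss). sat A (ys @ xs) ?body)"
    by (simp only: graft_def Let_def sat_Exs)
  \<comment> \<open>A flat tuple of witnesses is cut at the block boundaries, which its sorts
    determine.\<close>
  also have "\<dots> \<longleftrightarrow> (\<exists>us\<in>tuples (\<lambda>s. tuples (Carrier A) (coord \<Delta> s)) ss. sat A (concat us @ xs) ?body)"
    (is "?l \<longleftrightarrow> ?r")
  proof
    assume ?l
    then obtain ys where ys: "ys \<in> tuples (Carrier A) (coords \<Delta> ss)" "sat A (ys @ xs) ?body" ..
    from ys(1) obtain us where "ys = concat us" "us \<in> tuples (\<lambda>s. tuples (Carrier A) (coord \<Delta> s)) ss"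
      by (rule tuples_coordsE)
    with ys(2) show ?r by (intro bexI[of _ us]) simp_all
  next
    assume ?r
    then obtain us where "us \<in> tuples (\<lambda>s. tuples (Carrier A) (coord \<Delta> s)) ss"
      "sat A (concat us @ xs) ?body" ..
    then show ?l by (intro bexI[OF _ concat_in_tuples])
  qed
  also have "\<dots> \<longleftrightarrow> (\<exists>us\<in>tuples D ss. map2 \<nu> ss us = map val ts \<and> sat A (concat us @ map ((!) xs) \<rho> @ q) \<chi>)"
    using body sub by blast
  finally show ?thesis .
qed

lemma tval_carrier:
  assumes "has_sort L \<Sigma> t s" "ys \<in> tuples (Carrier B) \<Sigma>"
  shows "tval B ys t \<in> Carrier B s"
  using assms
proof (induction t arbitrary: s)
  case (Var i)
  then show ?case by (auto simp: tuples_def list_all2_conv_all_nth)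
next
  case (App f ts)
  have "map (tval B ys) ts \<in> tuples (Carrier B) (fst (fun_type L f))"
    using App by (auto simp: tuples_def list_all2_conv_all_nth)
  then show ?case using App.prems realizes_closed[OF real] by simp
qed

lemma vals_reps:
  assumes "list_all2 (has_sort L \<Sigma>) ts ss" "ys \<in> tuples (Carrier B) \<Sigma>"
  obtains us where "us \<in> tuples D ss" "map2 \<nu> ss us = map (tval B ys) ts"
proof (rule tuples_imageE)
  show "map (tval B ys) ts \<in> tuples (Carrier B) ss"
    using assms tval_carrier by (auto simp: tuples_def list_all2_conv_all_nth)
  show "Carrier B s \<subseteq> \<nu> s ` D s" for s using image_D by simp
qed

text \<open>The hypothesis on \<open>T\<close> ranges over all valuations and blocks because the
  quantifiers of \<open>graft\<close> lengthen the valuation and shift every block before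
  \<open>T\<close> is read.\<close>

lemma sat_graft_terms:
  assumes T: "\<And>t s xs \<pi> \<sigma> \<beta> v. t \<in> set ts \<Longrightarrow> has_sort L \<Sigma> t s \<Longrightarrow> map ((!) xs) \<pi> = q \<Longrightarrow>
      map (map ((!) xs)) \<sigma> \<in> tuples D \<Sigma> \<Longrightarrow> map ((!) xs) \<beta> = v \<Longrightarrow> v \<in> D s \<Longrightarrow>
      sat A xs (T \<sigma> \<pi> \<beta> s t) \<longleftrightarrow> \<nu> s v = tval B (map2 \<nu> \<Sigma> (map (map ((!) xs)) \<sigma>)) t"
    and ts: "list_all2 (has_sort L \<Sigma>) ts ss" and \<pi>: "map ((!) xs) \<pi> = q"
    and \<sigma>: "map (map ((!) xs)) \<sigma> \<in> tuples D \<Sigma>"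
    and \<chi>: "wff LA (coords \<Delta> ss @ \<Sigma>' @ params \<Delta>) \<chi>" "length \<rho> = length \<Sigma>'"
  shows "sat A xs (graft \<Delta> T \<sigma> \<pi> \<rho> ss ts \<chi>) \<longleftrightarrow>
    (\<exists>us\<in>tuples D ss. map2 \<nu> ss us = map (tval B (map2 \<nu> \<Sigma> (map (map ((!) xs)) \<sigma>))) ts \<and>
       sat A (concat us @ map ((!) xs) \<rho> @ q) \<chi>)"
proof (rule sat_graft[OF list_all2_lengthD[OF ts] \<pi> \<chi>])
  fix i us assume i: "i < length ss" and us: "us \<in> tuples D ss"
  let ?up = "map (\<lambda>i. i + length (coords \<Delta> ss))"
  have up: "map ((!) (concat us @ xs)) (?up vs) = map ((!) xs) vs" for vs
    using map_nth_shift[of "concat us" xs vs] length_concat_coords[OF tuples_length_list_all2[OF us]] by simp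
  have up2: "map (map ((!) (concat us @ xs))) (map ?up \<sigma>) = map (map ((!) xs)) \<sigma>"
    unfolding map_map by (rule map_cong[OF refl]) (simp only: comp_apply up)
  have bli: "map ((!) (concat us @ xs)) (blocks \<Delta> ss 0 ! i) = us ! i"
    using map_nth_blocks[OF tuples_length_list_all2[OF us], of "[]" xs] i
    by (metis append_Nil length_blocks list.size(3) nth_map)
  have ti: "ts ! i \<in> set ts" "has_sort L \<Sigma> (ts ! i) (ss ! i)"
    using ts i by (auto simp: list_all2_conv_all_nth)
  have ui: "us ! i \<in> D (ss ! i)"
    using us i by (simp add: tuples_def list_all2_conv_all_nth)
  show "sat A (concat us @ xs) (T (map ?up \<sigma>) (?up \<pi>) (blocks \<Delta> ss 0 ! i) (ss ! i) (ts ! i)) \<longleftrightarrow>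
      \<nu> (ss ! i) (us ! i) = tval B (map2 \<nu> \<Sigma> (map (map ((!) xs)) \<sigma>)) (ts ! i)"
    by (rule T[OF ti, of "concat us @ xs" "?up \<pi>" "map ?up \<sigma>", unfolded up up2, OF \<pi> \<sigma> bli ui])
qed

text \<open>The value of a compound term is reached through representatives of the subterm values
  and the interpreted graph, whose truth does not depend on which representatives are taken.\<close>

lemma sat_trans_trm:
  assumes "has_sort L \<Sigma> t s" "map ((!) xs) \<pi> = q"
    "map (map ((!) xs)) \<sigma> \<in> tuples D \<Sigma>" "map ((!) xs) \<beta> = v" "v \<in> D s"
  shows "sat A xs (trans_trm L \<Delta> \<sigma> \<pi> \<beta> s t) \<longleftrightarrow> \<nu> s v = tval B (map2 \<nu> \<Sigma> (map (map ((!) xs)) \<sigma>)) t"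
  using assms
proof (induction t arbitrary: s xs \<sigma> \<pi> \<beta> v)
  case (Var i)
  then have i: "i < length \<Sigma>" "s = \<Sigma> ! i" by simp_all
  have len: "length \<sigma> = length \<Sigma>" using length_tuples[OF Var.prems(3)] by simp
  have si: "map ((!) xs) (\<sigma> ! i) \<in> D s"
    using Var.prems(3) i by (auto simp: tuples_def list_all2_conv_all_nth)
  have "length (\<sigma> ! i @ \<beta> @ \<pi>) = length (coord \<Delta> s @ coord \<Delta> s @ params \<Delta>)"
    using length_dom_set[OF si] length_dom_set[OF Var.prems(5)] Var.prems length_tuples[OF q] by auto
  from sat_inst[OF wf_code_Equ[OF wf] this, of A xs]
  have "sat A xs (trans_trm L \<Delta> \<sigma> \<pi> \<beta> s (Var i)) \<longleftrightarrow> \<nu> s (map ((!) xs) (\<sigma> ! i)) = \<nu> s v"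
    using realizes_Equ[OF real si Var.prems(5)] Var.prems by simp
  then show ?case using i len by auto
next
  case (App f ts)
  let ?ss = "fst (fun_type L f)"
  let ?ys = "map2 \<nu> \<Sigma> (map (map ((!) xs)) \<sigma>)"
  have f: "f \<in> funs L" and ts: "list_all2 (has_sort L \<Sigma>) ts ?ss" and s: "s = snd (fun_type L f)"
    using App.prems(1) by simp_all
  have ys: "?ys \<in> tuples (Carrier B) \<Sigma>"
    using App.prems(3) image_D by (intro map2_in_tuples) auto
  have \<beta>: "length \<beta> = length (coord \<Delta> s)"
    using App.prems(4) length_dom_set[OF App.prems(5)] by auto
  have \<chi>: "wff LA (coords \<Delta> ?ss @ coord \<Delta> s @ params \<Delta>) (FunC \<Delta> f)"
    unfolding s by (rule wf_code_Fun[OF wf f])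
  have "sat A xs (trans_trm L \<Delta> \<sigma> \<pi> \<beta> s (App f ts)) \<longleftrightarrow>
    (\<exists>us\<in>tuples D ?ss. map2 \<nu> ?ss us = map (tval B ?ys) ts \<and> sat A (concat us @ map ((!) xs) \<beta> @ q) (FunC \<Delta> f))"
    unfolding trans_trm.simps
    by (rule sat_graft_terms[OF App.IH ts App.prems(2,3) \<chi> \<beta>])
  also have "\<dots> \<longleftrightarrow> \<nu> s v = FunI B f (map (tval B ?ys) ts)"
  proof -
    obtain us where "us \<in> tuples D ?ss" "map2 \<nu> ?ss us = map (tval B ?ys) ts"
      using vals_reps[OF ts ys] .
    moreover have "sat A (concat us @ map ((!) xs) \<beta> @ q) (FunC \<Delta> f) \<longleftrightarrow> \<nu> s v = FunI B f (map2 \<nu> ?ss us)"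
      if "us \<in> tuples D ?ss" for us
      using realizes_Fun[OF real f that, of v] App.prems(4,5) s by simp
    ultimately show ?thesis by (rule bex_reps)
  qed
  finally show ?case by simp
qed

text \<open>A quantifier over an interpreted sort becomes one over tuples relativised to the domain;
  since \<open>\<nu>\<close> maps that domain onto the sort, both range over the same
  elements.\<close>

lemma sat_trans_fm:
  assumes "wff L \<Sigma> \<phi>" "map ((!) xs) \<pi> = q" "map (map ((!) xs)) \<sigma> \<in> tuples D \<Sigma>"
  shows "sat A xs (trans_fm L \<Delta> \<sigma> \<pi> \<phi>) \<longleftrightarrow> sat B (map2 \<nu> \<Sigma> (map (map ((!) xs)) \<sigma>)) \<phi>"
  using assms
proof (induction \<phi> arbitrary: \<Sigma> xs \<sigma> \<pi>)
  case (Eq s t u)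
  let ?ys = "map2 \<nu> \<Sigma> (map (map ((!) xs)) \<sigma>)"
  have ts: "list_all2 (has_sort L \<Sigma>) [t, u] [s, s]" using Eq.prems(1) by simp
  have ys: "?ys \<in> tuples (Carrier B) \<Sigma>"
    using Eq.prems(3) image_D by (intro map2_in_tuples) auto
  have \<chi>: "wff LA (coords \<Delta> [s, s] @ [] @ params \<Delta>) (EquC \<Delta> s)" using wf_code_Equ[OF wf, of s] by simp
  have "sat A xs (trans_fm L \<Delta> \<sigma> \<pi> (Eq s t u)) \<longleftrightarrow>
    (\<exists>us\<in>tuples D [s, s]. map2 \<nu> [s, s] us = map (tval B ?ys) [t, u] \<and>
       sat A (concat us @ map ((!) xs) [] @ q) (EquC \<Delta> s))"
    unfolding trans_fm.simps
    by (rule sat_graft_terms[OF sat_trans_trm ts Eq.prems(2,3) \<chi>]) simp_all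
  also have "\<dots> \<longleftrightarrow> (\<exists>u1\<in>D s. \<exists>u2\<in>D s. \<nu> s u1 = tval B ?ys t \<and> \<nu> s u2 = tval B ?ys u \<and> \<nu> s u1 = \<nu> s u2)"
  proof -
    have pairs: "(\<exists>us\<in>tuples D [s, s]. P us) \<longleftrightarrow> (\<exists>u1\<in>D s. \<exists>u2\<in>D s. P [u1, u2])" for P
      by (auto simp: in_tuples_Cons) blast
    show ?thesis
      unfolding pairs using realizes_Equ[OF real, of _ s] by (auto cong: bex_cong)
  qed
  also have "\<dots> \<longleftrightarrow> tval B ?ys t = tval B ?ys u"
  proof -
    have "tval B ?ys t \<in> Carrier B s"
      using Eq.prems(1) by (intro tval_carrier[OF _ ys]) simp
    then obtain w where "w \<in> D s" "\<nu> s w = tval B ?ys t" unfolding image_D[of s, symmetric] by auto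
    \<comment> \<open>If the two values agree, one representative serves for both sides.\<close>
    then show ?thesis by (auto intro!: bexI[of _ w])
  qed
  finally show ?case by simp
next
  case (Rel r ts)
  let ?ss = "rel_type L r"
  let ?ys = "map2 \<nu> \<Sigma> (map (map ((!) xs)) \<sigma>)"
  have r: "r \<in> rels L" and ts: "list_all2 (has_sort L \<Sigma>) ts ?ss" using Rel.prems(1) by simp_all
  have ys: "?ys \<in> tuples (Carrier B) \<Sigma>"
    using Rel.prems(3) image_D by (intro map2_in_tuples) auto
  have \<chi>: "wff LA (coords \<Delta> ?ss @ [] @ params \<Delta>) (RelC \<Delta> r)" using wf_code_Rel[OF wf r] by simp
  have "sat A xs (trans_fm L \<Delta> \<sigma> \<pi> (Rel r ts)) \<longleftrightarrow>
    (\<exists>us\<in>tuples D ?ss. map2 \<nu> ?ss us = map (tval B ?ys) ts \<and> sat A (concat us @ map ((!) xs) [] @ q) (RelC \<Delta> r))"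
    unfolding trans_fm.simps
    by (rule sat_graft_terms[OF sat_trans_trm ts Rel.prems(2,3) \<chi>]) simp_all
  also have "\<dots> \<longleftrightarrow> RelI B r (map (tval B ?ys) ts)"
  proof -
    obtain us where "us \<in> tuples D ?ss" "map2 \<nu> ?ss us = map (tval B ?ys) ts"
      using vals_reps[OF ts ys] .
    moreover have "sat A (concat us @ map ((!) xs) [] @ q) (RelC \<Delta> r) \<longleftrightarrow> RelI B r (map2 \<nu> ?ss us)"
      if "us \<in> tuples D ?ss" for us
      using realizes_Rel[OF real r that] by simp
    ultimately show ?thesis by (rule bex_reps)
  qed
  finally show ?case by simp
next
  case (Neg \<phi>)
  show ?case
    unfolding trans_fm.simps sat.simps Neg.IH[OF Neg.prems(1)[unfolded wff.simps] Neg.prems(2,3)] ..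
next
  case (And \<phi> \<psi>)
  from And.prems(1) have wf: "wff L \<Sigma> \<phi>" "wff L \<Sigma> \<psi>" by simp_all
  show ?case
    unfolding trans_fm.simps sat.simps And.IH(1)[OF wf(1) And.prems(2,3)]
      And.IH(2)[OF wf(2) And.prems(2,3)] ..
next
  case (Exi s \<phi>)
  let ?d = "length (coord \<Delta> s)"
  let ?up = "map (\<lambda>i. i + ?d)"
  let ?ys = "map2 \<nu> \<Sigma> (map (map ((!) xs)) \<sigma>)"
  have "sat A (u @ xs) (And (inst ([0..<?d] @ ?up \<pi>) (DomC \<Delta> s)) (trans_fm L \<Delta> ([0..<?d] # map ?up \<sigma>) (?up \<pi>) \<phi>))
      \<longleftrightarrow> u \<in> D s \<and> sat B (\<nu> s u # ?ys) \<phi>" if u: "u \<in> tuples (Carrier A) (coord \<Delta> s)" for u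
  proof -
    have l: "length u = ?d" using u by (rule length_tuples)
    have up: "map ((!) (u @ xs)) (?up vs) = map ((!) xs) vs" for vs
      using map_nth_shift[of u xs vs] l by simp
    have up2: "map (map ((!) (u @ xs))) (map ?up \<sigma>) = map (map ((!) xs)) \<sigma>"
      unfolding map_map by (rule map_cong[OF refl]) (simp only: comp_apply up)
    have b: "map ((!) (u @ xs)) [0..<?d] = u" using map_nth_upt[of u xs] l by simp
    have up3: "map (map ((!) (u @ xs))) ([0..<?d] # map ?up \<sigma>) = u # map (map ((!) xs)) \<sigma>"
      by (simp only: list.map b up2[unfolded list.map])
    have \<pi>: "map ((!) (u @ xs)) (?up \<pi>) = q" unfolding up by (rule Exi.prems(2))
    have "sat A (u @ xs) (inst ([0..<?d] @ ?up \<pi>) (DomC \<Delta> s)) \<longleftrightarrow> u \<in> D s"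
      by (rule sat_Dom[OF b \<pi> u])
    moreover have "sat A (u @ xs) (trans_fm L \<Delta> ([0..<?d] # map ?up \<sigma>) (?up \<pi>) \<phi>) \<longleftrightarrow> sat B (\<nu> s u # ?ys) \<phi>"
      if "u \<in> D s"
    proof -
      have "map (map ((!) (u @ xs))) ([0..<?d] # map ?up \<sigma>) \<in> tuples D (s # \<Sigma>)"
        unfolding up3 using that Exi.prems(3) by simp
      from Exi.IH[OF Exi.prems(1)[unfolded wff.simps] \<pi> this] show ?thesis
        unfolding up3 by simp
    qed
    ultimately show ?thesis by auto
  qed
  then have "sat A xs (trans_fm L \<Delta> \<sigma> \<pi> (Exi s \<phi>)) \<longleftrightarrow>
      (\<exists>u\<in>tuples (Carrier A) (coord \<Delta> s). u \<in> D s \<and> sat B (\<nu> s u # ?ys) \<phi>)"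
    unfolding trans_fm.simps Let_def sat_Exs by (rule bex_cong[OF refl])
  also have "\<dots> \<longleftrightarrow> (\<exists>u\<in>D s. sat B (\<nu> s u # ?ys) \<phi>)"
    using dom_set_tuples[of _ \<Delta> A q s] by (auto simp del: sat.simps)
  also have "\<dots> \<longleftrightarrow> sat B ?ys (Exi s \<phi>)"
    unfolding sat.simps image_D[of s, symmetric] by auto
  finally show ?case .
qed simp

lemma sat_translate:
  assumes \<phi>: "wff L ss \<phi>" and us: "us \<in> tuples (\<lambda>s. tuples (Carrier A) (coord \<Delta> s)) ss"
  shows "sat A (concat us @ q) (translate L \<Delta> ss \<phi>) \<longleftrightarrow> us \<in> tuples D ss \<and> sat B (map2 \<nu> ss us) \<phi>"
proof -
  have l2: "list_all2 (\<lambda>u s. length u = length (coord \<Delta> s)) us ss"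
    using us by (auto simp: tuples_def[of _ ss] length_tuples elim!: list_all2_mono)
  then have lenc: "length (concat us) = length (coords \<Delta> ss)" and lenu: "length us = length ss"
    by (auto dest: length_concat_coords list_all2_lengthD)
  have bl: "map (map ((!) (concat us @ q))) (blocks \<Delta> ss 0) = us"
    using map_nth_blocks[OF l2, of "[]" q] by simp
  let ?n = "length (coords \<Delta> ss)"
  have \<pi>: "map ((!) (concat us @ q)) [?n..<?n + length (params \<Delta>)] = q"
    using map_nth_upt_append[of "concat us" q "[]"] lenc length_tuples[OF q] by simp
  have D: "sat A (concat us @ q) (inst (blocks \<Delta> ss 0 ! i @ [?n..<?n + length (params \<Delta>)]) (DomC \<Delta> (ss ! i))) \<longleftrightarrow>
      us ! i \<in> D (ss ! i)" if i: "i < length ss" for i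
  proof (rule sat_Dom[OF _ \<pi>])
    show "map ((!) (concat us @ q)) (blocks \<Delta> ss 0 ! i) = us ! i"
      using i bl by (metis length_blocks nth_map)
    show "us ! i \<in> tuples (Carrier A) (coord \<Delta> (ss ! i))"
      using us i by (auto simp: tuples_def[of _ ss] list_all2_conv_all_nth)
  qed
  have "(\<forall>(s, b)\<in>set (zip ss (blocks \<Delta> ss 0)). sat A (concat us @ q)
      (inst (b @ [?n..<?n + length (params \<Delta>)]) (DomC \<Delta> s))) \<longleftrightarrow> us \<in> tuples D ss"
    using lenu D by (simp add: all_set_conv_all_nth tuples_def list_all2_conv_all_nth)
  moreover have "sat A (concat us @ q) (trans_fm L \<Delta> (blocks \<Delta> ss 0) [?n..<?n + length (params \<Delta>)] \<phi>) \<longleftrightarrow>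
      sat B (map2 \<nu> ss us) \<phi>" if "us \<in> tuples D ss"
    using sat_trans_fm[OF \<phi> \<pi>, of "blocks \<Delta> ss 0"] that unfolding bl by simp
  ultimately show ?thesis
    unfolding translate_def Let_def sat.simps sat_Ands by (auto simp: case_prod_unfold)
qed

end

section \<open>Sorts of translated formulas\<close>

abbreviation places :: "'s list \<Rightarrow> nat list \<Rightarrow> 's list \<Rightarrow> bool" where
  "places \<Sigma> vs ss \<equiv> list_all2 (\<lambda>v s. v < length \<Sigma> \<and> \<Sigma> ! v = s) vs ss"

lemma wff_graft:
  assumes T: "\<And>t s b. t \<in> set ts \<Longrightarrow> has_sort L \<Sigma> t s \<Longrightarrow> places (coords \<Delta> ss @ \<Sigma>') b (coord \<Delta> s) \<Longrightarrow>
      wff LA (coords \<Delta> ss @ \<Sigma>') (T (map (map (\<lambda>i. i + length (coords \<Delta> ss))) \<sigma>)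
        (map (\<lambda>i. i + length (coords \<Delta> ss)) \<pi>) b s t)"
    and wf: "wf_code L LA \<Delta>" and ts: "list_all2 (has_sort L \<Sigma>) ts ss"
    and \<pi>: "places \<Sigma>' \<pi> (params \<Delta>)" and \<rho>: "places \<Sigma>' \<rho> \<Sigma>''"
    and \<chi>: "wff LA (coords \<Delta> ss @ \<Sigma>'' @ params \<Delta>) \<chi>"
  shows "wff LA \<Sigma>' (graft \<Delta> T \<sigma> \<pi> \<rho> ss ts \<chi>)"
proof -
  let ?up = "map (\<lambda>i. i + length (coords \<Delta> ss))"
  have bs: "list_all2 (\<lambda>b s. places (coords \<Delta> ss @ \<Sigma>') b (coord \<Delta> s)) (blocks \<Delta> ss 0) ss"
    using blocks_wf[of "[]" \<Delta> ss \<Sigma>'] by simp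
  have up: "places (coords \<Delta> ss @ \<Sigma>') (?up vs) us" if "places \<Sigma>' vs us" for vs us
    using list_all2_shift[OF that] by blast
  have len: "length ts = length ss" using ts by (rule list_all2_lengthD)
  have "wff LA (coords \<Delta> ss @ \<Sigma>') (inst (concat (blocks \<Delta> ss 0) @ ?up \<rho> @ ?up \<pi>) \<chi>)"
    by (rule wff_inst[OF \<chi>]) (intro list_all2_appendI up \<rho> \<pi> list_all2_concat_blocks bs)
  moreover have "wff LA (coords \<Delta> ss @ \<Sigma>')
      (And (inst (blocks \<Delta> ss 0 ! i @ ?up \<pi>) (DomC \<Delta> (ss ! i)))
        (T (map ?up \<sigma>) (?up \<pi>) (blocks \<Delta> ss 0 ! i) (ss ! i) (ts ! i)))" if i: "i < length ss" for i
  proof -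
    have b: "places (coords \<Delta> ss @ \<Sigma>') (blocks \<Delta> ss 0 ! i) (coord \<Delta> (ss ! i))"
      using bs i by (simp add: list_all2_conv_all_nth)
    have "wff LA (coords \<Delta> ss @ \<Sigma>') (inst (blocks \<Delta> ss 0 ! i @ ?up \<pi>) (DomC \<Delta> (ss ! i)))"
      by (rule wff_inst[OF wf_code_Dom[OF wf]]) (intro list_all2_appendI up \<pi> b)
    moreover have "wff LA (coords \<Delta> ss @ \<Sigma>') (T (map ?up \<sigma>) (?up \<pi>) (blocks \<Delta> ss 0 ! i) (ss ! i) (ts ! i))"
      using ts i by (intro T b) (auto simp: list_all2_conv_all_nth)
    ultimately show ?thesis by simp
  qed
  ultimately show ?thesis
    unfolding graft_def Let_def wff_Exs wff.simps wff_Ands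
    by (simp only: ball_set_zip3[OF len refl length_blocks] prod.case wff.simps) blast
qed

lemma list_all2_places_shift:
  assumes "list_all2 (\<lambda>b s. places \<Sigma>' b (c s)) \<sigma> \<Sigma>" "length \<Sigma>0 = n"
  shows "list_all2 (\<lambda>b s. places (\<Sigma>0 @ \<Sigma>') b (c s)) (map (map (\<lambda>i. i + n)) \<sigma>) \<Sigma>"
  using assms(1) list_all2_shift[OF _ assms(2)] unfolding list.rel_map
  by (elim list_all2_mono) blast

lemma wff_trans_trm:
  assumes wf: "wf_code L LA \<Delta>" and "has_sort L \<Sigma> t s" "places \<Sigma>' \<pi> (params \<Delta>)"
    "list_all2 (\<lambda>b s. places \<Sigma>' b (coord \<Delta> s)) \<sigma> \<Sigma>" "places \<Sigma>' \<beta> (coord \<Delta> s)"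
  shows "wff LA \<Sigma>' (trans_trm L \<Delta> \<sigma> \<pi> \<beta> s t)"
  using assms(2-)
proof (induction t arbitrary: s \<Sigma>' \<sigma> \<pi> \<beta>)
  case (Var i)
  then have "places \<Sigma>' (\<sigma> ! i) (coord \<Delta> s)" by (auto simp: list_all2_conv_all_nth)
  then show ?case
    unfolding trans_trm.simps
    by (intro wff_inst[OF wf_code_Equ[OF wf]] list_all2_appendI Var.prems)
next
  case (App f ts)
  have f: "f \<in> funs L" and ts: "list_all2 (has_sort L \<Sigma>) ts (fst (fun_type L f))" and s: "s = snd (fun_type L f)"
    using App.prems(1) by simp_all
  show ?case
    unfolding trans_trm.simps
  proof (rule wff_graft[OF _ wf ts App.prems(2,4)])
    show "wff LA (coords \<Delta> (fst (fun_type L f)) @ coord \<Delta> s @ params \<Delta>) (FunC \<Delta> f)"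
      unfolding s by (rule wf_code_Fun[OF wf f])
  next
    fix t s' b assume *: "t \<in> set ts" "has_sort L \<Sigma> t s'"
      "places (coords \<Delta> (fst (fun_type L f)) @ \<Sigma>') b (coord \<Delta> s')"
    show "wff LA (coords \<Delta> (fst (fun_type L f)) @ \<Sigma>')
        (trans_trm L \<Delta> (map (map (\<lambda>i. i + length (coords \<Delta> (fst (fun_type L f))))) \<sigma>)
          (map (\<lambda>i. i + length (coords \<Delta> (fst (fun_type L f)))) \<pi>) b s' t)"
      by (intro App.IH[OF *(1,2) _ _ *(3)] list_all2_shift list_all2_places_shift App.prems refl)
  qed
qed

lemma wff_trans_fm:
  assumes wf: "wf_code L LA \<Delta>" and "wff L \<Sigma> \<phi>" "places \<Sigma>' \<pi> (params \<Delta>)"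
    "list_all2 (\<lambda>b s. places \<Sigma>' b (coord \<Delta> s)) \<sigma> \<Sigma>"
  shows "wff LA \<Sigma>' (trans_fm L \<Delta> \<sigma> \<pi> \<phi>)"
  using assms(2-)
proof (induction \<phi> arbitrary: \<Sigma> \<Sigma>' \<sigma> \<pi>)
  case (Eq s t u)
  then have ts: "list_all2 (has_sort L \<Sigma>) [t, u] [s, s]" by simp
  show ?case
    unfolding trans_fm.simps
  proof (rule wff_graft[OF _ wf ts Eq.prems(2)])
    show "places \<Sigma>' [] []" by simp
    show "wff LA (coords \<Delta> [s, s] @ [] @ params \<Delta>) (EquC \<Delta> s)" using wf_code_Equ[OF wf, of s] by simp
  qed (rule wff_trans_trm[OF wf _ list_all2_shift[OF Eq.prems(2) refl] list_all2_places_shift[OF Eq.prems(3) refl]], assumption+)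
next
  case (Rel r ts)
  then have r: "r \<in> rels L" and ts: "list_all2 (has_sort L \<Sigma>) ts (rel_type L r)" by simp_all
  show ?case
    unfolding trans_fm.simps
  proof (rule wff_graft[OF _ wf ts Rel.prems(2)])
    show "places \<Sigma>' [] []" by simp
    show "wff LA (coords \<Delta> (rel_type L r) @ [] @ params \<Delta>) (RelC \<Delta> r)" using wf_code_Rel[OF wf r] by simp
  qed (rule wff_trans_trm[OF wf _ list_all2_shift[OF Rel.prems(2) refl] list_all2_places_shift[OF Rel.prems(3) refl]], assumption+)
next
  case (Neg \<phi>)
  from Neg.IH[OF _ Neg.prems(2,3)] Neg.prems(1) show ?case by simp
next
  case (And \<phi> \<psi>)
  from And.IH[OF _ And.prems(2,3)] And.prems(1) show ?case by simp
next
  case (Exi s \<phi>)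
  let ?d = "length (coord \<Delta> s)"
  let ?up = "map (\<lambda>i. i + ?d)"
  have b: "places (coord \<Delta> s @ \<Sigma>') [0..<?d] (coord \<Delta> s)"
    using list_all2_upt_wf[of "[]" "coord \<Delta> s" \<Sigma>'] by simp
  have \<pi>: "places (coord \<Delta> s @ \<Sigma>') (?up \<pi>) (params \<Delta>)"
    by (rule list_all2_shift[OF Exi.prems(2) refl])
  have "wff LA (coord \<Delta> s @ \<Sigma>') (inst ([0..<?d] @ ?up \<pi>) (DomC \<Delta> s))"
    by (intro wff_inst[OF wf_code_Dom[OF wf]] list_all2_appendI b \<pi>)
  moreover have "wff LA (coord \<Delta> s @ \<Sigma>') (trans_fm L \<Delta> ([0..<?d] # map ?up \<sigma>) (?up \<pi>) \<phi>)"
  proof (rule Exi.IH[OF _ \<pi>])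
    show "wff L (s # \<Sigma>) \<phi>" using Exi.prems(1) by simp
    show "list_all2 (\<lambda>b s'. places (coord \<Delta> s @ \<Sigma>') b (coord \<Delta> s')) ([0..<?d] # map ?up \<sigma>) (s # \<Sigma>)"
      unfolding list_all2_Cons by (intro conjI b list_all2_places_shift Exi.prems refl)
  qed
  ultimately show ?case unfolding trans_fm.simps Let_def wff_Exs wff.simps ..
qed simp

lemma wff_translate:
  assumes wf: "wf_code L LA \<Delta>" and \<phi>: "wff L ss \<phi>"
  shows "wff LA (coords \<Delta> ss @ params \<Delta>) (translate L \<Delta> ss \<phi>)"
proof -
  let ?n = "length (coords \<Delta> ss)"
  let ?\<pi> = "[?n..<?n + length (params \<Delta>)]"
  have bs: "list_all2 (\<lambda>b s. places (coords \<Delta> ss @ params \<Delta>) b (coord \<Delta> s)) (blocks \<Delta> ss 0) ss"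
    using blocks_wf[of "[]" \<Delta> ss "params \<Delta>"] by simp
  have \<pi>: "places (coords \<Delta> ss @ params \<Delta>) ?\<pi> (params \<Delta>)"
    using list_all2_upt_wf[of "coords \<Delta> ss" "params \<Delta>" "[]"] by simp
  have "\<forall>(s, b)\<in>set (zip ss (blocks \<Delta> ss 0)). wff LA (coords \<Delta> ss @ params \<Delta>) (inst (b @ ?\<pi>) (DomC \<Delta> s))"
  proof (clarify)
    fix s b assume "(s, b) \<in> set (zip ss (blocks \<Delta> ss 0))"
    then have "places (coords \<Delta> ss @ params \<Delta>) b (coord \<Delta> s)"
      using bs by (auto simp: set_zip list_all2_conv_all_nth)
    then show "wff LA (coords \<Delta> ss @ params \<Delta>) (inst (b @ ?\<pi>) (DomC \<Delta> s))"
      by (intro wff_inst[OF wf_code_Dom[OF wf]] list_all2_appendI \<pi>)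
  qed
  moreover have "wff LA (coords \<Delta> ss @ params \<Delta>) (trans_fm L \<Delta> (blocks \<Delta> ss 0) ?\<pi> \<phi>)"
    by (rule wff_trans_fm[OF wf \<phi> \<pi> bs])
  ultimately show ?thesis
    unfolding translate_def Let_def wff.simps wff_Ands by (auto simp: case_prod_unfold)
qed

section \<open>Composition of interpretations\<close>

lemma coords_comp: "coords (comp_code LA LB \<Gamma> \<Delta>) ss = coords \<Delta> (coords \<Gamma> ss)"
  by (induction ss) (simp_all add: comp_code_def)

lemma wf_comp_code:
  assumes \<Gamma>: "wf_code LA LB \<Gamma>" and \<Delta>: "wf_code LB LC \<Delta>"
  shows "wf_code LA LC (comp_code LA LB \<Gamma> \<Delta>)"
proof -
  have sel: "coord (comp_code LA LB \<Gamma> \<Delta>) s = coords \<Delta> (coord \<Gamma> s)" for s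
    by (simp add: comp_code_def)
  have tr: "wff LC (coords \<Delta> (ss @ params \<Gamma>) @ params \<Delta>) (translate LB \<Delta> (ss @ params \<Gamma>) \<phi>)"
    if "wff LB (ss @ params \<Gamma>) \<phi>" for ss \<phi>
    by (rule wff_translate[OF \<Delta> that])
  show ?thesis
    unfolding wf_code_def coords_comp sel
    using tr[OF wf_code_Dom[OF \<Gamma>]] tr[of "coord \<Gamma> _ @ coord \<Gamma> _"] wf_code_Equ[OF \<Gamma>]
      tr[of "coords \<Gamma> _ @ coord \<Gamma> _"] wf_code_Fun[OF \<Gamma>] tr[OF wf_code_Rel[OF \<Gamma>]]
    by (simp add: comp_code_def)
qed

text \<open>Left inverse of \<open>concat\<close> on lists whose blocks have the lengths prescribed
  by the code; a composite coordinate map receives only the flat tuple.\<close>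

primrec chop :: "('s, 'f, 'r, 't, 'g, 'q) code \<Rightarrow> 's list \<Rightarrow> 'u list \<Rightarrow> 'u list list" where
  "chop \<Delta> [] xs = []"
| "chop \<Delta> (s # ss) xs = take (length (coord \<Delta> s)) xs # chop \<Delta> ss (drop (length (coord \<Delta> s)) xs)"

lemma chop_concat:
  "list_all2 (\<lambda>u s. length u = length (coord \<Delta> s)) us ss \<Longrightarrow> chop \<Delta> ss (concat us) = us"
  by (induction us ss rule: list_all2_induct) auto

definition comp_map ::
  "('s, 'f, 'r, 't, 'g, 'q) code \<Rightarrow> ('s \<Rightarrow> 'v list \<Rightarrow> 'a) \<Rightarrow> ('t, 'g, 'q, 'w, 'h, 'k) code \<Rightarrow>
   ('t \<Rightarrow> 'u list \<Rightarrow> 'v) \<Rightarrow> 's \<Rightarrow> 'u list \<Rightarrow> 'a" where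
  "comp_map \<Gamma> \<mu> \<Delta> \<nu> s u = \<mu> s (map2 \<nu> (coord \<Gamma> s) (chop \<Delta> (coord \<Gamma> s) u))"

lemma map2_concat:
  assumes "list_all2 (\<lambda>us s. length us = length (c s)) uss ss"
  shows "map2 f (concat (map c ss)) (concat uss) = concat (map2 (\<lambda>s us. map2 f (c s) us) ss uss)"
  using assms by (induction uss ss rule: list_all2_induct) auto

context realization
begin

context
  fixes LG :: "('x, 'y, 'z) lang" and \<Gamma> :: "('x, 'y, 'z, 's, 'f, 'r) code"
    and X :: "('x, 'y, 'z, 'a) model" and \<mu> ps p
  assumes wf\<Gamma>: "wf_code LG L \<Gamma>" and real\<Gamma>: "realizes LG \<Gamma> B p X \<mu>"
    and ps: "ps \<in> tuples D (params \<Gamma>)" and p: "p = map2 \<nu> (params \<Gamma>) ps"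
begin

abbreviation "\<Xi> \<equiv> comp_code LG L \<Gamma> \<Delta>"

text \<open>The parameters of the outer code are elements of the interpreted structure and enter
  through representatives \<open>ps\<close>, so they are treated as further blocks behind those of
  the arguments.\<close>

lemma sat_translate_comp:
  assumes \<phi>: "wff L (ss @ params \<Gamma>) \<phi>" and us: "us \<in> tuples (\<lambda>s. tuples (Carrier A) (coord \<Delta> s)) ss"
  shows "sat A (concat us @ concat ps @ q) (translate L \<Delta> (ss @ params \<Gamma>) \<phi>) \<longleftrightarrow>
    us \<in> tuples D ss \<and> sat B (map2 \<nu> ss us @ p) \<phi>"
proof -
  have "ps \<in> tuples (\<lambda>s. tuples (Carrier A) (coord \<Delta> s)) (params \<Gamma>)"
    using ps by (rule tuples_mono) (auto simp: dom_set_tuples)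
  with us have "us @ ps \<in> tuples (\<lambda>s. tuples (Carrier A) (coord \<Delta> s)) (ss @ params \<Gamma>)"
    by (rule append_in_tuples)
  from sat_translate[OF \<phi> this] show ?thesis
    using ps length_tuples[OF us] by (simp add: append_in_tuples_iff p)
qed

lemma dom_set_comp:
  "u \<in> dom_set \<Xi> A (concat ps @ q) s \<longleftrightarrow>
    (\<exists>us\<in>tuples D (coord \<Gamma> s). u = concat us \<and> map2 \<nu> (coord \<Gamma> s) us \<in> dom_set \<Gamma> B p s)"
    (is "?l \<longleftrightarrow> ?r")
proof
  assume ?l
  then have u: "u \<in> tuples (Carrier A) (coords \<Delta> (coord \<Gamma> s))"
    "sat A (u @ concat ps @ q) (translate L \<Delta> (coord \<Gamma> s @ params \<Gamma>) (DomC \<Gamma> s))"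
    by (auto simp: dom_set_def comp_code_def)
  from u(1) obtain us where us: "u = concat us" "us \<in> tuples (\<lambda>s. tuples (Carrier A) (coord \<Delta> s)) (coord \<Gamma> s)"
    by (rule tuples_coordsE)
  have *: "us \<in> tuples D (coord \<Gamma> s)" "sat B (map2 \<nu> (coord \<Gamma> s) us @ p) (DomC \<Gamma> s)"
    using u(2) sat_translate_comp[OF wf_code_Dom[OF wf\<Gamma>] us(2)] us(1) by auto
  moreover have "map2 \<nu> (coord \<Gamma> s) us \<in> tuples (Carrier B) (coord \<Gamma> s)"
    using *(1) image_D by (intro map2_in_tuples) auto
  ultimately show ?r using us(1) by (auto simp: dom_set_def)
next
  assume ?r
  then obtain us where us: "us \<in> tuples D (coord \<Gamma> s)" "u = concat us"
    "map2 \<nu> (coord \<Gamma> s) us \<in> dom_set \<Gamma> B p s" by blast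
  have us': "us \<in> tuples (\<lambda>s. tuples (Carrier A) (coord \<Delta> s)) (coord \<Gamma> s)"
    using us(1) by (rule tuples_mono) (auto simp: dom_set_tuples)
  have "sat A (u @ concat ps @ q) (translate L \<Delta> (coord \<Gamma> s @ params \<Gamma>) (DomC \<Gamma> s))"
    using sat_translate_comp[OF wf_code_Dom[OF wf\<Gamma>] us'] us by (auto simp: dom_set_def)
  then show ?l using us(2) concat_in_tuples[OF us'] by (simp add: dom_set_def comp_code_def)
qed

lemma comp_map_concat:
  "us \<in> tuples D (coord \<Gamma> s) \<Longrightarrow> comp_map \<Gamma> \<mu> \<Delta> \<nu> s (concat us) = \<mu> s (map2 \<nu> (coord \<Gamma> s) us)"
  unfolding comp_map_def by (simp add: chop_concat[OF tuples_length_list_all2])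

text \<open>Resolves both levels of representation for all arguments at once, so that the clauses
  for operations and relations can pass from the composite to the outer code.\<close>

lemma comp_reps:
  assumes "ws \<in> tuples (dom_set \<Xi> A (concat ps @ q)) ss"
  obtains uss where "uss \<in> tuples (\<lambda>s. tuples D (coord \<Gamma> s)) ss" "ws = map concat uss"
    "map2 (\<lambda>s us. map2 \<nu> (coord \<Gamma> s) us) ss uss \<in> tuples (dom_set \<Gamma> B p) ss"
    "map2 (comp_map \<Gamma> \<mu> \<Delta> \<nu>) ss ws = map2 \<mu> ss (map2 (\<lambda>s us. map2 \<nu> (coord \<Gamma> s) us) ss uss)"
proof -
  have "\<exists>uss. uss \<in> tuples (\<lambda>s. tuples D (coord \<Gamma> s)) ss \<and> ws = map concat uss \<and>
    map2 (\<lambda>s us. map2 \<nu> (coord \<Gamma> s) us) ss uss \<in> tuples (dom_set \<Gamma> B p) ss \<and>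
    map2 (comp_map \<Gamma> \<mu> \<Delta> \<nu>) ss ws = map2 \<mu> ss (map2 (\<lambda>s us. map2 \<nu> (coord \<Gamma> s) us) ss uss)"
    using assms
  proof (induction ss arbitrary: ws)
    case (Cons s ss)
    then obtain w ws' where w: "ws = w # ws'" "w \<in> dom_set \<Xi> A (concat ps @ q) s"
      "ws' \<in> tuples (dom_set \<Xi> A (concat ps @ q)) ss" by (auto simp: in_tuples_Cons)
    from Cons.IH[OF w(3)] obtain uss where uss: "uss \<in> tuples (\<lambda>s. tuples D (coord \<Gamma> s)) ss" "ws' = map concat uss"
      "map2 (\<lambda>s us. map2 \<nu> (coord \<Gamma> s) us) ss uss \<in> tuples (dom_set \<Gamma> B p) ss"
      "map2 (comp_map \<Gamma> \<mu> \<Delta> \<nu>) ss ws' = map2 \<mu> ss (map2 (\<lambda>s us. map2 \<nu> (coord \<Gamma> s) us) ss uss)"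
      by (elim exE conjE)
    from w(2) obtain us where us: "us \<in> tuples D (coord \<Gamma> s)" "w = concat us"
      "map2 \<nu> (coord \<Gamma> s) us \<in> dom_set \<Gamma> B p s" unfolding dom_set_comp by (elim bexE conjE)
    show ?case
      using uss us w(1) by (intro exI[of _ "us # uss"]) (simp add: comp_map_concat)
  qed simp
  then show ?thesis using that by (elim exE conjE)
qed

lemma sat_comp:
  assumes \<phi>: "wff L (coords \<Gamma> ss @ params \<Gamma>) \<phi>" and uss: "uss \<in> tuples (\<lambda>s. tuples D (coord \<Gamma> s)) ss"
  shows "sat A (concat (map concat uss) @ concat ps @ q) (translate L \<Delta> (coords \<Gamma> ss @ params \<Gamma>) \<phi>) \<longleftrightarrow>
    sat B (concat (map2 (\<lambda>s us. map2 \<nu> (coord \<Gamma> s) us) ss uss) @ p) \<phi>"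
proof -
  have c: "concat uss \<in> tuples D (coords \<Gamma> ss)"
    using uss by (rule concat_in_tuples)
  then have c': "concat uss \<in> tuples (\<lambda>s. tuples (Carrier A) (coord \<Delta> s)) (coords \<Gamma> ss)"
    by (rule tuples_mono) (auto simp: dom_set_tuples)
  have "list_all2 (\<lambda>us s. length us = length (coord \<Gamma> s)) uss ss"
    using uss unfolding tuples_def[of _ ss] by (auto simp: length_tuples elim!: list_all2_mono)
  then have "map2 \<nu> (coords \<Gamma> ss) (concat uss) = concat (map2 (\<lambda>s us. map2 \<nu> (coord \<Gamma> s) us) ss uss)"
    by (rule map2_concat)
  moreover have "concat (map concat uss) = concat (concat uss)" by (induction uss) auto
  ultimately show ?thesis
    using sat_translate_comp[OF \<phi> c'] c by simp
qed

text \<open>Each clause is reduced by the translation to the outer code over the interpreted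
  structure and settled by the outer realization. Equality and graphs are handled like relations,
  the second element or the value being appended to the list of arguments.\<close>

lemma realizes_comp_code: "realizes LG \<Xi> A (concat ps @ q) X (comp_map \<Gamma> \<mu> \<Delta> \<nu>)"
  unfolding realizes_def
proof (intro conjI allI ballI)
  fix s
  show "comp_map \<Gamma> \<mu> \<Delta> \<nu> s ` dom_set \<Xi> A (concat ps @ q) s = Carrier X s"
  proof (intro equalityI subsetI)
    fix a assume "a \<in> comp_map \<Gamma> \<mu> \<Delta> \<nu> s ` dom_set \<Xi> A (concat ps @ q) s"
    then obtain us where "us \<in> tuples D (coord \<Gamma> s)" "a = comp_map \<Gamma> \<mu> \<Delta> \<nu> s (concat us)"
      "map2 \<nu> (coord \<Gamma> s) us \<in> dom_set \<Gamma> B p s" by (auto simp: dom_set_comp)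
    then show "a \<in> Carrier X s" using realizes_image[OF real\<Gamma>, of s] by (auto simp: comp_map_concat)
  next
    fix a assume "a \<in> Carrier X s"
    then obtain v where v: "v \<in> dom_set \<Gamma> B p s" "a = \<mu> s v" using realizes_image[OF real\<Gamma>, of s] by blast
    obtain us where us: "us \<in> tuples D (coord \<Gamma> s)" "map2 \<nu> (coord \<Gamma> s) us = v"
      using tuples_imageE[OF dom_set_tuples[OF v(1)], of \<nu> D] image_D by blast
    have "concat us \<in> dom_set \<Xi> A (concat ps @ q) s" using us v dom_set_comp by blast
    moreover have "a = comp_map \<Gamma> \<mu> \<Delta> \<nu> s (concat us)" using us v comp_map_concat by simp
    ultimately show "a \<in> comp_map \<Gamma> \<mu> \<Delta> \<nu> s ` dom_set \<Xi> A (concat ps @ q) s" by blast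
  qed
next
  fix s u v assume "u \<in> dom_set \<Xi> A (concat ps @ q) s" "v \<in> dom_set \<Xi> A (concat ps @ q) s"
  then have "[u, v] \<in> tuples (dom_set \<Xi> A (concat ps @ q)) [s, s]" by simp
  then obtain uss where uss: "uss \<in> tuples (\<lambda>s. tuples D (coord \<Gamma> s)) [s, s]" "[u, v] = map concat uss"
    "map2 (\<lambda>s us. map2 \<nu> (coord \<Gamma> s) us) [s, s] uss \<in> tuples (dom_set \<Gamma> B p) [s, s]"
    "map2 (comp_map \<Gamma> \<mu> \<Delta> \<nu>) [s, s] [u, v] = map2 \<mu> [s, s] (map2 (\<lambda>s us. map2 \<nu> (coord \<Gamma> s) us) [s, s] uss)"
    by (rule comp_reps)
  from uss(2) obtain us vs where e: "uss = [us, vs]" "u = concat us" "v = concat vs"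
    by (auto simp: Cons_eq_map_conv)
  have "wff L (coords \<Gamma> [s, s] @ params \<Gamma>) (EquC \<Gamma> s)" using wf_code_Equ[OF wf\<Gamma>, of s] by simp
  from sat_comp[OF this uss(1)]
  have "sat A (u @ v @ concat ps @ q) (EquC \<Xi> s) \<longleftrightarrow>
      sat B (map2 \<nu> (coord \<Gamma> s) us @ map2 \<nu> (coord \<Gamma> s) vs @ p) (EquC \<Gamma> s)"
    by (simp add: e comp_code_def)
  also have "\<dots> \<longleftrightarrow> \<mu> s (map2 \<nu> (coord \<Gamma> s) us) = \<mu> s (map2 \<nu> (coord \<Gamma> s) vs)"
    using uss(3) by (intro realizes_Equ[OF real\<Gamma>]) (simp_all add: e)
  finally show "sat A (u @ v @ concat ps @ q) (EquC \<Xi> s) \<longleftrightarrow>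
      comp_map \<Gamma> \<mu> \<Delta> \<nu> s u = comp_map \<Gamma> \<mu> \<Delta> \<nu> s v"
    using uss(4) by (simp add: e)
next
  fix f ws v
  let ?ss = "fst (fun_type LG f)" and ?s = "snd (fun_type LG f)"
  assume f: "f \<in> funs LG" and ws: "ws \<in> tuples (dom_set \<Xi> A (concat ps @ q)) ?ss"
    and v: "v \<in> dom_set \<Xi> A (concat ps @ q) ?s"
  from ws obtain uss where uss: "uss \<in> tuples (\<lambda>s. tuples D (coord \<Gamma> s)) ?ss" "ws = map concat uss"
    "map2 (\<lambda>s us. map2 \<nu> (coord \<Gamma> s) us) ?ss uss \<in> tuples (dom_set \<Gamma> B p) ?ss"
    "map2 (comp_map \<Gamma> \<mu> \<Delta> \<nu>) ?ss ws = map2 \<mu> ?ss (map2 (\<lambda>s us. map2 \<nu> (coord \<Gamma> s) us) ?ss uss)"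
    by (rule comp_reps)
  from v obtain vs where vs: "vs \<in> tuples D (coord \<Gamma> ?s)" "v = concat vs"
    "map2 \<nu> (coord \<Gamma> ?s) vs \<in> dom_set \<Gamma> B p ?s" unfolding dom_set_comp by (elim bexE conjE)
  have l: "length uss = length ?ss" using length_tuples[OF uss(1)] .
  have "wff L (coords \<Gamma> (?ss @ [?s]) @ params \<Gamma>) (FunC \<Gamma> f)" using wf_code_Fun[OF wf\<Gamma> f] by simp
  moreover have "uss @ [vs] \<in> tuples (\<lambda>s. tuples D (coord \<Gamma> s)) (?ss @ [?s])"
    using uss(1) vs(1) by (intro append_in_tuples) simp_all
  ultimately have "sat A (concat (map concat (uss @ [vs])) @ concat ps @ q)
      (translate L \<Delta> (coords \<Gamma> (?ss @ [?s]) @ params \<Gamma>) (FunC \<Gamma> f)) \<longleftrightarrow>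
    sat B (concat (map2 (\<lambda>s us. map2 \<nu> (coord \<Gamma> s) us) (?ss @ [?s]) (uss @ [vs])) @ p) (FunC \<Gamma> f)"
    by (rule sat_comp)
  then have "sat A (concat ws @ v @ concat ps @ q) (FunC \<Xi> f) \<longleftrightarrow>
    sat B (concat (map2 (\<lambda>s us. map2 \<nu> (coord \<Gamma> s) us) ?ss uss) @ map2 \<nu> (coord \<Gamma> ?s) vs @ p) (FunC \<Gamma> f)"
    by (simp add: uss(2) vs(2) comp_code_def l)
  also have "\<dots> \<longleftrightarrow> \<mu> ?s (map2 \<nu> (coord \<Gamma> ?s) vs) = FunI X f (map2 (comp_map \<Gamma> \<mu> \<Delta> \<nu>) ?ss ws)"
    unfolding uss(4) by (rule realizes_Fun[OF real\<Gamma> f uss(3) vs(3)])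
  finally show "sat A (concat ws @ v @ concat ps @ q) (FunC \<Xi> f) \<longleftrightarrow>
      comp_map \<Gamma> \<mu> \<Delta> \<nu> ?s v = FunI X f (map2 (comp_map \<Gamma> \<mu> \<Delta> \<nu>) ?ss ws)"
    unfolding vs(2) comp_map_concat[OF vs(1)] .
next
  fix f xs assume "f \<in> funs LG" "xs \<in> tuples (Carrier X) (fst (fun_type LG f))"
  then show "FunI X f xs \<in> Carrier X (snd (fun_type LG f))" by (rule realizes_closed[OF real\<Gamma>])
next
  fix r ws
  let ?ss = "rel_type LG r"
  assume r: "r \<in> rels LG" and ws: "ws \<in> tuples (dom_set \<Xi> A (concat ps @ q)) ?ss"
  from ws obtain uss where uss: "uss \<in> tuples (\<lambda>s. tuples D (coord \<Gamma> s)) ?ss" "ws = map concat uss"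
    "map2 (\<lambda>s us. map2 \<nu> (coord \<Gamma> s) us) ?ss uss \<in> tuples (dom_set \<Gamma> B p) ?ss"
    "map2 (comp_map \<Gamma> \<mu> \<Delta> \<nu>) ?ss ws = map2 \<mu> ?ss (map2 (\<lambda>s us. map2 \<nu> (coord \<Gamma> s) us) ?ss uss)"
    by (rule comp_reps)
  have "sat A (concat ws @ concat ps @ q) (RelC \<Xi> r) \<longleftrightarrow>
    sat B (concat (map2 (\<lambda>s us. map2 \<nu> (coord \<Gamma> s) us) ?ss uss) @ p) (RelC \<Gamma> r)"
    using sat_comp[OF wf_code_Rel[OF wf\<Gamma> r] uss(1)] by (simp add: uss(2) comp_code_def)
  also have "\<dots> \<longleftrightarrow> RelI X r (map2 (comp_map \<Gamma> \<mu> \<Delta> \<nu>) ?ss ws)"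
    unfolding uss(4) by (rule realizes_Rel[OF real\<Gamma> r uss(3)])
  finally show "sat A (concat ws @ concat ps @ q) (RelC \<Xi> r) \<longleftrightarrow> RelI X r (map2 (comp_map \<Gamma> \<mu> \<Delta> \<nu>) ?ss ws)" .
qed

end

end

section \<open>Transport of an interpretation along an automorphism\<close>

lemma tuples_map_iff:
  assumes inv: "\<And>x. \<tau> (\<sigma> x) = x"
    and car: "\<And>s x. x \<in> C s \<Longrightarrow> \<sigma> x \<in> C s" "\<And>s x. x \<in> C s \<Longrightarrow> \<tau> x \<in> C s"
  shows "map \<sigma> xs \<in> tuples C \<Sigma> \<longleftrightarrow> xs \<in> tuples C \<Sigma>"
  using car inv by (auto simp: tuples_def list.rel_map elim!: list_all2_mono) metis

text \<open>An automorphism carries a set defined with parameters \<open>q\<close> to the set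
  defined by the same formula with parameters \<open>map \<sigma> q\<close>.\<close>

lemma dom_set_transfer:
  fixes A :: "('t, 'g, 'q, 'u) model"
  assumes wf: "wf_code L LA \<Delta>" and q: "q \<in> tuples (Carrier A) (params \<Delta>)"
    and inv: "\<And>x. \<tau> (\<sigma> x) = x" "\<And>x. \<sigma> (\<tau> x) = x"
    and car: "\<And>s x. x \<in> Carrier A s \<Longrightarrow> \<sigma> x \<in> Carrier A s" "\<And>s x. x \<in> Carrier A s \<Longrightarrow> \<tau> x \<in> Carrier A s"
    and sat: "\<And>\<Sigma> xs \<phi>. wff LA \<Sigma> \<phi> \<Longrightarrow> xs \<in> tuples (Carrier A) \<Sigma> \<Longrightarrow> sat A (map \<sigma> xs) \<phi> \<longleftrightarrow> sat A xs \<phi>"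
  shows "u \<in> dom_set \<Delta> A (map \<sigma> q) s \<longleftrightarrow> map \<tau> u \<in> dom_set \<Delta> A q s"
proof -
  have "map \<sigma> (map \<tau> u) \<in> dom_set \<Delta> A (map \<sigma> q) s \<longleftrightarrow> map \<tau> u \<in> dom_set \<Delta> A q s"
    using sat[OF wf_code_Dom[OF wf], of "map \<tau> u @ q" s] q
    by (auto simp: dom_set_def tuples_map_iff[where \<sigma> = \<sigma> and \<tau> = \<tau>, OF inv(1) car] append_in_tuples simp del: map_map)
  then show ?thesis by (simp add: comp_def inv map_idI)
qed

text \<open>Precomposition with the inverse automorphism moves representatives back to the old
  parameters. This will reduce every admissible generator to \<open>X 1\<close>.\<close>

lemma realizes_transfer:
  fixes A :: "('t, 'g, 'q, 'u) model"
  assumes wf: "wf_code L LA \<Delta>" and real: "realizes L \<Delta> A q B \<nu>"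
    and q: "q \<in> tuples (Carrier A) (params \<Delta>)"
    and inv: "\<And>x. \<tau> (\<sigma> x) = x" "\<And>x. \<sigma> (\<tau> x) = x"
    and car: "\<And>s x. x \<in> Carrier A s \<Longrightarrow> \<sigma> x \<in> Carrier A s" "\<And>s x. x \<in> Carrier A s \<Longrightarrow> \<tau> x \<in> Carrier A s"
    and sat: "\<And>\<Sigma> xs \<phi>. wff LA \<Sigma> \<phi> \<Longrightarrow> xs \<in> tuples (Carrier A) \<Sigma> \<Longrightarrow> sat A (map \<sigma> xs) \<phi> \<longleftrightarrow> sat A xs \<phi>"
  shows "realizes L \<Delta> A (map \<sigma> q) B (\<lambda>s u. \<nu> s (map \<tau> u))"
proof -
  have inv': "map \<tau> (map \<sigma> u) = u" "map \<sigma> (map \<tau> u) = u" for u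
    by (simp_all add: comp_def inv map_idI)
  have dom: "u \<in> dom_set \<Delta> A (map \<sigma> q) s \<longleftrightarrow> map \<tau> u \<in> dom_set \<Delta> A q s" for u s
    using assms by (intro dom_set_transfer)
  have tdom: "us \<in> tuples (dom_set \<Delta> A (map \<sigma> q)) ss \<longleftrightarrow> map (map \<tau>) us \<in> tuples (dom_set \<Delta> A q) ss" for us ss
    by (simp add: tuples_def list.rel_map dom)
  have m2: "map2 (\<lambda>s u. \<nu> s (map \<tau> u)) ss us = map2 \<nu> ss (map (map \<tau>) us)" for ss us
    by (simp add: zip_map2 comp_def case_prod_unfold)
  have cc: "map \<sigma> (concat (map (map \<tau>) us)) = concat us" for us
    by (simp add: map_concat comp_def inv' del: map_map)
       (simp add: inv map_idI)
  have cat: "concat us \<in> tuples (Carrier A) (coords \<Delta> ss)" if "us \<in> tuples (dom_set \<Delta> A q) ss" for us ss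
    by (rule concat_in_tuples[OF tuples_mono[OF that]]) (auto simp: dom_set_tuples)
  show ?thesis
    unfolding realizes_def
  proof (intro conjI allI ballI)
    fix s
    have "dom_set \<Delta> A (map \<sigma> q) s = map \<sigma> ` dom_set \<Delta> A q s"
    proof (intro equalityI subsetI)
      fix u assume "u \<in> dom_set \<Delta> A (map \<sigma> q) s"
      then show "u \<in> map \<sigma> ` dom_set \<Delta> A q s" using dom inv'(2) by (metis imageI)
    next
      fix u assume "u \<in> map \<sigma> ` dom_set \<Delta> A q s"
      then show "u \<in> dom_set \<Delta> A (map \<sigma> q) s" using dom inv'(1) by auto
    qed
    then have "(\<lambda>u. \<nu> s (map \<tau> u)) ` dom_set \<Delta> A (map \<sigma> q) s = (\<lambda>u. \<nu> s (map \<tau> (map \<sigma> u))) ` dom_set \<Delta> A q s"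
      by (simp only: image_image)
    then show "(\<lambda>u. \<nu> s (map \<tau> u)) ` dom_set \<Delta> A (map \<sigma> q) s = Carrier B s"
      unfolding inv' realizes_image[OF real] .
  next
    fix s u v assume uv: "u \<in> dom_set \<Delta> A (map \<sigma> q) s" "v \<in> dom_set \<Delta> A (map \<sigma> q) s"
    have "sat A (map \<sigma> (map \<tau> u @ map \<tau> v @ q)) (EquC \<Delta> s) \<longleftrightarrow> sat A (map \<tau> u @ map \<tau> v @ q) (EquC \<Delta> s)"
      using uv unfolding dom by (intro sat[OF wf_code_Equ[OF wf]] append_in_tuples q dom_set_tuples)
    then show "sat A (u @ v @ map \<sigma> q) (EquC \<Delta> s) \<longleftrightarrow> \<nu> s (map \<tau> u) = \<nu> s (map \<tau> v)"
      unfolding map_append inv' using uv unfolding dom by (simp add: realizes_Equ[OF real])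
  next
    fix f us v
    assume f: "f \<in> funs L" and us: "us \<in> tuples (dom_set \<Delta> A (map \<sigma> q)) (fst (fun_type L f))"
      and v: "v \<in> dom_set \<Delta> A (map \<sigma> q) (snd (fun_type L f))"
    have "sat A (map \<sigma> (concat (map (map \<tau>) us) @ map \<tau> v @ q)) (FunC \<Delta> f) \<longleftrightarrow>
        sat A (concat (map (map \<tau>) us) @ map \<tau> v @ q) (FunC \<Delta> f)"
      using us v unfolding dom tdom by (intro sat[OF wf_code_Fun[OF wf f]] append_in_tuples q cat) (auto simp: dom_set_tuples)
    then show "sat A (concat us @ v @ map \<sigma> q) (FunC \<Delta> f) \<longleftrightarrow>
        \<nu> (snd (fun_type L f)) (map \<tau> v) = FunI B f (map2 (\<lambda>s u. \<nu> s (map \<tau> u)) (fst (fun_type L f)) us)"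
      unfolding map_append inv' cc m2 using us v unfolding dom tdom by (simp add: realizes_Fun[OF real f])
  next
    fix f xs assume "f \<in> funs L" "xs \<in> tuples (Carrier B) (fst (fun_type L f))"
    then show "FunI B f xs \<in> Carrier B (snd (fun_type L f))" by (rule realizes_closed[OF real])
  next
    fix r us assume r: "r \<in> rels L" and us: "us \<in> tuples (dom_set \<Delta> A (map \<sigma> q)) (rel_type L r)"
    have "sat A (map \<sigma> (concat (map (map \<tau>) us) @ q)) (RelC \<Delta> r) \<longleftrightarrow> sat A (concat (map (map \<tau>) us) @ q) (RelC \<Delta> r)"
      using us unfolding tdom by (intro sat[OF wf_code_Rel[OF wf r]] append_in_tuples q cat)
    then show "sat A (concat us @ map \<sigma> q) (RelC \<Delta> r) \<longleftrightarrow> RelI B r (map2 (\<lambda>s u. \<nu> s (map \<tau> u)) (rel_type L r) us)"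
      unfolding map_append cc m2 using us unfolding tdom by (simp add: realizes_Rel[OF real r])
  qed
qed

section \<open>Laurent polynomials\<close>

type_synonym 'a laurent_model = "(unit, ring_fun, unit, int \<Rightarrow>\<^sub>0 'a) model"
type_synonym 'a super_model = "(list_sort, list_fun, list_rel, 'a list_elem) model"
type_synonym 'a laurent = "int \<Rightarrow>\<^sub>0 'a"

abbreviation cf :: "'a::zero laurent \<Rightarrow> int \<Rightarrow> 'a" where "cf \<equiv> Poly_Mapping.lookup"
abbreviation monom :: "int \<Rightarrow> 'a::zero \<Rightarrow> 'a laurent" where "monom \<equiv> Poly_Mapping.single"
abbreviation X :: "int \<Rightarrow> 'a::zero_neq_one laurent" where "X k \<equiv> monom k 1"
abbreviation C :: "'a::zero \<Rightarrow> 'a laurent" where "C \<equiv> monom 0"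
abbreviation supp :: "'a::zero laurent \<Rightarrow> int set" where "supp \<equiv> Poly_Mapping.keys"

lemma cf_monom: "cf (monom k a) l = (if l = k then a else 0)"
  by (simp add: lookup_single when_def)

lemma monom_mult: "monom k a * monom l b = monom (k + l) (a * (b::'a::semiring_0))"
  by (simp add: mult_single)

lemma X_mult: "X k * X l = (X (k + l) :: 'a::field laurent)"
  by (simp add: monom_mult)

lemma monom_power: "monom k (a::'a::field) ^ n = monom (int n * k) (a ^ n)"
  by (induction n) (simp_all add: monom_mult algebra_simps)

lemma monom_eq_iff: "monom k a = monom l b \<longleftrightarrow> (k = l \<and> a = b) \<or> (a = 0 \<and> b = 0)"
  by (auto simp: poly_mapping_eq_iff fun_eq_iff cf_monom split: if_splits)

lemma monom_eq_0_iff [simp]: "monom k a = 0 \<longleftrightarrow> a = 0"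
  using monom_eq_iff[of k a 0 0] by auto

lemma laurent_expansion:
  assumes "finite S" "supp f \<subseteq> S"
  shows "f = (\<Sum>k\<in>S. monom k (cf f k))"
proof (rule poly_mapping_eqI)
  fix l
  have "cf (\<Sum>k\<in>S. monom k (cf f k)) l = (\<Sum>k\<in>S. if k = l then cf f k else 0)"
    unfolding lookup_sum by (intro sum.cong) (auto simp: cf_monom)
  also have "\<dots> = cf f l"
    using assms by (auto simp: in_keys_iff)
  finally show "cf f l = cf (\<Sum>k\<in>S. monom k (cf f k)) l" ..
qed

lemma cf_monom_mult: "cf (monom k a * g) l = (a::'a::field) * cf g (l - k)"
proof -
  have "monom k a * g = (\<Sum>j\<in>supp g. monom (k + j) (a * cf g j))"
    by (subst laurent_expansion[of "supp g" g]) (simp_all add: sum_distrib_left monom_mult)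
  then have "cf (monom k a * g) l = (\<Sum>j\<in>supp g. cf (monom (k + j) (a * cf g j)) l)"
    by (simp only: lookup_sum)
  also have "\<dots> = (\<Sum>j\<in>supp g. if j = l - k then a * cf g j else 0)"
    by (intro sum.cong) (auto simp: cf_monom)
  also have "\<dots> = a * cf g (l - k)"
    by (auto simp: in_keys_iff)
  finally show ?thesis .
qed

lemma cf_mult:
  assumes "finite S" "supp f \<subseteq> S"
  shows "cf (f * g) l = (\<Sum>k\<in>S. cf f k * (cf g (l - k) :: 'a::field))"
proof -
  have "f * g = (\<Sum>k\<in>S. monom k (cf f k) * g)"
    by (subst laurent_expansion[OF assms]) (simp add: sum_distrib_right)
  then show ?thesis by (simp add: lookup_sum cf_monom_mult)
qed

text \<open>Covers both substitutions for x that occur: evaluation at a nonzero scalar and the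
  automorphisms \<open>twist\<close>. A multiplicative \<open>m\<close> on all integers encodes that
  the image of x is a unit.\<close>

locale laurent_hom =
  fixes \<phi> :: "'a::field \<Rightarrow> 'b::comm_ring_1" and m :: "int \<Rightarrow> 'b"
  assumes \<phi>_add: "\<phi> (a + b) = \<phi> a + \<phi> b" and \<phi>_mult: "\<phi> (a * b) = \<phi> a * \<phi> b" and \<phi>_1: "\<phi> 1 = 1"
    and m_add: "m (k + l) = m k * m l" and m_0: "m 0 = 1"
begin

definition hom :: "'a laurent \<Rightarrow> 'b" where
  "hom f = (\<Sum>k\<in>supp f. \<phi> (cf f k) * m k)"

lemma \<phi>_0: "\<phi> 0 = 0"
  using \<phi>_add[of 0 0] by simp

text \<open>Addition can cancel coefficients, so sums have to be compared over a common finite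
  superset of the supports.\<close>

lemma hom_superset: "finite S \<Longrightarrow> supp f \<subseteq> S \<Longrightarrow> hom f = (\<Sum>k\<in>S. \<phi> (cf f k) * m k)"
  unfolding hom_def by (rule sum.mono_neutral_left) (auto simp: in_keys_iff \<phi>_0)

lemma hom_0 [simp]: "hom 0 = 0"
  by (simp add: hom_def)

lemma hom_add: "hom (f + g) = hom f + hom g"
proof -
  let ?S = "supp f \<union> supp g"
  have "supp (f + g) \<subseteq> ?S" by (rule keys_add)
  then show ?thesis
    by (simp add: hom_superset[of ?S] lookup_add \<phi>_add algebra_simps sum.distrib)
qed

lemma hom_sum: "hom (\<Sum>i\<in>I. f i) = (\<Sum>i\<in>I. hom (f i))"
  by (induction I rule: infinite_finite_induct) (simp_all add: hom_add)

lemma hom_monom: "hom (monom k a) = \<phi> a * m k"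
  by (subst hom_superset[of "{k}"]) (auto simp: cf_monom in_keys_iff)

lemma hom_1 [simp]: "hom 1 = 1"
  using hom_monom[of 0 1] by (simp add: \<phi>_1 m_0)

lemma hom_mult: "hom (f * g) = hom f * hom g"
proof -
  have "hom (f * g) = hom (\<Sum>k\<in>supp f. \<Sum>l\<in>supp g. monom k (cf f k) * monom l (cf g l))"
    by (simp only: sum_product[symmetric] laurent_expansion[OF finite_keys subset_refl, symmetric])
  also have "\<dots> = (\<Sum>k\<in>supp f. \<Sum>l\<in>supp g. (\<phi> (cf f k) * m k) * (\<phi> (cf g l) * m l))"
    by (simp add: hom_sum monom_mult hom_monom \<phi>_mult m_add mult_ac)
  also have "\<dots> = hom f * hom g"
    by (simp only: sum_product hom_def)
  finally show ?thesis .
qed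

lemma hom_minus: "hom (- f) = - hom f"
  using hom_add[of f "- f"] by (simp add: add_eq_0_iff)

lemma hom_diff: "hom (f - g) = hom f - hom g"
  using hom_add[of f "- g"] by (simp add: hom_minus)

end

section \<open>Width\<close>

definition hi :: "'a::zero laurent \<Rightarrow> int" where "hi f = Max (supp f)"
definition lo :: "'a::zero laurent \<Rightarrow> int" where "lo f = Min (supp f)"
text \<open>A degree up to units: monomials with nonzero coefficient have width 0, so width bounds
  divisors as the degree does for ordinary polynomials. For 0 the extreme exponents are unspecified,
  whence the nonzero hypotheses below.\<close>

definition width :: "'a::zero laurent \<Rightarrow> int" where "width f = hi f - lo f"

lemma hi_eqI: "cf f k \<noteq> 0 \<Longrightarrow> (\<And>l. l > k \<Longrightarrow> cf f l = 0) \<Longrightarrow> hi f = k"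
  unfolding hi_def by (rule Max_eqI) (auto simp: in_keys_iff not_less[symmetric])

lemma lo_eqI: "cf f k \<noteq> 0 \<Longrightarrow> (\<And>l. l < k \<Longrightarrow> cf f l = 0) \<Longrightarrow> lo f = k"
  unfolding lo_def by (rule Min_eqI) (auto simp: in_keys_iff not_less[symmetric])

lemma cf_hi: "f \<noteq> 0 \<Longrightarrow> cf f (hi f) \<noteq> 0"
  using Max_in[of "supp f"] by (auto simp: hi_def in_keys_iff)

lemma cf_lo: "f \<noteq> 0 \<Longrightarrow> cf f (lo f) \<noteq> 0"
  using Min_in[of "supp f"] by (auto simp: lo_def in_keys_iff)

lemma cf_above_hi: "l > hi f \<Longrightarrow> cf f l = 0"
  using Max_ge[OF finite_keys, of l f] unfolding hi_def in_keys_iff by linarith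

lemma cf_below_lo: "l < lo f \<Longrightarrow> cf f l = 0"
  using Min_le[OF finite_keys, of l f] unfolding lo_def in_keys_iff by linarith

lemma lo_le_hi: "f \<noteq> 0 \<Longrightarrow> lo f \<le> hi f"
  using cf_lo cf_above_hi by (metis not_le)

text \<open>At the top exponent only the product of the two leading coefficients contributes, and it
  is nonzero in a field.\<close>

lemma hi_mult:
  fixes f g :: "'a::field laurent"
  assumes "f \<noteq> 0" "g \<noteq> 0" shows "hi (f * g) = hi f + hi g"
proof (rule hi_eqI)
  have "cf (f * g) (hi f + hi g) = (\<Sum>k\<in>supp f. cf f k * cf g (hi f + hi g - k))"
    by (rule cf_mult) auto
  also have "\<dots> = (\<Sum>k\<in>{hi f}. cf f k * cf g (hi f + hi g - k))"
  proof (rule sum.mono_neutral_right)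
    show "{hi f} \<subseteq> supp f" using cf_hi[OF assms(1)] by (simp add: in_keys_iff)
    show "\<forall>k\<in>supp f - {hi f}. cf f k * cf g (hi f + hi g - k) = 0"
    proof
      fix k assume "k \<in> supp f - {hi f}"
      then have "k < hi f" using cf_above_hi[of f k] by (force simp: in_keys_iff)
      then show "cf f k * cf g (hi f + hi g - k) = 0" by (simp add: cf_above_hi)
    qed
  qed simp
  finally show "cf (f * g) (hi f + hi g) \<noteq> 0" using cf_hi[OF assms(1)] cf_hi[OF assms(2)] by simp
next
  fix l assume l: "l > hi f + hi g"
  have "cf (f * g) l = (\<Sum>k\<in>supp f. cf f k * cf g (l - k))" by (rule cf_mult) auto
  also have "\<dots> = 0"
  proof (rule sum.neutral, rule ballI)
    fix k assume "k \<in> supp f"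
    then have "k \<le> hi f" using cf_above_hi[of f k] by (force simp: in_keys_iff)
    then show "cf f k * cf g (l - k) = 0" using l by (simp add: cf_above_hi)
  qed
  finally show "cf (f * g) l = 0" .
qed

lemma lo_mult:
  fixes f g :: "'a::field laurent"
  assumes "f \<noteq> 0" "g \<noteq> 0" shows "lo (f * g) = lo f + lo g"
proof (rule lo_eqI)
  have "cf (f * g) (lo f + lo g) = (\<Sum>k\<in>supp f. cf f k * cf g (lo f + lo g - k))"
    by (rule cf_mult) auto
  also have "\<dots> = (\<Sum>k\<in>{lo f}. cf f k * cf g (lo f + lo g - k))"
  proof (rule sum.mono_neutral_right)
    show "{lo f} \<subseteq> supp f" using cf_lo[OF assms(1)] by (simp add: in_keys_iff)
    show "\<forall>k\<in>supp f - {lo f}. cf f k * cf g (lo f + lo g - k) = 0"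
    proof
      fix k assume "k \<in> supp f - {lo f}"
      then have "k > lo f" using cf_below_lo[of k f] by (force simp: in_keys_iff)
      then show "cf f k * cf g (lo f + lo g - k) = 0" by (simp add: cf_below_lo)
    qed
  qed simp
  finally show "cf (f * g) (lo f + lo g) \<noteq> 0" using cf_lo[OF assms(1)] cf_lo[OF assms(2)] by simp
next
  fix l assume l: "l < lo f + lo g"
  have "cf (f * g) l = (\<Sum>k\<in>supp f. cf f k * cf g (l - k))" by (rule cf_mult) auto
  also have "\<dots> = 0"
  proof (rule sum.neutral, rule ballI)
    fix k assume "k \<in> supp f"
    then have "k \<ge> lo f" using cf_below_lo[of k f] by (force simp: in_keys_iff)
    then show "cf f k * cf g (l - k) = 0" using l by (simp add: cf_below_lo)
  qed
  finally show "cf (f * g) l = 0" .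
qed

lemma width_mult:
  fixes f g :: "'a::field laurent"
  shows "f \<noteq> 0 \<Longrightarrow> g \<noteq> 0 \<Longrightarrow> width (f * g) = width f + width g"
  by (simp add: width_def hi_mult lo_mult)

lemma width_nonneg: "f \<noteq> 0 \<Longrightarrow> width f \<ge> 0"
  by (simp add: width_def lo_le_hi)

lemma width_dvd_le:
  fixes f g :: "'a::field laurent"
  assumes "f dvd g" "g \<noteq> 0" shows "width f \<le> width g"
proof -
  obtain h where h: "g = f * h" using assms(1) by blast
  with assms(2) have "f \<noteq> 0" "h \<noteq> 0" by auto
  then show ?thesis using width_mult[of f h] width_nonneg[of h] h by simp
qed

lemma hi_monom: "a \<noteq> 0 \<Longrightarrow> hi (monom k a) = k"
  by (rule hi_eqI) (auto simp: cf_monom)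

lemma lo_monom: "a \<noteq> 0 \<Longrightarrow> lo (monom k a) = k"
  by (rule lo_eqI) (auto simp: cf_monom)

text \<open>Turns divisibility by such an element into a bound on \<open>\<bar>k\<bar>\<close>. A
  general \<open>c\<close> is allowed for the sake of linear factors and of generators c
  x^k.\<close>

lemma width_monom_diff_1:
  assumes "k \<noteq> 0" "(c::'a::field) \<noteq> 0"
  shows "monom k c - 1 \<noteq> 0" "width (monom k c - 1) = \<bar>k\<bar>"
proof -
  have cf: "cf (monom k c - 1) l = (if l = k then c else if l = 0 then - 1 else 0)" for l
    using assms(1) by (simp add: lookup_minus cf_monom lookup_one when_def)
  have "cf (monom k c - 1) 0 \<noteq> 0" using assms by (simp add: cf)
  then show "monom k c - 1 \<noteq> 0" by (metis lookup_zero)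
  have "hi (monom k c - 1) = max k 0"
    by (rule hi_eqI) (use assms in \<open>auto simp: cf max_def split: if_splits\<close>)
  moreover have "lo (monom k c - 1) = min k 0"
    by (rule lo_eqI) (use assms in \<open>auto simp: cf min_def split: if_splits\<close>)
  ultimately show "width (monom k c - 1) = \<bar>k\<bar>" by (simp add: width_def)
qed

text \<open>A divisor of 1 has width 0, which leaves room for a single exponent.\<close>

lemma laurent_unit_iff:
  fixes f :: "'a::field laurent"
  shows "f dvd 1 \<longleftrightarrow> (\<exists>k a. a \<noteq> 0 \<and> f = monom k a)"
proof
  assume "f dvd 1"
  then have "f \<noteq> 0" "width f \<le> width (1 :: 'a laurent)" by (auto intro: width_dvd_le)
  moreover have "width (1 :: 'a laurent) = 0"
    unfolding width_def using hi_monom[of "1::'a" 0] lo_monom[of "1::'a" 0] by simp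
  ultimately have e: "hi f = lo f" and 0: "f \<noteq> 0" using lo_le_hi[of f] by (auto simp: width_def)
  have "f = monom (hi f) (cf f (hi f))"
  proof (rule poly_mapping_eqI)
    fix k
    show "cf f k = cf (monom (hi f) (cf f (hi f))) k"
      using cf_above_hi[of f k] cf_below_lo[of k f] e by (cases k "hi f" rule: linorder_cases) (auto simp: cf_monom)
  qed
  then show "\<exists>k a. a \<noteq> 0 \<and> f = monom k a" using cf_hi[OF 0] by blast
next
  assume "\<exists>k a. a \<noteq> 0 \<and> f = monom k a"
  then obtain k a where "a \<noteq> 0" "f = monom k a" by blast
  then have "f * monom (- k) (inverse a) = 1" by (simp add: monom_mult)
  then show "f dvd 1" by (metis dvd_triv_left)
qed

section \<open>Evaluation\<close>

lemma diff_dvd_power_diff: "x - y dvd x ^ n - (y ^ n :: 'a::comm_ring_1)"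
  by (metis dvd_triv_left power_diff_sumr2)

definition ev :: "'a::field \<Rightarrow> 'a laurent \<Rightarrow> 'a" where
  "ev \<alpha> = laurent_hom.hom (\<lambda>a. a) (\<lambda>k. \<alpha> powi k)"

context
  fixes \<alpha> :: "'a::field" assumes \<alpha>: "\<alpha> \<noteq> 0"
begin

interpretation laurent_hom "\<lambda>a::'a. a" "\<lambda>k. \<alpha> powi k"
  by unfold_locales (use \<alpha> in \<open>auto simp: power_int_add\<close>)

lemma ev_add: "ev \<alpha> (f + g) = ev \<alpha> f + ev \<alpha> g"
  and ev_diff: "ev \<alpha> (f - g) = ev \<alpha> f - ev \<alpha> g"
  and ev_mult: "ev \<alpha> (f * g) = ev \<alpha> f * ev \<alpha> g"
  and ev_monom: "ev \<alpha> (monom k a) = a * \<alpha> powi k"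
  and ev_sum: "ev \<alpha> (\<Sum>i\<in>I. F i) = (\<Sum>i\<in>I. ev \<alpha> (F i))"
  unfolding ev_def by (simp_all add: hom_add hom_diff hom_mult hom_monom hom_sum)

text \<open>Remainder theorem. Negative powers reduce to positive ones because
  \<open>X k - C (\<alpha> powi k)\<close> is a unit multiple of the same expression for
  \<open>- k\<close>.\<close>

lemma X_minus_C_dvd: "X 1 - C \<alpha> dvd f - C (ev \<alpha> f)"
proof -
  have nat: "X 1 - C \<alpha> dvd X (int n) - C (\<alpha> ^ n)" for n
    using diff_dvd_power_diff[of "X 1" "C \<alpha>" n] by (simp add: monom_power)
  have int: "X 1 - C \<alpha> dvd X k - C (\<alpha> powi k)" for k
  proof (cases "k \<ge> 0")
    case True
    then show ?thesis using nat[of "nat k"] by (simp add: power_int_def)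
  next
    case False
    have "X k - C (\<alpha> powi k) = (- monom k (\<alpha> powi k)) * (X (- k) - C (\<alpha> powi (- k)))"
      using \<alpha> by (simp add: right_diff_distrib monom_mult power_int_minus)
    then show ?thesis using nat[of "nat (- k)"] False by (simp add: power_int_def)
  qed
  have "f - C (ev \<alpha> f) = (\<Sum>k\<in>supp f. monom k (cf f k)) - (\<Sum>k\<in>supp f. C (cf f k * \<alpha> powi k))"
  proof -
    have "C (ev \<alpha> f) = (\<Sum>k\<in>supp f. C (cf f k * \<alpha> powi k))"
      unfolding ev_def hom_def by (induction "supp f" rule: infinite_finite_induct)
        (auto simp: single_add intro: poly_mapping_eqI simp: lookup_sum cf_monom)
    then show ?thesis using laurent_expansion[of "supp f" f] by simp
  qed
  also have "\<dots> = (\<Sum>k\<in>supp f. C (cf f k) * (X k - C (\<alpha> powi k)))"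
    by (simp add: sum_subtractf right_diff_distrib monom_mult)
  also have "X 1 - C \<alpha> dvd \<dots>" by (intro dvd_sum dvd_mult int)
  finally show ?thesis .
qed

text \<open>Makes evaluation expressible in the language of rings: the value at \<alpha> is the
  constant congruent to \<open>f\<close> modulo x - \<alpha>.\<close>

lemma ev_eq_iff: "X 1 - C \<alpha> dvd f - C a \<longleftrightarrow> ev \<alpha> f = a"
proof
  assume "X 1 - C \<alpha> dvd f - C a"
  then obtain g where "f - C a = (X 1 - C \<alpha>) * g" by blast
  then have "ev \<alpha> (f - C a) = 0" by (simp add: ev_mult ev_diff ev_monom)
  then show "ev \<alpha> f = a" by (simp add: ev_diff ev_monom)
qed (use X_minus_C_dvd in blast)

end

text \<open>Splitting off a root lowers the width by one, as with the degree of a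
  polynomial.\<close>

lemma finite_ev_roots:
  fixes f :: "'a::field laurent"
  assumes "f \<noteq> 0" shows "finite {\<alpha>. \<alpha> \<noteq> 0 \<and> ev \<alpha> f = 0}"
  using assms
proof (induction "nat (width f)" arbitrary: f rule: less_induct)
  case less
  show ?case
  proof (cases "\<exists>\<alpha>. \<alpha> \<noteq> 0 \<and> ev \<alpha> f = 0")
    case True
    then obtain \<alpha> where \<alpha>: "\<alpha> \<noteq> 0" "ev \<alpha> f = 0" by blast
    then obtain g where g: "f = (X 1 - C \<alpha>) * g" using X_minus_C_dvd[OF \<alpha>(1), of f] by auto
    with less.prems have g0: "g \<noteq> 0" by auto
    \<comment> \<open>Written as a unit times a monomial minus 1, the linear factor is seen to have
      width 1.\<close>
    have "X 1 - C \<alpha> = C \<alpha> * (monom 1 (inverse \<alpha>) - 1 :: 'a laurent)"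
      using \<alpha> by (simp add: right_diff_distrib monom_mult single_uminus)
    moreover have "width (C \<alpha>) = 0" using \<alpha> by (simp add: width_def hi_monom lo_monom)
    ultimately have w: "X 1 - C \<alpha> \<noteq> 0" "width (X 1 - C \<alpha>) = 1"
      using width_monom_diff_1[of 1 "inverse \<alpha>"] \<alpha> by (simp_all add: width_mult)
    have "width f = 1 + width g" unfolding g using w g0 by (simp add: width_mult)
    then have "finite {\<beta>. \<beta> \<noteq> 0 \<and> ev \<beta> g = 0}" using g0 width_nonneg[of g] by (intro less.hyps) auto
    moreover have "{\<beta>. \<beta> \<noteq> 0 \<and> ev \<beta> f = 0} \<subseteq> insert \<alpha> {\<beta>. \<beta> \<noteq> 0 \<and> ev \<beta> g = 0}"
      unfolding g by (auto simp: ev_mult ev_diff ev_monom)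
    ultimately show ?thesis by (rule finite_subset[rotated, OF finite.insertI])
  qed (metis (mono_tags, lifting) Collect_empty_eq finite.emptyI)
qed

text \<open>Here the infinite field enters: over a finite field with q elements, x^(q-1) - 1
  vanishes at every nonzero scalar.\<close>

lemma laurent_eq_by_ev:
  fixes f g :: "'a::field laurent"
  assumes inf: "infinite (UNIV :: 'a set)" and eq: "\<And>\<alpha>. \<alpha> \<noteq> 0 \<Longrightarrow> ev \<alpha> f = ev \<alpha> g"
  shows "f = g"
proof (rule ccontr)
  assume "f \<noteq> g"
  then have "finite {\<alpha>. \<alpha> \<noteq> 0 \<and> ev \<alpha> (f - g) = 0}" by (intro finite_ev_roots) simp
  moreover have "{\<alpha>. \<alpha> \<noteq> 0 \<and> ev \<alpha> (f - g) = 0} = UNIV - {0}" using eq by (auto simp: ev_diff)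
  ultimately show False using inf by simp
qed

section \<open>Divisibility of exponents\<close>

lemma X_dvd_X_if:
  assumes "k dvd m" shows "(X k - 1 :: 'a::field laurent) dvd X m - 1"
proof -
  obtain j where j: "m = k * j" using assms by blast
  have nat: "(X k - 1 :: 'a laurent) dvd X (k * int n) - 1" for n
    using diff_dvd_power_diff[of "X k :: 'a laurent" 1 n] by (simp add: monom_power mult.commute)
  show ?thesis
  proof (cases "j \<ge> 0")
    case True
    then show ?thesis using nat[of "nat j"] j by simp
  next
    case False
    have "X m - 1 = (- X m) * (X (- m) - 1 :: 'a laurent)" by (simp add: right_diff_distrib monom_mult)
    then show ?thesis using nat[of "nat (- j)"] j False by simp
  qed
qed

text \<open>Division with remainder in the exponent: modulo \<open>X k - 1\<close> the exponent m
  may be replaced by a remainder r below \<open>\<bar>k\<bar>\<close>, and then the width excludes r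
  \<noteq> 0.\<close>

lemma X_dvd_X_iff: "(X k - 1 :: 'a::field laurent) dvd X m - 1 \<longleftrightarrow> k dvd m"
proof
  assume d: "(X k - 1 :: 'a laurent) dvd X m - 1"
  show "k dvd m"
  proof (cases "k = 0")
    case True
    then show ?thesis using d monom_eq_iff[of m 1 0 "1::'a"] by simp
  next
    case False
    define r where "r = m mod \<bar>k\<bar>"
    have r: "0 \<le> r" "r < \<bar>k\<bar>" using False by (simp_all add: r_def)
    have kr: "k dvd m - r" unfolding r_def by (metis abs_dvd_iff minus_mod_eq_mult_div dvd_triv_left)
    have "X m - 1 - X r * (X (m - r) - 1) = (X r - 1 :: 'a laurent)"
      by (simp add: right_diff_distrib monom_mult)
    then have "(X k - 1 :: 'a laurent) dvd X r - 1"
      using d X_dvd_X_if[OF kr, where ?'a = 'a] by (metis dvd_diff dvd_mult)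
    have "r = 0"
    proof (rule ccontr)
      assume "r \<noteq> 0"
      then have "\<bar>k\<bar> \<le> \<bar>r\<bar>"
        using width_dvd_le[OF \<open>X k - 1 dvd X r - 1\<close>] width_monom_diff_1[of r "1::'a"]
          width_monom_diff_1[of k "1::'a"] False by simp
      then show False using r by simp
    qed
    then show ?thesis using kr by simp
  qed
qed (rule X_dvd_X_if)

text \<open>A single nonzero element thus bounds a set of exponents, which is how finiteness gets
  expressed by a first-order formula.\<close>

lemma finite_X_dvd:
  assumes "(e :: 'a::field laurent) \<noteq> 0" shows "finite {k. X k - 1 dvd e}"
proof (rule finite_subset)
  show "{k. X k - 1 dvd e} \<subseteq> {- width e..width e}"
  proof
    fix k assume k: "k \<in> {k. X k - 1 dvd e}"
    then have "\<bar>k\<bar> \<le> width e" if "k \<noteq> 0"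
      using width_dvd_le[of "X k - 1" e] assms width_monom_diff_1[of k "1::'a"] that by simp
    then show "k \<in> {- width e..width e}" using width_nonneg[OF assms] by (cases "k = 0") auto
  qed
qed simp

section \<open>Coding by simultaneous congruences\<close>

text \<open>The new modulus is comaximal with the product of the old ones, so a solution can be
  corrected without disturbing the old congruences.\<close>

lemma crt:
  fixes g y :: "'i \<Rightarrow> 'b::comm_ring_1"
  assumes "finite K" and "\<And>i j. i \<in> K \<Longrightarrow> j \<in> K \<Longrightarrow> i \<noteq> j \<Longrightarrow> \<exists>a b. a * g i + b * g j = 1"
  shows "\<exists>f. \<forall>i\<in>K. g i dvd f - y i"
  using assms
proof (induction K rule: finite_induct)
  case (insert i K)
  have "\<exists>a b. a * g i + b * (\<Prod>j\<in>K. g j) = 1"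
    using insert.prems[OF insertI1] \<open>i \<notin> K\<close> insertI2[of _ K i] \<open>finite K\<close>
  proof -
    have "\<exists>a b. a * g i + b * (\<Prod>j\<in>J. g j) = 1" if "finite J" "J \<subseteq> K" for J
      using that
    proof (induction J rule: finite_induct)
      case empty
      show ?case by (rule exI[of _ 0], rule exI[of _ 1]) simp
    next
      case (insert j J)
      then obtain a b where ab: "a * g i + b * (\<Prod>j\<in>J. g j) = 1" by blast
      obtain c d where cd: "c * g i + d * g j = 1"
        using insert.prems insert.hyps \<open>i \<notin> K\<close> \<open>\<And>i' j'. i' \<in> insert i K \<Longrightarrow> j' \<in> insert i K \<Longrightarrow> i' \<noteq> j' \<Longrightarrow> \<exists>a b. a * g i' + b * g j' = 1\<close>
        by (metis insertI1 insert_subset subsetD insertI2)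
      \<comment> \<open>Multiplying two Bezout relations leaves only multiples of \<open>g i\<close>
        and of the enlarged product.\<close>
      have "1 = (a * g i + b * (\<Prod>j\<in>J. g j)) * (c * g i + d * g j)" using ab cd by simp
      also have "\<dots> = (a * c * g i + a * d * g j + b * (\<Prod>j\<in>J. g j) * c) * g i + b * d * (g j * (\<Prod>j\<in>J. g j))"
        by (simp add: algebra_simps)
      finally show ?case using insert.hyps by (metis prod.insert)
    qed
    then show ?thesis using \<open>finite K\<close> by blast
  qed
  then obtain a b where ab: "a * g i + b * (\<Prod>j\<in>K. g j) = 1" by blast
  obtain f where f: "\<forall>j\<in>K. g j dvd f - y j" using insert by blast
  let ?P = "\<Prod>j\<in>K. g j"
  \<comment> \<open>The factor \<open>b * ?P\<close> is 0 modulo every old modulus and 1 modulo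
    \<open>g i\<close>.\<close>
  let ?f = "f + b * ?P * (y i - f)"
  have "?f - y i = (f - y i) * (1 - b * ?P)" by (simp add: algebra_simps)
  also have "1 - b * ?P = a * g i" using ab by (simp add: algebra_simps)
  finally have "g i dvd ?f - y i" by simp
  moreover have "g j dvd ?f - y j" if "j \<in> K" for j
  proof -
    have "g j dvd ?P" using that insert.hyps by (simp add: dvd_prodI)
    then have "g j dvd (f - y j) + b * ?P * (y i - f)" using f that by (intro dvd_add) auto
    then show ?thesis by (simp add: algebra_simps)
  qed
  ultimately show ?case by blast
qed simp

text \<open>\<open>md h k\<close> is a modulus: the \<open>k\<close>-th entry of the sequence coded by \<open>(f, h)\<close> is the constant
  congruent to \<open>f\<close>, as with the moduli \<open>1 + (k + 1) h\<close> of Goedel's beta function.\<close>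

definition md :: "'a::field laurent \<Rightarrow> int \<Rightarrow> 'a laurent" where
  "md h k = 1 + X k * h"

text \<open>Eliminating \<open>h\<close> from the two moduli leaves 1 - x^(k-l), up to sign the
  assumed divisor of \<open>h\<close>; hence \<open>X k * h\<close>, which is
  \<open>md h k - 1\<close>, lies in the ideal they generate, and so does 1.\<close>

lemma md_comaximal:
  assumes "X (k - l) - 1 dvd h" shows "\<exists>a b. a * md h k + b * md h l = 1"
proof -
  obtain e where e: "h = (X (k - l) - 1) * e" using assms by blast
  have "md h k - X (k - l) * md h l = 1 - X (k - l)"
    by (simp add: md_def right_diff_distrib distrib_left mult.assoc[symmetric] monom_mult)
  moreover have "X k * h = - (X k * e) * (1 - X (k - l))"
    unfolding e by (simp add: algebra_simps)
  ultimately have "X k * h = - (X k * e) * (md h k - X (k - l) * md h l)" by simp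
  then have "1 = md h k + (X k * e) * (md h k - X (k - l) * md h l)"
    by (simp add: md_def[of h k, symmetric] eq_neg_iff_add_eq_0) (simp add: md_def)
  then have "(1 + X k * e) * md h k + (- (X k * e * X (k - l))) * md h l = 1"
    by (simp add: algebra_simps)
  then show ?thesis by blast
qed

text \<open>A product of elements x^j - 1 secures the divisibilities; multiplying it by a high power
  of x preserves them and makes the moduli non-units.\<close>

lemma ex_modulus:
  fixes K :: "int set" assumes "finite K"
  shows "\<exists>h :: 'a::field laurent. (\<forall>k\<in>K. \<forall>l\<in>K. k \<noteq> l \<longrightarrow> X (k - l) - 1 dvd h) \<and> (\<forall>k\<in>K. \<not> md h k dvd 1)"
proof -
  obtain N where N: "\<forall>k\<in>K. \<bar>k\<bar> \<le> N"
    using assms by (metis finite_imageI image_eqI Max_ge)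
  \<comment> \<open>Differences of elements of \<open>K\<close> lie between -2N and 2N, and changing
    the sign of j changes x^j - 1 only by a unit.\<close>
  define h0 :: "'a laurent" where "h0 = (\<Prod>j\<in>{1..2 * N}. X j - 1)"
  have h0: "h0 \<noteq> 0" unfolding h0_def using width_monom_diff_1(1)[of _ "1::'a"] by (auto simp: prod_zero_iff)
  have pos: "\<forall>k\<in>supp h0. k \<ge> 0"
  proof -
    have *: "\<forall>k\<in>supp (\<Prod>j\<in>J. X j - 1 :: 'a laurent). k \<ge> 0" if "finite J" "\<forall>j\<in>J. j \<ge> 1" for J :: "int set"
      using that
    proof (induction J rule: finite_induct)
      case (insert j J)
      show ?case
      proof
        fix k assume "k \<in> supp (\<Prod>j\<in>insert j J. X j - 1 :: 'a laurent)"
        then have "k \<in> supp ((X j - 1 :: 'a laurent) * (\<Prod>j\<in>J. X j - 1))" using insert.hyps by simp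
        then obtain a b where ab: "a \<in> supp (X j - 1 :: 'a laurent)" "b \<in> supp (\<Prod>j\<in>J. X j - 1 :: 'a laurent)" "k = a + b"
          using keys_mult[of "X j - 1 :: 'a laurent" "\<Prod>j\<in>J. X j - 1"] by blast
        have "a \<ge> 0"
          using ab(1) insert.prems by (auto simp: in_keys_iff lookup_minus cf_monom lookup_one when_def split: if_splits)
        then show "k \<ge> 0" using ab insert.IH insert.prems by force
      qed
    qed (simp add: in_keys_iff lookup_one when_def)
    show ?thesis unfolding h0_def by (rule *) auto
  qed
  \<comment> \<open>The shift by \<open>N + 1\<close> makes every exponent in \<open>X k * h\<close>
    positive for k \<ge> -N, so the modulus has constant term 1 and at least one further
    term.\<close>
  define h where "h = X (N + 1) * h0"
  have "X (k - l) - 1 dvd h" if "k \<in> K" "l \<in> K" "k \<noteq> l" for k l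
  proof -
    have "(X (k - l) - 1 :: 'a laurent) dvd X \<bar>k - l\<bar> - 1" by (rule X_dvd_X_if) simp
    also have "X \<bar>k - l\<bar> - 1 dvd h0"
      unfolding h0_def using that N[rule_format, OF that(1)] N[rule_format, OF that(2)]
      by (intro dvd_prodI) (auto simp: abs_le_iff)
    finally show ?thesis unfolding h_def by (rule dvd_mult)
  qed
  moreover have "\<not> md h k dvd 1" if k: "k \<in> K" for k
  proof
    assume "md h k dvd 1"
    then obtain i a where ia: "a \<noteq> 0" "md h k = monom i a" unfolding laurent_unit_iff by blast
    have kN: "k + (N + 1) > 0" using N k by force
    have md: "md h k = 1 + X (k + (N + 1)) * h0"
      by (simp add: md_def h_def mult.assoc[symmetric] monom_mult)
    have "cf (X (k + (N + 1)) * h0) 0 = 0"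
      using pos[rule_format, of "- (k + (N + 1))"] kN by (auto simp: cf_monom_mult in_keys_iff)
    then have "cf (monom i a) 0 = 1"
      unfolding ia(2)[symmetric] md by (simp add: lookup_add)
    then have "monom i a = 1" using monom_eq_iff[of i a 0 1] by (auto simp: cf_monom split: if_splits)
    then have "X (k + (N + 1)) * h0 = 0" using md ia by simp
    then show False using h0 by simp
  qed
  ultimately show ?thesis by blast
qed

text \<open>Non-unit moduli are part of the conclusion because only then can distinct constants not
  be residues at the same index.\<close>

lemma ex_code:
  fixes y :: "int \<Rightarrow> 'a::field laurent" assumes "finite K"
  shows "\<exists>h f. (\<forall>k\<in>K. \<not> md h k dvd 1) \<and> (\<forall>k\<in>K. md h k dvd f - y k)"
proof -
  obtain h :: "'a laurent" where h: "\<forall>k\<in>K. \<forall>l\<in>K. k \<noteq> l \<longrightarrow> X (k - l) - 1 dvd h" "\<forall>k\<in>K. \<not> md h k dvd 1"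
    using ex_modulus[OF assms] by blast
  have "\<exists>f. \<forall>k\<in>K. md h k dvd f - y k"
    by (rule crt[OF assms]) (use h md_comaximal in blast)
  then show ?thesis using h(2) by blast
qed

text \<open>Nonnegative exponents are those that can be reached from \<open>0\<close> by unit steps inside a finite
  set; the finite sets are parametrised by \<open>e\<close>, which bounds them, and by \<open>h\<close> and \<open>f\<close>.\<close>

lemma nonneg_iff_ex_chain:
  "n \<ge> 0 \<longleftrightarrow> (\<exists>(e :: 'a::field laurent) (h :: 'a laurent) f. e \<noteq> 0 \<and> md h 0 dvd f \<and>
     (\<forall>k. (k = 0 \<or> X k - 1 dvd e) \<and> md h k dvd f \<longrightarrow>
        k = n \<or> (k + 1 = 0 \<or> X (k + 1) - 1 dvd e) \<and> md h (k + 1) dvd f))"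
proof
  assume n: "n \<ge> 0"
  \<comment> \<open>Chosen so that 1, ..., n belong to the bounded set. The exponent 0 has to be
    added separately, since \<open>X 0 - 1\<close> vanishes and divides only 0.\<close>
  define e :: "'a laurent" where "e = (\<Prod>j\<in>{1..n}. X j - 1)"
  have e: "e \<noteq> 0" unfolding e_def using width_monom_diff_1(1)[of _ "1::'a"] by (auto simp: prod_zero_iff)
  define K where "K = insert 0 {k. X k - 1 dvd e}"
  have K: "finite K" unfolding K_def using finite_X_dvd[OF e] by simp
  \<comment> \<open>Residue 0 marks the exponents 0, ..., n and residue 1 the rest of
    \<open>K\<close>; non-unit moduli keep the two apart.\<close>
  obtain h f :: "'a laurent" where hf: "\<forall>k\<in>K. \<not> md h k dvd 1"
    "\<forall>k\<in>K. md h k dvd f - (if 0 \<le> k \<and> k \<le> n then 0 else 1)" using ex_code[OF K, of "\<lambda>k. if 0 \<le> k \<and> k \<le> n then 0 else 1"] by blast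
  have iff: "md h k dvd f \<longleftrightarrow> 0 \<le> k \<and> k \<le> n" if "k \<in> K" for k
  proof
    assume d: "md h k dvd f"
    show "0 \<le> k \<and> k \<le> n"
    proof (rule ccontr)
      assume "\<not> (0 \<le> k \<and> k \<le> n)"
      then have "md h k dvd f - 1" using hf(2) that by auto
      then have "md h k dvd f - (f - 1)" using d by (rule dvd_diff[rotated])
      then show False using hf(1) that by simp
    qed
  qed (use hf(2) that in auto)
  have inK: "k \<in> K" if "0 \<le> k" "k \<le> n" for k
  proof (cases "k = 0")
    case False
    then have "X k - 1 dvd e" unfolding e_def using that by (intro dvd_prodI) auto
    then show ?thesis by (simp add: K_def)
  qed (simp add: K_def)
  show "\<exists>(e :: 'a laurent) (h :: 'a laurent) f. e \<noteq> 0 \<and> md h 0 dvd f \<and>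
     (\<forall>k. (k = 0 \<or> X k - 1 dvd e) \<and> md h k dvd f \<longrightarrow>
        k = n \<or> (k + 1 = 0 \<or> X (k + 1) - 1 dvd e) \<and> md h (k + 1) dvd f)"
  proof (rule exI[of _ e], rule exI[of _ h], rule exI[of _ f], intro conjI allI impI)
    show "e \<noteq> 0" by fact
    show "md h 0 dvd f" using iff[OF inK[of 0]] n by simp
    fix k assume k: "(k = 0 \<or> X k - 1 dvd e) \<and> md h k dvd f"
    then have "k \<in> K" by (auto simp: K_def)
    then have "0 \<le> k \<and> k \<le> n" using iff k by blast
    then have "k = n \<or> 0 \<le> k + 1 \<and> k + 1 \<le> n" by auto
    then show "k = n \<or> (k + 1 = 0 \<or> X (k + 1) - 1 dvd e) \<and> md h (k + 1) dvd f"
      using inK[of "k + 1"] iff[of "k + 1"] unfolding K_def by blast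
  qed
next
  assume "\<exists>(e :: 'a laurent) (h :: 'a laurent) f. e \<noteq> 0 \<and> md h 0 dvd f \<and>
     (\<forall>k. (k = 0 \<or> X k - 1 dvd e) \<and> md h k dvd f \<longrightarrow>
        k = n \<or> (k + 1 = 0 \<or> X (k + 1) - 1 dvd e) \<and> md h (k + 1) dvd f)"
  then obtain e h f :: "'a laurent" where e: "e \<noteq> 0" and 0: "md h 0 dvd f" and
    step: "\<And>k. (k = 0 \<or> X k - 1 dvd e) \<and> md h k dvd f \<Longrightarrow>
        k = n \<or> (k + 1 = 0 \<or> X (k + 1) - 1 dvd e) \<and> md h (k + 1) dvd f" by blast
  define S where "S = {k. (k = 0 \<or> X k - 1 dvd e) \<and> md h k dvd f}"
  have fin: "finite S"
    by (rule finite_subset[of _ "insert 0 {k. X k - 1 dvd e}"]) (use finite_X_dvd[OF e] in \<open>auto simp: S_def\<close>)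
  show "n \<ge> 0"
  proof (rule ccontr)
    assume n: "\<not> n \<ge> 0"
    \<comment> \<open>A chain that starts at 0 never meets a negative \<open>n\<close>, so it cannot
      stop and contradicts finiteness.\<close>
    have "int i \<in> S" for i
    proof (induction i)
      case 0
      show ?case using \<open>md h 0 dvd f\<close> by (simp add: S_def)
    next
      case (Suc i)
      then show ?case using step[of "int i"] n by (simp add: S_def add.commute)
    qed
    then have "range int \<subseteq> S" by auto
    then have "finite (range int)" using fin by (rule finite_subset)
    then show False using finite_imageD[OF _ inj_on_of_nat, of UNIV] by auto
  qed
qed

section \<open>Squares from divisibility\<close>

lemma same_multiples_imp:
  fixes a b :: int
  assumes "\<And>z. a dvd z \<longleftrightarrow> b dvd z" shows "a = b \<or> a = - b"
  using assms by (metis dvd_refl zdvd_antisym_abs abs_eq_iff)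

text \<open>Consecutive integers are coprime, so their common multiples are the multiples of the
  product. This is the source of multiplication.\<close>

lemma consecutive_dvd: "(y::int) dvd z \<and> (y + 1) dvd z \<longleftrightarrow> y * (y + 1) dvd z"
  by (metis divides_mult dvd_mult_left dvd_mult_right coprime_commute coprime_add_one_right)

text \<open>Multiples determine a number only up to sign. The condition with y + 1 alone would also
  admit v = -y^2 - 2y; together with the one for y - 1, every combination of signs leads to the
  square.\<close>

lemma square_iff_dvd:
  "v = y * y \<longleftrightarrow> (\<forall>z. y dvd z \<and> y + 1 dvd z \<longleftrightarrow> v + y dvd z) \<and>
     (\<forall>z::int. y dvd z \<and> y - 1 dvd z \<longleftrightarrow> v - y dvd z)"
proof -
  have 1: "y dvd z \<and> y + 1 dvd z \<longleftrightarrow> y * (y + 1) dvd z" for z by (rule consecutive_dvd)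
  have 2: "y dvd z \<and> y - 1 dvd z \<longleftrightarrow> y * (y - 1) dvd z" for z
    using consecutive_dvd[of "y - 1" z] by (simp add: mult.commute conj_commute)
  show ?thesis unfolding 1 2
  proof
    assume "v = y * y"
    then have "v + y = y * (y + 1)" "v - y = y * (y - 1)" by (simp_all add: algebra_simps)
    then show "(\<forall>z. y * (y + 1) dvd z \<longleftrightarrow> v + y dvd z) \<and> (\<forall>z. y * (y - 1) dvd z \<longleftrightarrow> v - y dvd z)" by simp
  next
    assume "(\<forall>z. y * (y + 1) dvd z \<longleftrightarrow> v + y dvd z) \<and> (\<forall>z. y * (y - 1) dvd z \<longleftrightarrow> v - y dvd z)"
    then have "y * (y + 1) = v + y \<or> y * (y + 1) = - (v + y)" "y * (y - 1) = v - y \<or> y * (y - 1) = - (v - y)"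
      by (metis same_multiples_imp)+
    then consider "v = y * y" | "v = y * y" | "y * y + y = - v - y" "y * y - y = - v + y" | "v + y = - (y * y + y)" "v - y = y * y - y"
      | "v + y = y * y + y" "v - y = - (y * y - y)"
      by (auto simp: algebra_simps)
    then show "v = y * y"
    proof cases
      case 3
      then have "y = 0" by linarith
      then show ?thesis using 3 by simp
    next
      case 4
      then have "y * y + y = 0" by linarith
      then have "y * (y + 1) = 0" by (simp add: algebra_simps)
      then have "y = 0 \<or> y = - 1" by auto
      then show ?thesis using 4 by auto
    next
      case 5
      then show ?thesis by simp
    qed auto
  qed
qed

section \<open>Definability facts about Laurent polynomials\<close>

text \<open>If a and a + 1 are both units, they are monomials differing by 1, which forces exponent
  0. The constants 0 and -1, where one of the two vanishes, are listed separately.\<close>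

lemma constant_iff:
  fixes a :: "'a::field laurent"
  shows "a = 0 \<or> a + 1 = 0 \<or> (a dvd 1 \<and> a + 1 dvd 1) \<longleftrightarrow> (\<exists>c. a = C c)"
proof
  assume "a = 0 \<or> a + 1 = 0 \<or> (a dvd 1 \<and> a + 1 dvd 1)"
  then consider "a = 0" | "a + 1 = 0" | "a dvd 1" "a + 1 dvd 1" by blast
  then show "\<exists>c. a = C c"
  proof cases
    case 1
    then show ?thesis by (intro exI[of _ 0]) simp
  next
    case 2
    then have "a = C (- 1)" by (simp add: single_uminus eq_neg_iff_add_eq_0)
    then show ?thesis by blast
  next
    case 3
    then obtain k c l d where k: "c \<noteq> 0" "a = monom k c" and l: "d \<noteq> 0" "a + 1 = monom l d"
      unfolding laurent_unit_iff by blast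
    have "k = 0"
    proof (rule ccontr)
      assume k0: "k \<noteq> 0"
      have cf: "cf (monom l d) i = cf (monom k c) i + cf 1 i" for i
        unfolding l(2)[symmetric] k(2) by (rule lookup_add)
      have "l = 0" using cf[of 0] k0 by (simp add: cf_monom split: if_splits)
      moreover have "l = k" using cf[of k] k0 k(1) by (simp add: cf_monom lookup_one when_def split: if_splits)
      ultimately show False using k0 by simp
    qed
    then show ?thesis using k by blast
  qed
next
  assume "\<exists>c. a = C c"
  then obtain c where c: "a = C c" by blast
  have *: "C d dvd 1" if "d \<noteq> 0" for d :: 'a using that laurent_unit_iff by blast
  have "a + 1 = C (c + 1)" by (simp add: c single_add)
  then show "a = 0 \<or> a + 1 = 0 \<or> (a dvd 1 \<and> a + 1 dvd 1)"
    using * c by (cases "c = 0"; cases "c + 1 = 0") simp_all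
qed

text \<open>Units are c x^k; evaluation at 1 leaves c, so the congruence modulo x - 1 says that c =
  1.\<close>

lemma X_power_iff:
  fixes u :: "'a::field laurent"
  shows "u dvd 1 \<and> X 1 - 1 dvd u - 1 \<longleftrightarrow> (\<exists>k. u = X k)"
proof
  assume u: "u dvd 1 \<and> X 1 - 1 dvd u - 1"
  then obtain k c where k: "c \<noteq> 0" "u = monom k c" unfolding laurent_unit_iff by blast
  have "ev 1 u = 1" using u ev_eq_iff[of 1 u 1] by simp
  then have "c = 1" by (simp add: k ev_monom)
  then show "\<exists>k. u = X k" using k by blast
next
  assume "\<exists>k. u = X k"
  then obtain k where k: "u = X k" by blast
  then have "u dvd 1" using laurent_unit_iff[of u] by (metis one_neq_zero)
  moreover have "X 1 - 1 dvd u - 1" unfolding k by (rule X_dvd_X_if) simp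
  ultimately show "u dvd 1 \<and> X 1 - 1 dvd u - 1" by blast
qed

text \<open>For t = c x^k the quotient by t - 1 has dimension \<open>\<bar>k\<bar>\<close> over the
  field, so constants represent all of it only for \<open>\<bar>k\<bar> = 1\<close>. By width,
  testing the single element x is enough.\<close>

lemma generator_imp:
  fixes t :: "'a::field laurent"
  assumes "t dvd 1" "\<And>a. t \<noteq> C a" "\<And>f. \<exists>a. t - 1 dvd f - C a"
  obtains c \<epsilon> where "c \<noteq> 0" "\<epsilon> = 1 \<or> \<epsilon> = - 1" "t = monom \<epsilon> c"
proof -
  obtain k c where k: "c \<noteq> 0" "t = monom k c" using assms(1) unfolding laurent_unit_iff by blast
  have k0: "k \<noteq> 0" using assms(2) k by blast
  obtain a where a: "t - 1 dvd X 1 - C a" using assms(3) by blast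
  have cf: "cf (X 1 - C a) l = (if l = 1 then 1 else if l = 0 then - a else 0)" for l
    by (simp add: lookup_minus cf_monom)
  have n0: "X 1 - C a \<noteq> 0" using cf[of 1] by (metis lookup_zero one_neq_zero)
  have "hi (X 1 - C a) = 1" by (rule hi_eqI) (simp_all add: cf)
  moreover have "lo (X 1 - C a) \<ge> 0"
  proof (rule ccontr)
    assume "\<not> lo (X 1 - C a) \<ge> 0"
    then have "cf (X 1 - C a) (lo (X 1 - C a)) = 0" by (simp add: cf)
    then show False using cf_lo[OF n0] by simp
  qed
  ultimately have "width (X 1 - C a) \<le> 1" by (simp add: width_def)
  moreover have "\<bar>k\<bar> \<le> width (X 1 - C a)"
    using width_dvd_le[OF a n0] width_monom_diff_1(2)[OF k0 k(1)] k(2) by simp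
  ultimately have "k = 1 \<or> k = - 1" using k0 by linarith
  then show ?thesis using that k by blast
qed

lemma X_generator: "\<exists>a. X 1 - 1 dvd f - C (a::'a::field)"
  using X_minus_C_dvd[of 1 f] by auto

text \<open>The automorphism \<open>x \<mapsto> c x\<^sup>\<epsilon>\<close> for \<open>\<epsilon> = \<plusminus>1\<close>.\<close>

definition twist :: "int \<Rightarrow> 'a::field \<Rightarrow> 'a laurent \<Rightarrow> 'a laurent" where
  "twist \<epsilon> c = laurent_hom.hom C (\<lambda>k. monom (\<epsilon> * k) (c powi k))"

context
  fixes c :: "'a::field" and \<epsilon> :: int assumes c: "c \<noteq> 0"
begin

interpretation laurent_hom C "\<lambda>k. monom (\<epsilon> * k) (c powi k)"
  by unfold_locales (use c in \<open>simp_all add: single_add monom_mult power_int_add distrib_left\<close>)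

lemma twist_add: "twist \<epsilon> c (f + g) = twist \<epsilon> c f + twist \<epsilon> c g"
  and twist_mult: "twist \<epsilon> c (f * g) = twist \<epsilon> c f * twist \<epsilon> c g"
  and twist_0: "twist \<epsilon> c 0 = 0" and twist_1: "twist \<epsilon> c 1 = 1"
  and twist_monom: "twist \<epsilon> c (monom k a) = monom (\<epsilon> * k) (a * c powi k)"
  and twist_sum: "twist \<epsilon> c (\<Sum>i\<in>I. F i) = (\<Sum>i\<in>I. twist \<epsilon> c (F i))"
  unfolding twist_def by (simp_all add: hom_add hom_mult hom_monom hom_sum monom_mult)

end

text \<open>Since \<epsilon>^2 = 1, substituting first with c and then with d sends x to c
  d^\<epsilon> x, which is x for d = c^(-\<epsilon>).\<close>

lemma twist_twist:
  assumes c: "(c::'a::field) \<noteq> 0" and \<epsilon>: "\<epsilon> = 1 \<or> \<epsilon> = - 1"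
  shows "twist \<epsilon> (c powi (- \<epsilon>)) (twist \<epsilon> c f) = f"
proof -
  have d: "c powi (- \<epsilon>) \<noteq> 0" using c by simp
  have "twist \<epsilon> (c powi (- \<epsilon>)) (twist \<epsilon> c (monom k a)) = monom k a" for k a
  proof -
    have "(c powi (- \<epsilon>)) powi (\<epsilon> * k) = c powi (- k)"
      using \<epsilon> by (auto simp: power_int_mult[symmetric])
    moreover have "c powi k * c powi (- k) = 1" using c by (simp add: power_int_minus)
    ultimately show ?thesis using \<epsilon> by (auto simp add: twist_monom[OF c] twist_monom[OF d] mult.assoc)
  qed
  then have "twist \<epsilon> (c powi (- \<epsilon>)) (twist \<epsilon> c (\<Sum>k\<in>supp f. monom k (cf f k))) = (\<Sum>k\<in>supp f. monom k (cf f k))"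
    by (simp add: twist_sum[OF c] twist_sum[OF d])
  then show ?thesis using laurent_expansion[OF finite_keys subset_refl, of f] by simp
qed

lemma twist_inverse:
  assumes c: "(c::'a::field) \<noteq> 0" and \<epsilon>: "\<epsilon> = 1 \<or> \<epsilon> = - 1"
  shows "twist \<epsilon> c (twist \<epsilon> (c powi (- \<epsilon>)) f) = f"
proof -
  have "(c powi (- \<epsilon>)) powi (- \<epsilon>) = c" using \<epsilon> c by (auto simp: power_int_minus)
  then show ?thesis using twist_twist[of "c powi (- \<epsilon>)" \<epsilon> f] c \<epsilon> by simp
qed

section \<open>The interpretation by pairs of tuples\<close>

abbreviation S :: "'a::field super_model" where
  "S \<equiv> list_super"

lemma Carrier_list_super [simp]:
  "Carrier list_super FieldS = range Fld" "Carrier list_super ListS = range Lst" "Carrier list_super NatS = range Num"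
  "FunI list_super = super_fun" "RelI list_super = super_rel"
  by (simp_all add: list_super_def)

lemma list_lang_simps [simp]:
  "funs list_lang = UNIV" "rels list_lang = UNIV"
  "fun_type list_lang FZero = ([], FieldS)" "fun_type list_lang FOne = ([], FieldS)"
  "fun_type list_lang FAdd = ([FieldS, FieldS], FieldS)" "fun_type list_lang FMul = ([FieldS, FieldS], FieldS)"
  "fun_type list_lang NZero = ([], NatS)" "fun_type list_lang NOne = ([], NatS)"
  "fun_type list_lang NAdd = ([NatS, NatS], NatS)" "fun_type list_lang NMul = ([NatS, NatS], NatS)"
  "fun_type list_lang Len = ([ListS], NatS)" "rel_type list_lang r = [ListS, FieldS, NatS]"
  by (simp_all add: list_lang_def)

lemma ring_lang_simps [simp]:
  "funs ring_lang = UNIV" "rels ring_lang = {}"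
  "fun_type ring_lang RZero = ([], ())" "fun_type ring_lang ROne = ([], ())"
  "fun_type ring_lang RAdd = ([(), ()], ())" "fun_type ring_lang RMul = ([(), ()], ())"
  by (simp_all add: ring_lang_def)

lemma laurent_ring_simps [simp]:
  "Carrier laurent_ring s = UNIV" "FunI laurent_ring = laurent_fun" "RelI laurent_ring r xs = False"
  by (simp_all add: laurent_ring_def)

lemma Gamma0_simps [simp]:
  "params Gamma0 = []" "coord Gamma0 s = [ListS, ListS]"
  "DomC Gamma0 s = Neg (Eq NatS (App Len [Var 0]) (App NZero []))"
  "EquC Gamma0 s = And (inst [0, 2] pad_eq_fm) (inst [1, 3] pad_eq_fm)"
  "FunC Gamma0 RZero = zero_fm" "FunC Gamma0 ROne = one_fm" "FunC Gamma0 RAdd = add_fm" "FunC Gamma0 RMul = mul_fm"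
  by (simp_all add: Gamma0_def)

text \<open>Index 0 also has the default value 0, so equality up to padding can quantify over all
  natural numbers.\<close>

definition entry :: "'a::zero list \<Rightarrow> nat \<Rightarrow> 'a" where
  "entry s i = (if 1 \<le> i \<and> i \<le> length s then s ! (i - 1) else 0)"

lemma wff_entry: "wff list_lang [ListS, NatS, FieldS] entry_fm"
  by (simp add: entry_fm_def)

lemma sat_entry: "sat S [Lst s, Num i, Fld a] entry_fm \<longleftrightarrow> a = entry s i"
  by (auto simp: entry_fm_def entry_def)

lemma wff_coeff: "wff list_lang [ListS, ListS, NatS, NatS, FieldS] coeff_fm"
  by (simp add: coeff_fm_def wff_inst[OF wff_entry])

text \<open>Stated for any injective exponent function because the two tuples use the exponents i
  and -1 - j.\<close>

lemma sum_nth_monom: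
  assumes "inj f"
  shows "cf (\<Sum>i<length p. monom (f i) (p ! i)) k = (if \<exists>i<length p. k = f i then p ! (inv f k) else (0::'a::field))"
proof -
  have "cf (\<Sum>i<length p. monom (f i) (p ! i)) k = (\<Sum>i<length p. if k = f i then p ! i else 0)"
    by (simp add: lookup_sum cf_monom)
  also have "\<dots> = (if \<exists>i<length p. k = f i then p ! (inv f k) else 0)"
  proof (cases "\<exists>i<length p. k = f i")
    case True
    then obtain i where i: "i < length p" "k = f i" by blast
    then have "(\<Sum>i<length p. if k = f i then p ! i else 0) = (\<Sum>j<length p. if j = i then p ! j else 0)"
      using assms by (intro sum.cong) (auto dest: injD)
    then show ?thesis using i assms by auto
  qed (auto intro!: sum.neutral)
  finally show ?thesis .
qed

lemma cf_laurent_of: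
  "cf (laurent_of [Lst p, Lst q]) k = (if k \<ge> 0 then entry p (nat k + 1) else entry q (nat (- k)))"
proof -
  have 1: "cf (\<Sum>i<length p. monom (int i) (p ! i)) k = (if k \<ge> 0 then entry p (nat k + 1) else 0)"
  proof -
    have "(\<exists>i<length p. k = int i) \<longleftrightarrow> k \<ge> 0 \<and> nat k < length p" by (auto simp: nat_less_iff)
    moreover have "inv int k = nat k" if "k \<ge> 0"
      using inv_f_f[OF inj_of_nat[where ?'a = int], of "nat k"] that by simp
    ultimately show ?thesis by (auto simp: sum_nth_monom[OF inj_of_nat] entry_def)
  qed
  have inj: "inj (\<lambda>j. - 1 - int j)" by (auto intro: injI)
  have 2: "cf (\<Sum>j<length q. monom (- 1 - int j) (q ! j)) k = (if k \<ge> 0 then 0 else entry q (nat (- k)))"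
  proof -
    have "(\<exists>j<length q. k = - 1 - int j) \<longleftrightarrow> k < 0 \<and> nat (- k) \<le> length q"
      by (auto intro!: exI[of _ "nat (- k) - 1"])
    moreover have "inv (\<lambda>j. - 1 - int j) k = nat (- k) - 1" if "k < 0"
      using inv_f_f[OF inj, of "nat (- k) - 1"] that by simp
    ultimately show ?thesis unfolding sum_nth_monom[OF inj] by (auto simp: entry_def)
  qed
  show ?thesis by (simp add: lookup_add 1 2)
qed

declare laurent_of.simps [simp del]

text \<open>Exponents are differences because the arithmetic sort has no negative numbers; requiring
  i to be nonzero selects the disjunct by the sign of k - l.\<close>

lemma sat_coeff:
  "sat S [Lst p, Lst q, Num k, Num l, Fld a] coeff_fm \<longleftrightarrow> a = cf (laurent_of [Lst p, Lst q]) (int k - int l)"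
proof -
  have "sat S [Lst p, Lst q, Num k, Num l, Fld a] coeff_fm \<longleftrightarrow>
      (\<exists>i. i \<noteq> 0 \<and> k + 1 = l + i \<and> a = entry p i) \<or>
      (\<exists>i. i \<noteq> 0 \<and> l = k + i \<and> a = entry q i)"
    by (auto simp: coeff_fm_def sat_inst[OF wff_entry] sat_entry)
  also have "\<dots> \<longleftrightarrow> (if l \<le> k then a = entry p (k - l + 1) else a = entry q (l - k))"
  proof -
    have 1: "i \<noteq> 0 \<and> k + 1 = l + i \<longleftrightarrow> i = k - l + 1 \<and> l \<le> k" for i by auto
    have 2: "i \<noteq> 0 \<and> l = k + i \<longleftrightarrow> i = l - k \<and> k < l" for i by auto
    show ?thesis unfolding conj_assoc[symmetric] 1 2 by (cases "l \<le> k") (simp_all add: not_le)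
  qed
  also have "\<dots> \<longleftrightarrow> a = cf (laurent_of [Lst p, Lst q]) (int k - int l)"
  proof (cases "l \<le> k")
    case True
    then have "int k - int l = int (k - l)" by (rule of_nat_diff[symmetric])
    then show ?thesis using True by (simp only: cf_laurent_of nat_int) simp
  next
    case False
    then have "int k - int l = - int (l - k)" "l - k > 0" by auto
    then show ?thesis using False by (simp only: cf_laurent_of minus_minus nat_int) simp
  qed
  finally show ?thesis .
qed

lemma wff_pad_eq: "wff list_lang [ListS, ListS] pad_eq_fm"
  by (simp add: pad_eq_fm_def wff_inst[OF wff_entry])

lemma sat_pad_eq: "sat S [Lst s, Lst s'] pad_eq_fm \<longleftrightarrow> (\<forall>i. entry s i = entry s' i)"
  by (auto simp: pad_eq_fm_def sat_inst[OF wff_entry] sat_entry)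

lemma laurent_of_eq_iff:
  "laurent_of [Lst p, Lst q] = laurent_of [Lst p', Lst q'] \<longleftrightarrow>
     (\<forall>i. entry p i = entry p' i) \<and> (\<forall>i. entry q i = entry q' i)"
proof
  assume eq: "laurent_of [Lst p, Lst q] = laurent_of [Lst p', Lst q']"
  have "entry p i = entry p' i \<and> entry q i = entry q' i" for i
  proof (cases i)
    case 0
    then show ?thesis by (simp add: entry_def)
  next
    case (Suc j)
    then show ?thesis
      using arg_cong[OF eq, of "\<lambda>f. cf f (int j)"] arg_cong[OF eq, of "\<lambda>f. cf f (- int i)"]
      by (simp add: cf_laurent_of nat_add_distrib)
  qed
  then show "(\<forall>i. entry p i = entry p' i) \<and> (\<forall>i. entry q i = entry q' i)" by blast
qed (auto intro!: poly_mapping_eqI simp: cf_laurent_of)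

text \<open>Lets quantification over pairs of natural numbers reach every integer exponent.\<close>

lemma int_eq_diff: "\<exists>a b. k = int a - int b"
  by (metis diff_0 diff_zero int_cases2 of_nat_0)

lemma wff_zero: "wff list_lang [ListS, ListS] zero_fm"
  by (simp add: zero_fm_def wff_inst[OF wff_coeff])

lemma sat_zero: "sat S [Lst p, Lst q] zero_fm \<longleftrightarrow> laurent_of [Lst p, Lst q] = 0"
proof -
  have "sat S [Lst p, Lst q] zero_fm \<longleftrightarrow> (\<forall>k l. cf (laurent_of [Lst p, Lst q]) (int k - int l) = 0)"
    by (simp add: zero_fm_def sat_inst[OF wff_coeff] sat_coeff)
  also have "\<dots> \<longleftrightarrow> laurent_of [Lst p, Lst q] = 0"
    by (metis int_eq_diff lookup_zero poly_mapping_eqI)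
  finally show ?thesis .
qed

lemma wff_one: "wff list_lang [ListS, ListS] one_fm"
  by (simp add: one_fm_def wff_inst[OF wff_coeff])

lemma sat_one: "sat S [Lst p, Lst q] one_fm \<longleftrightarrow> laurent_of [Lst p, Lst q] = 1"
proof -
  have "sat S [Lst p, Lst q] one_fm \<longleftrightarrow>
      (\<forall>k l. k = l \<and> cf (laurent_of [Lst p, Lst q]) (int k - int l) = 1 \<or>
        k \<noteq> l \<and> cf (laurent_of [Lst p, Lst q]) (int k - int l) = 0)"
    by (simp add: one_fm_def sat_inst[OF wff_coeff] sat_coeff)
  also have "\<dots> \<longleftrightarrow> (\<forall>k l. cf (laurent_of [Lst p, Lst q]) (int k - int l) = cf 1 (int k - int l))"
    by (intro all_cong1) (auto simp: lookup_one when_def)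
  also have "\<dots> \<longleftrightarrow> laurent_of [Lst p, Lst q] = 1"
    by (metis int_eq_diff poly_mapping_eqI)
  finally show ?thesis .
qed

lemma wff_add: "wff list_lang [ListS, ListS, ListS, ListS, ListS, ListS] add_fm"
  by (simp add: add_fm_def wff_inst[OF wff_coeff])

lemma sat_add:
  "sat S [Lst p1, Lst q1, Lst p2, Lst q2, Lst p3, Lst q3] add_fm \<longleftrightarrow>
   laurent_of [Lst p3, Lst q3] = laurent_of [Lst p1, Lst q1] + laurent_of [Lst p2, Lst q2]"
    (is "_ \<longleftrightarrow> ?h = ?f + ?g")
proof -
  have "sat S [Lst p1, Lst q1, Lst p2, Lst q2, Lst p3, Lst q3] add_fm \<longleftrightarrow>
      (\<forall>k l. cf ?h (int k - int l) = cf (?f + ?g) (int k - int l))"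
    by (simp add: add_fm_def sat_inst[OF wff_coeff] sat_coeff lookup_add)
  also have "\<dots> \<longleftrightarrow> ?h = ?f + ?g"
    by (metis int_eq_diff poly_mapping_eqI)
  finally show ?thesis .
qed

section \<open>Multiplication through recorded partial sums\<close>

lemma wff_mul: "wff list_lang [ListS, ListS, ListS, ListS, ListS, ListS] mul_fm"
  by (simp add: mul_fm_def wff_inst[OF wff_coeff])

text \<open>The recursion fixes the entries 0, ..., w + 1 of \<open>s\<close> and nothing beyond, so
  the existence of \<open>s\<close> says that entry w + 1, the complete sum, is
  \<open>c\<close>.\<close>

lemma ex_partial_sums:
  "(\<exists>s. 1 \<le> length s \<and> s ! 0 = 0 \<and> w + 2 \<le> length s \<and> s ! (w + 1) = c \<and>
      (\<forall>u v. u + v = w \<longrightarrow> u + 1 \<le> length s \<and> u + 2 \<le> length s \<and> s ! (u + 1) = s ! u + a u * b v)) \<longleftrightarrow>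
    (c::'a::field) = (\<Sum>u\<le>w. a u * b (w - u))"
proof
  assume "\<exists>s. 1 \<le> length s \<and> s ! 0 = 0 \<and> w + 2 \<le> length s \<and> s ! (w + 1) = c \<and>
      (\<forall>u v. u + v = w \<longrightarrow> u + 1 \<le> length s \<and> u + 2 \<le> length s \<and> s ! (u + 1) = s ! u + a u * b v)"
  then obtain s where s: "s ! 0 = 0" "s ! (w + 1) = c"
    "\<And>u v. u + v = w \<Longrightarrow> s ! (u + 1) = s ! u + a u * b v" by blast
  have "s ! (u + 1) = (\<Sum>j\<le>u. a j * b (w - j))" if "u \<le> w" for u
    using that
  proof (induction u)
    case 0
    then show ?case using s(3)[of 0 w] s(1) by simp
  next
    case (Suc u)
    then show ?case using s(3)[of "Suc u" "w - Suc u"] by simp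
  qed
  then show "c = (\<Sum>u\<le>w. a u * b (w - u))" using s(2) by simp
next
  assume c: "c = (\<Sum>u\<le>w. a u * b (w - u))"
  \<comment> \<open>Entry u sums over j < u: the starting 0 shifts the partial sums by one
    place.\<close>
  define s where "s = map (\<lambda>u. \<Sum>j<u. a j * b (w - j)) [0..<w + 2]"
  have nth: "s ! u = (\<Sum>j<u. a j * b (w - j))" if "u \<le> w + 1" for u
    using that unfolding s_def by (subst nth_map) (auto simp del: upt_Suc)
  have "length s = w + 2" by (simp add: s_def)
  moreover have "s ! (u + 1) = s ! u + a u * b v" if "u + v = w" for u v
  proof -
    have "w - u = v" using that by simp
    then show ?thesis using that by (simp add: nth)
  qed
  moreover have "s ! (w + 1) = c" by (simp add: nth c lessThan_Suc_atMost)
  moreover have "s ! 0 = 0" by (simp add: nth)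
  ultimately show "\<exists>s. 1 \<le> length s \<and> s ! 0 = 0 \<and> w + 2 \<le> length s \<and> s ! (w + 1) = c \<and>
      (\<forall>u v. u + v = w \<longrightarrow> u + 1 \<le> length s \<and> u + 2 \<le> length s \<and> s ! (u + 1) = s ! u + a u * b v)"
    by (intro exI[of _ s]) auto
qed

text \<open>Multiplication by x^M removes the negative exponents, so the convolution over the
  integers becomes a sum over u + v = w in the natural numbers.\<close>

lemma cf_mult_bounded:
  fixes f g :: "'a::field laurent"
  assumes "\<And>k. k < - int M \<Longrightarrow> cf f k = 0" "\<And>k. k < - int M \<Longrightarrow> cf g k = 0"
  shows "cf (f * g) (int w - int (M + M)) = (\<Sum>u\<le>w. cf f (int u - int M) * cf g (int (w - u) - int M))"
    and "k < - int (M + M) \<Longrightarrow> cf (f * g) k = 0"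
proof -
  let ?S = "(\<lambda>u. int u - int M) ` {..w} \<union> supp f"
  have "cf (f * g) (int w - int (M + M)) = (\<Sum>k\<in>?S. cf f k * cf g (int w - int (M + M) - k))"
    by (rule cf_mult) auto
  also have "\<dots> = (\<Sum>k\<in>(\<lambda>u. int u - int M) ` {..w}. cf f k * cf g (int w - int (M + M) - k))"
  proof (rule sum.mono_neutral_right)
    show "\<forall>k\<in>?S - (\<lambda>u. int u - int M) ` {..w}. cf f k * cf g (int w - int (M + M) - k) = 0"
    proof
      fix k assume k: "k \<in> ?S - (\<lambda>u. int u - int M) ` {..w}"
      show "cf f k * cf g (int w - int (M + M) - k) = 0"
      proof (cases "k < - int M")
        case False
        have "\<not> k + int M \<le> int w"
        proof
          assume "k + int M \<le> int w"
          then have "k = int (nat (k + int M)) - int M" "nat (k + int M) \<le> w" using False by auto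
          then show False using k by blast
        qed
        then show ?thesis using assms(2) by simp
      qed (simp add: assms(1))
    qed
  qed auto
  also have "\<dots> = (\<Sum>u\<le>w. cf f (int u - int M) * cf g (int (w - u) - int M))"
    by (subst sum.reindex) (auto simp: inj_on_def of_nat_diff algebra_simps intro!: sum.cong)
  finally show "cf (f * g) (int w - int (M + M)) = (\<Sum>u\<le>w. cf f (int u - int M) * cf g (int (w - u) - int M))" .
next
  assume k: "k < - int (M + M)"
  have "cf (f * g) k = (\<Sum>l\<in>supp f. cf f l * cf g (k - l))" by (rule cf_mult) auto
  also have "\<dots> = 0"
  proof (rule sum.neutral, rule ballI)
    fix l
    show "cf f l * cf g (k - l) = 0"
      using assms k by (cases "l < - int M") auto
  qed
  finally show "cf (f * g) k = 0" .
qed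

lemma sat_mul:
  "sat S [Lst p1, Lst q1, Lst p2, Lst q2, Lst p3, Lst q3] mul_fm \<longleftrightarrow>
   laurent_of [Lst p3, Lst q3] = laurent_of [Lst p1, Lst q1] * laurent_of [Lst p2, Lst q2]"
    (is "_ \<longleftrightarrow> ?h = ?f * ?g")
proof -
  let ?P = "\<lambda>M w c. \<exists>s. 1 \<le> length s \<and> s ! 0 = 0 \<and> w + 2 \<le> length s \<and> s ! (w + 1) = c \<and>
      (\<forall>u v. u + v = w \<longrightarrow> u + 1 \<le> length s \<and> u + 2 \<le> length s \<and>
         s ! (u + 1) = s ! u + cf ?f (int u - int M) * cf ?g (int v - int M))"
  have bounded: "(\<exists>d. length s + d = M) \<longleftrightarrow> length s \<le> M" for s :: "'a list" and M
    by (metis le_add1 le_Suc_ex)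
  have "sat S [Lst p1, Lst q1, Lst p2, Lst q2, Lst p3, Lst q3] mul_fm \<longleftrightarrow>
      (\<forall>M. length q1 \<le> M \<and> length q2 \<le> M \<longrightarrow>
        (\<forall>w. ?P M w (cf ?h (int w - int (M + M)))))"
    by (simp add: mul_fm_def sat_inst[OF wff_coeff] sat_coeff bounded)
  also have "\<dots> \<longleftrightarrow> (\<forall>M. length q1 \<le> M \<and> length q2 \<le> M \<longrightarrow>
        (\<forall>w. cf ?h (int w - int (M + M)) = (\<Sum>u\<le>w. cf ?f (int u - int M) * cf ?g (int (w - u) - int M))))"
    by (simp only: ex_partial_sums)
  also have "\<dots> \<longleftrightarrow> (\<forall>M. length q1 \<le> M \<and> length q2 \<le> M \<longrightarrow>
        (\<forall>w. cf ?h (int w - int (M + M)) = cf (?f * ?g) (int w - int (M + M))))"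
  proof -
    have "cf (laurent_of [Lst p, Lst q]) k = 0" if "length q \<le> M" "k < - int M" for p q :: "'a list" and M k
      using that by (auto simp add: cf_laurent_of entry_def)
    then show ?thesis using cf_mult_bounded(1)[of _ ?f ?g] by auto
  qed
  also have "\<dots> \<longleftrightarrow> ?h = ?f * ?g"
  proof
    assume *: "\<forall>M. length q1 \<le> M \<and> length q2 \<le> M \<longrightarrow>
        (\<forall>w. cf ?h (int w - int (M + M)) = cf (?f * ?g) (int w - int (M + M)))"
    show "?h = ?f * ?g"
    proof (rule poly_mapping_eqI)
      fix k
      \<comment> \<open>The summand \<open>nat \<bar>k\<bar>\<close> makes k + 2M a natural number,
        so the exponent k is among those tested for this \<open>M\<close>.\<close>
      define M where "M = length q1 + length q2 + nat \<bar>k\<bar>"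
      have "k = int (nat (k + int (M + M))) - int (M + M)" unfolding M_def by linarith
      then show "cf ?h k = cf (?f * ?g) k" using *[rule_format, of M "nat (k + int (M + M))"] by (simp add: M_def)
    qed
  qed simp
  finally show ?thesis .
qed

lemma dom_set_Gamma0:
  "u \<in> dom_set Gamma0 (list_super :: 'a::field super_model) [] s \<longleftrightarrow>
    (\<exists>p q. u = [Lst p, Lst q] \<and> p \<noteq> [])"
  by (auto simp: dom_set_def in_tuples_Cons)

text \<open>At least one entry is always written, as the first tuple of a pair has to be
  nonempty.\<close>

lemma ex_entries:
  fixes f :: "nat \<Rightarrow> 'a::zero"
  assumes "\<And>i. i > N \<Longrightarrow> f i = 0"
  shows "\<exists>p. p \<noteq> [] \<and> (\<forall>i\<ge>1. entry p i = f i)"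
proof (intro exI conjI allI impI)
  show "map (\<lambda>i. f (Suc i)) [0..<Suc N] \<noteq> []" by simp
  fix i :: nat assume "i \<ge> 1"
  then show "entry (map (\<lambda>i. f (Suc i)) [0..<Suc N]) i = f i"
    using assms by (auto simp: entry_def simp del: upt_Suc)
qed

lemma laurent_of_surj: "\<exists>p q. p \<noteq> [] \<and> laurent_of [Lst p, Lst q] = f"
proof -
  have bound: "cf f k = 0" if "\<bar>k\<bar> > \<bar>hi f\<bar> + \<bar>lo f\<bar>" for k
    using that cf_above_hi[of f k] cf_below_lo[of k f] by linarith
  define N where "N = nat (\<bar>hi f\<bar> + \<bar>lo f\<bar>) + 1"
  obtain p where p: "p \<noteq> []" "\<forall>i\<ge>1. entry p i = cf f (int i - 1)"
    using ex_entries[of N "\<lambda>i. cf f (int i - 1)"] bound by (auto simp: N_def)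
  obtain q where q: "\<forall>i\<ge>1. entry q i = cf f (- int i)"
    using ex_entries[of N "\<lambda>i. cf f (- int i)"] bound by (auto simp: N_def)
  have "laurent_of [Lst p, Lst q] = f"
    by (rule poly_mapping_eqI) (use p q in \<open>auto simp: cf_laurent_of simp del: laurent_of.simps\<close>)
  then show ?thesis using p(1) by blast
qed

lemma ring_fun_cases:
  assumes "us \<in> tuples D (fst (fun_type ring_lang f))"
  obtains "f = RZero" "us = []" | "f = ROne" "us = []" | u v where "f = RAdd" "us = [u, v]" "u \<in> D ()" "v \<in> D ()"
    | u v where "f = RMul" "us = [u, v]" "u \<in> D ()" "v \<in> D ()"
  using assms by (cases f) (auto simp: in_tuples_Cons)

lemma wf_Gamma0: "wf_code ring_lang list_lang Gamma0"
proof -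
  have "wff list_lang (coords Gamma0 (fst (fun_type ring_lang f)) @ coord Gamma0 (snd (fun_type ring_lang f)) @ params Gamma0)
      (FunC Gamma0 f)" for f
    by (cases f) (simp_all add: wff_zero wff_one wff_add wff_mul)
  then show ?thesis
    by (simp add: wf_code_def wff_inst[OF wff_pad_eq])
qed

lemma realizes_Gamma0:
  "realizes ring_lang Gamma0 list_super [] (laurent_ring :: 'a::field laurent_model) (\<lambda>_. laurent_of)"
  unfolding realizes_def
proof (intro conjI allI ballI)
  fix s
  show "laurent_of ` dom_set Gamma0 list_super [] s = Carrier (laurent_ring :: 'a laurent_model) s"
  proof -
    have "f \<in> laurent_of ` dom_set Gamma0 list_super [] s" for f :: "'a laurent"
      using laurent_of_surj[of f] dom_set_Gamma0 by (metis imageI)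
    then show ?thesis by auto
  qed
next
  fix s and u v :: "'a list_elem list"
  assume "u \<in> dom_set Gamma0 list_super [] s" "v \<in> dom_set Gamma0 list_super [] s"
  then obtain p q p' q' where "u = [Lst p, Lst q]" "v = [Lst p', Lst q']" unfolding dom_set_Gamma0 by blast
  then show "sat list_super (u @ v @ []) (EquC Gamma0 s) \<longleftrightarrow> laurent_of u = laurent_of v"
    by (simp add: sat_inst[OF wff_pad_eq] sat_pad_eq laurent_of_eq_iff)
next
  fix f and us :: "'a list_elem list list" and v :: "'a list_elem list"
  assume us: "us \<in> tuples (dom_set Gamma0 list_super []) (fst (fun_type ring_lang f))"
    and "v \<in> dom_set Gamma0 list_super [] (snd (fun_type ring_lang f))"
  then obtain p3 q3 where v: "v = [Lst p3, Lst q3]" unfolding dom_set_Gamma0 by blast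
  from us show "sat list_super (concat us @ v @ []) (FunC Gamma0 f) \<longleftrightarrow>
      laurent_of v = FunI laurent_ring f (map2 (\<lambda>_. laurent_of) (fst (fun_type ring_lang f)) us)"
    by (cases rule: ring_fun_cases)
       (auto simp: dom_set_Gamma0 v sat_zero sat_one sat_add sat_mul)
qed auto

section \<open>The interpretation of the list superstructure in the ring\<close>

type_synonym ring_fm = "(unit, ring_fun, unit) fm"
type_synonym ring_trm = "ring_fun trm"

abbreviation R :: "'a::field laurent_model" where "R \<equiv> laurent_ring"

text \<open>Weakening: formulas below are built from arbitrary terms, which have to be shifted when
  placed under one more quantifier.\<close>

definition lift :: "'f trm \<Rightarrow> 'f trm" where "lift = ren_trm Suc"

lemma tval_lift [simp]: "tval M (x # xs) (lift t) = tval M xs t"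
  unfolding lift_def
proof (induction t)
  case (App f ts)
  then have "\<forall>t\<in>set ts. tval M (x # xs) (ren_trm Suc t) = tval M xs t" by blast
  then show ?case by (simp add: comp_def cong: map_cong)
qed simp

lemma has_sort_lift [simp]: "has_sort L \<Sigma> t s \<Longrightarrow> has_sort L (s' # \<Sigma>) (lift t) s"
  unfolding lift_def by (rule has_sort_ren) auto

lemma C_eq_iff: "C a = C b \<longleftrightarrow> a = (b::'a::zero)"
  using monom_eq_iff[of 0 a 0 b] by auto

lemma X_eq_iff: "(X i :: 'a::zero_neq_one laurent) = X j \<longleftrightarrow> i = j"
  using monom_eq_iff[of i 1 j "1::'a"] by auto

lemma C_eq_1_iff: "C c = 1 \<longleftrightarrow> c = (1::'a::zero_neq_one)"
  using C_eq_iff[of c 1] by simp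

lemma X_eq_1_iff: "(X k :: 'a::zero_neq_one laurent) = 1 \<longleftrightarrow> k = 0"
  using X_eq_iff[of k 0, where ?'a = 'a] by simp

lemma C_sum_iff: "C c = C a + C b \<longleftrightarrow> c = a + (b::'a::monoid_add)"
  unfolding single_add[symmetric] C_eq_iff ..

text \<open>Replaces a quantifier relativised to constants or powers of x by one over coefficients
  or exponents.\<close>

lemma quantify_image:
  "(\<exists>x. (\<exists>c. x = F c) \<and> P x) \<longleftrightarrow> (\<exists>c. P (F c))"
  "(\<forall>x. (\<exists>c. x = F c) \<longrightarrow> P x) \<longleftrightarrow> (\<forall>c. P (F c))"
  "(\<forall>x. (\<exists>c. x = F c) \<and> Q x \<longrightarrow> P x) \<longleftrightarrow> (\<forall>c. Q (F c) \<longrightarrow> P (F c))"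
  by blast+

section \<open>Divisibility, units, constants and powers in the language of rings\<close>

abbreviation tz :: ring_trm where "tz \<equiv> App RZero []"
abbreviation to :: ring_trm where "to \<equiv> App ROne []"
abbreviation pl :: "ring_trm \<Rightarrow> ring_trm \<Rightarrow> ring_trm" where "pl a b \<equiv> App RAdd [a, b]"
abbreviation ti :: "ring_trm \<Rightarrow> ring_trm \<Rightarrow> ring_trm" where "ti a b \<equiv> App RMul [a, b]"

lemma has_sort_ring [simp]:
  "has_sort ring_lang \<Sigma> tz s" "has_sort ring_lang \<Sigma> to s"
  "has_sort ring_lang \<Sigma> (pl a b) s \<longleftrightarrow> has_sort ring_lang \<Sigma> a () \<and> has_sort ring_lang \<Sigma> b ()"
  "has_sort ring_lang \<Sigma> (ti a b) s \<longleftrightarrow> has_sort ring_lang \<Sigma> a () \<and> has_sort ring_lang \<Sigma> b ()"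
  by simp_all

text \<open>The language has no subtraction, so the equation b - c = (p - q) d is written with the
  negative terms moved across.\<close>

definition diff_dvd_fm :: "ring_trm \<Rightarrow> ring_trm \<Rightarrow> ring_trm \<Rightarrow> ring_trm \<Rightarrow> ring_fm" where
  "diff_dvd_fm p q b c =
     Exi () (Eq () (pl (ti (Var 0) (lift p)) (lift c)) (pl (ti (Var 0) (lift q)) (lift b)))"

lemma sat_diff_dvd [simp]:
  "sat R xs (diff_dvd_fm p q b c) \<longleftrightarrow> tval R xs p - tval R xs q dvd tval R xs b - tval R xs c"
proof -
  have "d * p' + c' = d * q' + b' \<longleftrightarrow> b' - c' = (p' - q') * d" for d p' q' b' c' :: "'a laurent"
    by (auto simp: algebra_simps)
  then show ?thesis by (simp add: diff_dvd_fm_def dvd_def)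
qed

lemma wff_diff_dvd [simp]:
  "has_sort ring_lang \<Sigma> p () \<Longrightarrow> has_sort ring_lang \<Sigma> q () \<Longrightarrow> has_sort ring_lang \<Sigma> b () \<Longrightarrow>
   has_sort ring_lang \<Sigma> c () \<Longrightarrow> wff ring_lang \<Sigma> (diff_dvd_fm p q b c)"
  by (simp add: diff_dvd_fm_def del: has_sort_App)

definition unit_fm :: "ring_trm \<Rightarrow> ring_fm" where
  "unit_fm u = diff_dvd_fm u tz to tz"

lemma sat_unit [simp]: "sat R xs (unit_fm u) \<longleftrightarrow> tval R xs u dvd 1"
  by (simp add: unit_fm_def)

lemma wff_unit [simp]: "has_sort ring_lang \<Sigma> u () \<Longrightarrow> wff ring_lang \<Sigma> (unit_fm u)"
  by (simp add: unit_fm_def)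

definition const_fm :: "ring_trm \<Rightarrow> ring_fm" where
  "const_fm a = Or (Eq () a tz) (Or (Eq () (pl a to) tz) (And (unit_fm a) (unit_fm (pl a to))))"

lemma sat_const [simp]: "sat R xs (const_fm a) \<longleftrightarrow> (\<exists>c. tval R xs a = C c)"
  unfolding constant_iff[symmetric] by (simp add: const_fm_def)

lemma wff_const [simp]: "has_sort ring_lang \<Sigma> a () \<Longrightarrow> wff ring_lang \<Sigma> (const_fm a)"
  by (simp add: const_fm_def)

definition pow_fm :: "ring_trm \<Rightarrow> ring_trm \<Rightarrow> ring_fm" where
  "pow_fm t u = And (unit_fm u) (diff_dvd_fm t to u to)"

lemma sat_pow: "tval R xs t = X 1 \<Longrightarrow> sat R xs (pow_fm t u) \<longleftrightarrow> (\<exists>k. tval R xs u = X k)"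
  unfolding X_power_iff[symmetric] by (simp add: pow_fm_def)

lemma wff_pow [simp]:
  "has_sort ring_lang \<Sigma> t () \<Longrightarrow> has_sort ring_lang \<Sigma> u () \<Longrightarrow> wff ring_lang \<Sigma> (pow_fm t u)"
  by (simp add: pow_fm_def)

section \<open>Natural exponents and their arithmetic\<close>

definition chain_fm :: "ring_trm \<Rightarrow> ring_trm \<Rightarrow> ring_trm \<Rightarrow> ring_trm \<Rightarrow> ring_fm" where
  "chain_fm e h f k = And (Or (Eq () k to) (diff_dvd_fm k to e tz)) (diff_dvd_fm (pl to (ti k h)) tz f tz)"

lemma sat_chain:
  "tval R xs k = X n \<Longrightarrow> sat R xs (chain_fm e h f k) \<longleftrightarrow>
    (n = 0 \<or> X n - 1 dvd tval R xs e) \<and> md (tval R xs h) n dvd tval R xs f"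
  using monom_eq_iff[of n 1 0 "1::'a::field"] by (simp add: chain_fm_def md_def)

lemma wff_chain [simp]:
  "has_sort ring_lang \<Sigma> e () \<Longrightarrow> has_sort ring_lang \<Sigma> h () \<Longrightarrow> has_sort ring_lang \<Sigma> f () \<Longrightarrow>
   has_sort ring_lang \<Sigma> k () \<Longrightarrow> wff ring_lang \<Sigma> (chain_fm e h f k)"
  by (simp add: chain_fm_def)

text \<open>The three existential variables are e, h and f from the outside. Multiplication by
  \<open>t\<close> is the unit step, and the last clause lets a chain stop only at the exponent of
  \<open>w\<close>.\<close>

definition nat_fm :: "ring_trm \<Rightarrow> ring_trm \<Rightarrow> ring_fm" where
  "nat_fm t w = And (pow_fm t w) (Exi () (Exi () (Exi () (And
     (And (Neg (Eq () (Var 2) tz)) (diff_dvd_fm (pl to (Var 1)) tz (Var 0) tz))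
     (Fall () (Imp (And (pow_fm (lift (lift (lift (lift t)))) (Var 0)) (chain_fm (Var 3) (Var 2) (Var 1) (Var 0)))
       (Or (Eq () (Var 0) (lift (lift (lift (lift w)))))
         (chain_fm (Var 3) (Var 2) (Var 1) (ti (Var 0) (lift (lift (lift (lift t)))))))))))))"

lemma sat_nat:
  assumes t: "tval R xs t = X 1"
  shows "sat R xs (nat_fm t w) \<longleftrightarrow> (\<exists>n. tval R xs w = X (int n))"
proof -
  have "sat R xs (nat_fm t w) \<longleftrightarrow> (\<exists>n. tval R xs w = X n \<and>
    (\<exists>(e :: 'a laurent) (h :: 'a laurent) f. e \<noteq> 0 \<and> md h 0 dvd f \<and>
     (\<forall>k. (k = 0 \<or> X k - 1 dvd e) \<and> md h k dvd f \<longrightarrow>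
        k = n \<or> (k + 1 = 0 \<or> X (k + 1) - 1 dvd e) \<and> md h (k + 1) dvd f)))"
  proof -
    have *: "sat R (X k # f # h # e # xs) (chain_fm (Var 3) (Var 2) (Var (Suc 0)) (ti (Var 0) (lift (lift (lift (lift t)))))) \<longleftrightarrow>
      (k + 1 = 0 \<or> X (k + 1) - 1 dvd e) \<and> md h (k + 1) dvd f" for k f h e
      by (subst sat_chain[of _ _ "k + 1"]) (simp_all add: t X_mult)
    have **: "sat R (X k # f # h # e # xs) (chain_fm (Var 3) (Var 2) (Var (Suc 0)) (Var 0)) \<longleftrightarrow>
      (k = 0 \<or> X k - 1 dvd e) \<and> md h k dvd f" for k f h e
      by (subst sat_chain[of _ _ k]) simp_all
    have md0: "md h 0 = 1 + h" for h :: "'a laurent" by (simp add: md_def)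
    show ?thesis
    proof (cases "\<exists>n. tval R xs w = X n")
      case True
      then obtain n where "tval R xs w = X n" by blast
      then show ?thesis
        by (simp add: nat_fm_def sat_pow t quantify_image * ** md0 X_eq_iff)
    qed (simp add: nat_fm_def sat_pow t)
  qed
  also have "\<dots> \<longleftrightarrow> (\<exists>n\<ge>0. tval R xs w = X n)"
    unfolding nonneg_iff_ex_chain[symmetric] by blast
  also have "\<dots> \<longleftrightarrow> (\<exists>n. tval R xs w = X (int n))"
    by (metis nonneg_int_cases of_nat_0_le_iff)
  finally show ?thesis .
qed

lemma wff_nat [simp]:
  "has_sort ring_lang \<Sigma> t () \<Longrightarrow> has_sort ring_lang \<Sigma> w () \<Longrightarrow> wff ring_lang \<Sigma> (nat_fm t w)"
  by (simp add: nat_fm_def)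

text \<open>The exponent of \<open>c\<close> is, up to sign, the least common multiple of those of
  \<open>a\<close> and \<open>b\<close>; divisibility of exponents is read through
  \<open>X_dvd_X_iff\<close>.\<close>

definition lcm_fm :: "ring_trm \<Rightarrow> ring_trm \<Rightarrow> ring_trm \<Rightarrow> ring_trm \<Rightarrow> ring_fm" where
  "lcm_fm t a b c = Fall () (Imp (pow_fm (lift t) (Var 0))
     (Iff (And (diff_dvd_fm (lift a) to (Var 0) to) (diff_dvd_fm (lift b) to (Var 0) to))
       (diff_dvd_fm (lift c) to (Var 0) to)))"

lemma sat_lcm:
  assumes "tval R xs t = X 1" "tval R xs a = X i" "tval R xs b = X j" "tval R xs c = X k"
  shows "sat R xs (lcm_fm t a b c) \<longleftrightarrow> (\<forall>z. i dvd z \<and> j dvd z \<longleftrightarrow> k dvd z)"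
proof -
  show ?thesis using assms by (simp add: lcm_fm_def sat_pow X_dvd_X_iff quantify_image)
qed

lemma wff_lcm [simp]:
  "has_sort ring_lang \<Sigma> t () \<Longrightarrow> has_sort ring_lang \<Sigma> a () \<Longrightarrow> has_sort ring_lang \<Sigma> b () \<Longrightarrow>
   has_sort ring_lang \<Sigma> c () \<Longrightarrow> wff ring_lang \<Sigma> (lcm_fm t a b c)"
  by (simp add: lcm_fm_def)

text \<open>Terms contain no inverses, so the quotients y/t and v/y, whose exponents are those of y
  - 1 and v - y in the divisibility criterion for squares, are named by variables.\<close>

definition square_fm :: "ring_trm \<Rightarrow> ring_trm \<Rightarrow> ring_trm \<Rightarrow> ring_fm" where
  "square_fm t y v = And (lcm_fm t y (ti y t) (ti v y))
     (Exi () (Exi () (And (And (Eq () (ti (Var 0) (lift (lift t))) (lift (lift y)))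
       (Eq () (ti (Var 1) (lift (lift y))) (lift (lift v))))
       (lcm_fm (lift (lift t)) (lift (lift y)) (Var 0) (Var 1)))))"

lemma mult_X_eq_iff: "(z :: 'a::field laurent) * X i = X j \<longleftrightarrow> z = X (j - i)"
proof
  assume "z * X i = X j"
  then have "z * X i * X (- i) = X j * X (- i)" by simp
  then show "z = X (j - i)" by (simp add: mult.assoc X_mult)
qed (simp add: X_mult)

lemma sat_square:
  assumes "tval R xs t = X 1" "tval R xs y = X i" "tval R xs v = X j"
  shows "sat R xs (square_fm t y v) \<longleftrightarrow> j = i * i"
proof -
  have "sat R xs (lcm_fm t y (ti y t) (ti v y)) \<longleftrightarrow> (\<forall>z. i dvd z \<and> i + 1 dvd z \<longleftrightarrow> j + i dvd z)"
    by (rule sat_lcm) (simp_all add: assms X_mult)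
  moreover have "sat R (X (i - 1) # X (j - i) # xs) (lcm_fm (lift (lift t)) (lift (lift y)) (Var 0) (Var 1)) \<longleftrightarrow>
      (\<forall>z. i dvd z \<and> i - 1 dvd z \<longleftrightarrow> j - i dvd z)"
    by (rule sat_lcm) (simp_all add: assms)
  ultimately show ?thesis
    unfolding square_iff_dvd by (simp add: square_fm_def assms mult_X_eq_iff)
qed

lemma wff_square [simp]:
  "has_sort ring_lang \<Sigma> t () \<Longrightarrow> has_sort ring_lang \<Sigma> y () \<Longrightarrow> has_sort ring_lang \<Sigma> v () \<Longrightarrow>
   wff ring_lang \<Sigma> (square_fm t y v)"
  by (simp add: square_fm_def)

text \<open>Products from squares without halving: k = i j exactly if (i + j)^2 = 2k + i^2 +
  j^2.\<close>

definition mult_fm :: "ring_trm \<Rightarrow> ring_trm \<Rightarrow> ring_trm \<Rightarrow> ring_trm \<Rightarrow> ring_fm" where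
  "mult_fm t a b c =
     (let t' = lift (lift (lift t)); a' = lift (lift (lift a)); b' = lift (lift (lift b)); c' = lift (lift (lift c)) in
      Exi () (Exi () (Exi () (Ands [pow_fm t' (Var 2), pow_fm t' (Var 1), pow_fm t' (Var 0),
        square_fm t' (ti a' b') (Var 2), square_fm t' a' (Var 1), square_fm t' b' (Var 0),
        Eq () (Var 2) (ti (ti c' c') (ti (Var 1) (Var 0)))]))))"

lemma sat_mult:
  assumes "tval R xs t = X 1" "tval R xs a = X i" "tval R xs b = X j" "tval R xs c = X k"
  shows "sat R xs (mult_fm t a b c) \<longleftrightarrow> k = i * j"
proof -
  let ?t = "lift (lift (lift t))" and ?a = "lift (lift (lift a))" and ?b = "lift (lift (lift b))"
  have sq: "sat R (X q # X p # X s # xs) (square_fm ?t (ti ?a ?b) (Var 2)) \<longleftrightarrow> s = (i + j) * (i + j)"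
    "sat R (X q # X p # X s # xs) (square_fm ?t ?a (Var 1)) \<longleftrightarrow> p = i * i"
    "sat R (X q # X p # X s # xs) (square_fm ?t ?b (Var 0)) \<longleftrightarrow> q = j * j" for q p s
    by (rule sat_square; simp add: assms X_mult)+
  have "sat R xs (mult_fm t a b c) \<longleftrightarrow> (\<exists>s p q. sat R (X q # X p # X s # xs) (square_fm ?t (ti ?a ?b) (Var 2)) \<and>
    sat R (X q # X p # X s # xs) (square_fm ?t ?a (Var 1)) \<and>
    sat R (X q # X p # X s # xs) (square_fm ?t ?b (Var 0)) \<and> (X s :: 'a laurent) = X (k + k + (p + q)))"
    by (simp add: mult_fm_def Let_def sat_pow assms X_mult quantify_image)
  also have "\<dots> \<longleftrightarrow> (i + j) * (i + j) = k + k + (i * i + j * j)"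
    unfolding sq by (simp add: X_eq_iff)
  also have "\<dots> \<longleftrightarrow> k = i * j"
    by (auto simp: algebra_simps)
  finally show ?thesis .
qed

lemma wff_mult [simp]:
  "has_sort ring_lang \<Sigma> t () \<Longrightarrow> has_sort ring_lang \<Sigma> a () \<Longrightarrow> has_sort ring_lang \<Sigma> b () \<Longrightarrow>
   has_sort ring_lang \<Sigma> c () \<Longrightarrow> wff ring_lang \<Sigma> (mult_fm t a b c)"
  by (simp add: mult_fm_def Let_def)

section \<open>Coded lists\<close>

definition index_fm :: "ring_trm \<Rightarrow> ring_trm \<Rightarrow> ring_trm \<Rightarrow> ring_fm" where
  "index_fm t w i = And (And (nat_fm t i) (Neg (Eq () i to)))
     (Exi () (And (nat_fm (lift t) (Var 0)) (Eq () (ti (Var 0) (lift i)) (lift w))))"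

text \<open>The bound j \<le> n is expressed by a natural exponent completing j to n; excluding the
  element 1 excludes j = 0, as components are numbered from 1.\<close>

lemma sat_index:
  assumes "tval R xs t = X 1" "tval R xs w = X (int n)"
  shows "sat R xs (index_fm t w i) \<longleftrightarrow> (\<exists>j\<in>{1..n}. tval R xs i = X (int j))"
proof -
  show ?thesis
  proof (cases "\<exists>j. tval R xs i = X (int j)")
    case True
    then obtain j where j: "tval R xs i = X (int j)" by blast
    have "(X (int j) :: 'a laurent) = 1 \<longleftrightarrow> j = 0" using X_eq_iff[of "int j" 0] by simp
    moreover have "(\<exists>m. int m = int n - int j) \<longleftrightarrow> j \<le> n" by (auto intro: exI[of _ "n - j"])
    ultimately show ?thesis
      using assms by (auto simp add: index_fm_def sat_nat mult_X_eq_iff j X_eq_iff quantify_image)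
  qed (use assms in \<open>auto simp: index_fm_def sat_nat\<close>)
qed

lemma wff_index [simp]:
  "has_sort ring_lang \<Sigma> t () \<Longrightarrow> has_sort ring_lang \<Sigma> w () \<Longrightarrow> has_sort ring_lang \<Sigma> i () \<Longrightarrow>
   wff ring_lang \<Sigma> (index_fm t w i)"
  by (simp add: index_fm_def)

definition value_fm :: "ring_trm \<Rightarrow> ring_trm \<Rightarrow> ring_trm \<Rightarrow> ring_trm \<Rightarrow> ring_fm" where
  "value_fm f h i a = diff_dvd_fm (pl to (ti i h)) tz f a"

lemma sat_value:
  "tval R xs i = X k \<Longrightarrow> sat R xs (value_fm f h i a) \<longleftrightarrow> md (tval R xs h) k dvd tval R xs f - tval R xs a"
  by (simp add: value_fm_def md_def)

lemma wff_value [simp]: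
  "has_sort ring_lang \<Sigma> f () \<Longrightarrow> has_sort ring_lang \<Sigma> h () \<Longrightarrow> has_sort ring_lang \<Sigma> i () \<Longrightarrow>
   has_sort ring_lang \<Sigma> a () \<Longrightarrow> wff ring_lang \<Sigma> (value_fm f h i a)"
  by (simp add: value_fm_def)

text \<open>Any pair with exactly one constant residue at each index is accepted, whether or not
  \<open>h\<close> has the shape used to prove existence; different codes of one list are identified
  by \<open>same_list_fm\<close>.\<close>

definition codes_fm :: "ring_trm \<Rightarrow> ring_trm \<Rightarrow> ring_trm \<Rightarrow> ring_trm \<Rightarrow> ring_fm" where
  "codes_fm t f h w = And (nat_fm t w) (Fall () (Imp (index_fm (lift t) (lift w) (Var 0))
     (Exi () (And (const_fm (Var 0)) (Fall () (Imp (const_fm (Var 0))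
       (Iff (value_fm (lift (lift (lift f))) (lift (lift (lift h))) (Var 2) (Var 0)) (Eq () (Var 0) (Var 1)))))))))"

lemma sat_codes:
  assumes t: "tval R xs t = X 1"
  shows "sat R xs (codes_fm t f h w) \<longleftrightarrow>
    (\<exists>n. tval R xs w = X (int n) \<and> (\<forall>i\<in>{1..n}. \<exists>a. \<forall>b. md (tval R xs h) (int i) dvd tval R xs f - C b \<longleftrightarrow> b = a))"
proof -
  have "sat R xs (codes_fm t f h w) \<longleftrightarrow> (\<exists>n. tval R xs w = X (int n) \<and>
      (\<forall>i\<in>{1..n}. \<exists>a. \<forall>b. md (tval R xs h) (int i) dvd tval R xs f - C b \<longleftrightarrow> C b = C a))"
    (is "?l \<longleftrightarrow> ?r")
  proof (cases "\<exists>n. tval R xs w = X (int n)")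
    case True
    then obtain n where n: "tval R xs w = X (int n)" by blast
    have val: "sat R (b # a # X (int i) # xs) (value_fm (lift (lift (lift f))) (lift (lift (lift h))) (Var 2) (Var 0)) \<longleftrightarrow>
      md (tval R xs h) (int i) dvd tval R xs f - b" for a b i
      by (subst sat_value[of _ _ "int i"]) simp_all
    have uniq: "(\<exists>m. tval R xs w = X (int m) \<and> P m) \<longleftrightarrow> P n" for P
      using n by (auto simp: X_eq_iff)
    have cong: "(\<forall>x. (\<exists>j\<in>J. x = X (int j)) \<longrightarrow> Q x) \<longleftrightarrow> (\<forall>j\<in>J. Q (X (int j)))" for Q :: "'a laurent \<Rightarrow> bool" and J
      by blast
    have nat: "sat R xs (nat_fm t w)" using n sat_nat[OF t] by blast
    have idx: "sat R (x # xs) (index_fm (lift t) (lift w) (Var 0)) \<longleftrightarrow> (\<exists>j\<in>{1..n}. x = X (int j))" for x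
      by (subst sat_index) (simp_all add: t n)
    show ?thesis
      unfolding uniq by (simp only: codes_fm_def sat.simps sat_connectives nat idx laurent_ring_simps ball_UNIV bex_UNIV
          sat_const tval.simps nth_Cons_0 cong quantify_image val) (simp add: C_eq_iff)
  qed (simp add: codes_fm_def sat_nat t)
  then show ?thesis by (simp add: C_eq_iff)
qed

lemma wff_codes [simp]:
  "has_sort ring_lang \<Sigma> t () \<Longrightarrow> has_sort ring_lang \<Sigma> f () \<Longrightarrow> has_sort ring_lang \<Sigma> h () \<Longrightarrow>
   has_sort ring_lang \<Sigma> w () \<Longrightarrow> wff ring_lang \<Sigma> (codes_fm t f h w)"
  by (simp add: codes_fm_def)

definition same_list_fm :: "ring_trm \<Rightarrow> ring_trm \<Rightarrow> ring_trm \<Rightarrow> ring_trm \<Rightarrow> ring_trm \<Rightarrow> ring_trm \<Rightarrow> ring_trm \<Rightarrow> ring_fm" where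
  "same_list_fm t f h w f' h' w' = And (Eq () w w') (Fall () (Fall ()
     (Imp (And (index_fm (lift (lift t)) (lift (lift w)) (Var 0)) (const_fm (Var 1)))
       (Iff (value_fm (lift (lift f)) (lift (lift h)) (Var 0) (Var 1))
         (value_fm (lift (lift f')) (lift (lift h')) (Var 0) (Var 1))))))"

lemma sat_same_list:
  assumes t: "tval R xs t = X 1" and n: "tval R xs w = X (int n)"
  shows "sat R xs (same_list_fm t f h w f' h' w') \<longleftrightarrow> tval R xs w' = X (int n) \<and>
    (\<forall>i\<in>{1..n}. \<forall>a. md (tval R xs h) (int i) dvd tval R xs f - C a \<longleftrightarrow> md (tval R xs h') (int i) dvd tval R xs f' - C a)"
proof -
  have val: "sat R (X (int i) # a # xs) (value_fm (lift (lift g)) (lift (lift g')) (Var 0) (Var 1)) \<longleftrightarrow>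
      md (tval R xs g') (int i) dvd tval R xs g - a" for a i g g'
    by (subst sat_value[of _ _ "int i"]) simp_all
  have cong: "(\<forall>a x. (\<exists>j\<in>J. x = X (int j)) \<and> (\<exists>c. a = C c) \<longrightarrow> Q x a) \<longleftrightarrow> (\<forall>j\<in>J. \<forall>c. Q (X (int j)) (C c))"
    for Q :: "'a laurent \<Rightarrow> 'a laurent \<Rightarrow> bool" and J by blast
  have idx: "sat R (x # a # xs) (index_fm (lift (lift t)) (lift (lift w)) (Var 0)) \<longleftrightarrow> (\<exists>j\<in>{1..n}. x = X (int j))" for x a
    by (subst sat_index) (simp_all add: t n)
  have "sat R xs (same_list_fm t f h w f' h' w') \<longleftrightarrow> tval R xs w = tval R xs w' \<and>
    (\<forall>a x. (\<exists>j\<in>{1..n}. x = X (int j)) \<and> (\<exists>c. a = C c) \<longrightarrow>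
      (sat R (x # a # xs) (value_fm (lift (lift f)) (lift (lift h)) (Var 0) (Var 1)) \<longleftrightarrow>
         sat R (x # a # xs) (value_fm (lift (lift f')) (lift (lift h')) (Var 0) (Var 1))))"
    by (simp add: same_list_fm_def idx)
  then show ?thesis unfolding cong val n by auto
qed

lemma wff_same_list [simp]:
  "has_sort ring_lang \<Sigma> t () \<Longrightarrow> has_sort ring_lang \<Sigma> f () \<Longrightarrow> has_sort ring_lang \<Sigma> h () \<Longrightarrow>
   has_sort ring_lang \<Sigma> w () \<Longrightarrow> has_sort ring_lang \<Sigma> f' () \<Longrightarrow> has_sort ring_lang \<Sigma> h' () \<Longrightarrow>
   has_sort ring_lang \<Sigma> w' () \<Longrightarrow> wff ring_lang \<Sigma> (same_list_fm t f h w f' h' w')"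
  by (simp add: same_list_fm_def)

text \<open>The admissible parameters are the elements \<open>c x\<close> and \<open>c x\<^sup>-\<^sup>1\<close> with \<open>c \<noteq> 0\<close>.\<close>

definition gen_fm :: "ring_trm \<Rightarrow> ring_fm" where
  "gen_fm t = And (And (unit_fm t) (Neg (const_fm t)))
     (Fall () (Exi () (And (const_fm (Var 0)) (diff_dvd_fm (lift (lift t)) to (Var 1) (Var 0)))))"

lemma sat_gen:
  "sat R xs (gen_fm t) \<longleftrightarrow> tval R xs t dvd 1 \<and> (\<forall>c. tval R xs t \<noteq> C c) \<and> (\<forall>f. \<exists>a. tval R xs t - 1 dvd f - C a)"
  by (simp add: gen_fm_def quantify_image)

lemma wff_gen [simp]: "has_sort ring_lang \<Sigma> t () \<Longrightarrow> wff ring_lang \<Sigma> (gen_fm t)"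
  by (simp add: gen_fm_def)

section \<open>The code of the list superstructure and its decoding\<close>

definition Delta :: "(list_sort, list_fun, list_rel, unit, ring_fun, unit) code" where
  "Delta =
     \<lparr> params = [()],
       coord = (\<lambda>s. case s of ListS \<Rightarrow> [(), (), ()] | _ \<Rightarrow> [()]),
       DomC = (\<lambda>s. case s of FieldS \<Rightarrow> const_fm (Var 0) | NatS \<Rightarrow> nat_fm (Var 1) (Var 0)
                 | ListS \<Rightarrow> codes_fm (Var 3) (Var 0) (Var 1) (Var 2)),
       EquC = (\<lambda>s. case s of ListS \<Rightarrow> same_list_fm (Var 6) (Var 0) (Var 1) (Var 2) (Var 3) (Var 4) (Var 5)
                 | _ \<Rightarrow> Eq () (Var 0) (Var 1)),
       FunC = (\<lambda>f. case f of FZero \<Rightarrow> Eq () (Var 0) tz | FOne \<Rightarrow> Eq () (Var 0) to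
                 | FAdd \<Rightarrow> Eq () (Var 2) (pl (Var 0) (Var 1)) | FMul \<Rightarrow> Eq () (Var 2) (ti (Var 0) (Var 1))
                 | NZero \<Rightarrow> Eq () (Var 0) to | NOne \<Rightarrow> Eq () (Var 0) (Var 1)
                 | NAdd \<Rightarrow> Eq () (Var 2) (ti (Var 0) (Var 1))
                 | NMul \<Rightarrow> mult_fm (Var 3) (Var 0) (Var 1) (Var 2) | Len \<Rightarrow> Eq () (Var 2) (Var 3)),
       RelC = (\<lambda>_. And (index_fm (Var 5) (Var 2) (Var 4)) (value_fm (Var 0) (Var 1) (Var 4) (Var 3))) \<rparr>"

lemma Delta_simps [simp]:
  "params Delta = [()]"
  "coord Delta FieldS = [()]" "coord Delta NatS = [()]" "coord Delta ListS = [(), (), ()]"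
  "DomC Delta FieldS = const_fm (Var 0)" "DomC Delta NatS = nat_fm (Var 1) (Var 0)"
  "DomC Delta ListS = codes_fm (Var 3) (Var 0) (Var 1) (Var 2)"
  "EquC Delta FieldS = Eq () (Var 0) (Var 1)" "EquC Delta NatS = Eq () (Var 0) (Var 1)"
  "EquC Delta ListS = same_list_fm (Var 6) (Var 0) (Var 1) (Var 2) (Var 3) (Var 4) (Var 5)"
  "FunC Delta FZero = Eq () (Var 0) tz" "FunC Delta FOne = Eq () (Var 0) to"
  "FunC Delta FAdd = Eq () (Var 2) (pl (Var 0) (Var 1))" "FunC Delta FMul = Eq () (Var 2) (ti (Var 0) (Var 1))"
  "FunC Delta NZero = Eq () (Var 0) to" "FunC Delta NOne = Eq () (Var 0) (Var 1)"
  "FunC Delta NAdd = Eq () (Var 2) (ti (Var 0) (Var 1))"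
  "FunC Delta NMul = mult_fm (Var 3) (Var 0) (Var 1) (Var 2)" "FunC Delta Len = Eq () (Var 2) (Var 3)"
  "RelC Delta r = And (index_fm (Var 5) (Var 2) (Var 4)) (value_fm (Var 0) (Var 1) (Var 4) (Var 3))"
  by (simp_all add: Delta_def)

lemma wf_Delta: "wf_code list_lang ring_lang Delta"
proof -
  have dom: "wff ring_lang (coord Delta s @ params Delta) (DomC Delta s)" for s
    by (cases s) simp_all
  have equ: "wff ring_lang (coord Delta s @ coord Delta s @ params Delta) (EquC Delta s)" for s
    by (cases s) simp_all
  have "wff ring_lang (coords Delta (fst (fun_type list_lang f)) @ coord Delta (snd (fun_type list_lang f)) @ params Delta)
      (FunC Delta f)" for f
    by (cases f) simp_all
  with dom equ show ?thesis by (simp add: wf_code_def)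
qed

definition exponent :: "'a::zero laurent \<Rightarrow> nat" where "exponent w = nat (hi w)"

lemma exponent_X [simp]: "exponent (X (int n) :: 'a::field laurent) = n"
  by (simp add: exponent_def hi_monom)

definition decoded :: "'a::field laurent \<Rightarrow> 'a laurent \<Rightarrow> nat \<Rightarrow> 'a" where
  "decoded f h i = (THE a. md h (int i) dvd f - C a)"

text \<open>Written for the parameter x; for other generators the coordinates are first moved back
  by an automorphism. Coefficient 0 recovers a constant and the top exponent recovers n from
  x^n.\<close>

primrec decode :: "list_sort \<Rightarrow> 'a::field laurent list \<Rightarrow> 'a list_elem" where
  "decode FieldS u = Fld (cf (u ! 0) 0)"
| "decode NatS u = Num (exponent (u ! 0))"
| "decode ListS u = Lst (map (decoded (u ! 0) (u ! 1)) [1..<Suc (exponent (u ! 2))])"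

definition codes :: "'a::field laurent \<Rightarrow> 'a laurent \<Rightarrow> nat \<Rightarrow> bool" where
  "codes f h n \<longleftrightarrow> (\<forall>i\<in>{1..n}. \<exists>a. \<forall>b. md h (int i) dvd f - C b \<longleftrightarrow> b = a)"

lemma codesD: "codes f h n \<Longrightarrow> i \<in> {1..n} \<Longrightarrow> md h (int i) dvd f - C b \<longleftrightarrow> b = decoded f h i"
proof -
  assume "codes f h n" "i \<in> {1..n}"
  then obtain a where a: "\<And>b. md h (int i) dvd f - C b \<longleftrightarrow> b = a" unfolding codes_def by blast
  then show ?thesis unfolding decoded_def by simp
qed

lemma dom_set_Delta:
  "u \<in> dom_set Delta R [X 1] FieldS \<longleftrightarrow> (\<exists>c. u = [C c])"
  "u \<in> dom_set Delta R [X 1] NatS \<longleftrightarrow> (\<exists>n. u = [X (int n)])"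
  "u \<in> dom_set Delta R [X 1] ListS \<longleftrightarrow> (\<exists>f h n. u = [f, h, X (int n)] \<and> codes f h n)"
  by (auto simp: dom_set_def in_tuples_Cons sat_nat sat_codes codes_def)

lemma decode_simps [simp]:
  "decode FieldS [C c] = Fld c" "decode NatS [X (int n)] = Num n"
  "decode ListS [f, h, X (int n)] = Lst (map (decoded f h) [1..<Suc n])"
  by simp_all

declare decode.simps [simp del]

lemma decode_special [simp]:
  "decode FieldS [0] = Fld (0::'a::field)" "decode FieldS [1] = Fld (1::'a)"
  "decode NatS [1 :: 'a laurent] = Num 0" "decode NatS [X 1 :: 'a laurent] = Num (Suc 0)"
  using exponent_X[of 0, where ?'a = 'a] exponent_X[of 1, where ?'a = 'a]
  by (simp_all add: decode.simps lookup_one)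

text \<open>The difference of two distinct constants is a unit, which a non-unit modulus cannot
  divide; this makes the residues supplied by the Chinese remainder theorem unique.\<close>

lemma ex_codes: "\<exists>f h. codes f h (length s) \<and> map (decoded f h) [1..<Suc (length s)] = (s :: 'a::field list)"
proof -
  obtain h f where hf: "\<forall>k\<in>int ` {1..length s}. \<not> md h k dvd 1"
    "\<forall>k\<in>int ` {1..length s}. md h k dvd f - C (s ! (nat k - 1))"
    using ex_code[of "int ` {1..length s}" "\<lambda>k. C (s ! (nat k - 1))"] by blast
  have iff: "md h (int i) dvd f - C b \<longleftrightarrow> b = s ! (i - 1)" if i: "i \<in> {1..length s}" for i b
  proof
    assume d: "md h (int i) dvd f - C b"
    have "md h (int i) dvd f - C (s ! (i - 1))" using hf(2) i by auto
    then have "md h (int i) dvd (f - C (s ! (i - 1))) - (f - C b)" using d by (rule dvd_diff)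
    then have dv: "md h (int i) dvd C (b - s ! (i - 1))" by (simp add: single_diff)
    show "b = s ! (i - 1)"
    proof (rule ccontr)
      assume "b \<noteq> s ! (i - 1)"
      then have "C (b - s ! (i - 1)) dvd 1" unfolding laurent_unit_iff by (metis eq_iff_diff_eq_0)
      then have "md h (int i) dvd 1" using dv by (rule dvd_trans[rotated])
      then show False using hf(1) i by auto
    qed
  next
    assume "b = s ! (i - 1)"
    then show "md h (int i) dvd f - C b" using hf(2) i by auto
  qed
  then have c: "codes f h (length s)" unfolding codes_def by blast
  have "decoded f h i = s ! (i - 1)" if "i \<in> {1..length s}" for i
    using codesD[OF c that] iff[OF that] by blast
  then have "map (decoded f h) [1..<Suc (length s)] = s"
    by (intro nth_equalityI) (auto simp del: upt_Suc)
  with c show ?thesis by blast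
qed

lemma decoded_eq_iff:
  "map (decoded f h) [1..<Suc n] = map (decoded f' h') [1..<Suc m] \<longleftrightarrow>
    m = n \<and> (\<forall>i\<in>{1..n}. decoded f h i = decoded f' h' i)"
proof
  assume *: "map (decoded f h) [1..<Suc n] = map (decoded f' h') [1..<Suc m]"
  then have mn: "m = n" using map_eq_imp_length_eq[OF *] by (simp del: upt_Suc)
  have "decoded f h i = decoded f' h' i" if "i \<in> {1..n}" for i
    using arg_cong[OF *, of "\<lambda>s. s ! (i - 1)"] that mn by (auto simp del: upt_Suc)
  with mn show "m = n \<and> (\<forall>i\<in>{1..n}. decoded f h i = decoded f' h' i)" by blast
qed (auto simp del: upt_Suc)

lemma dom_set_Delta_pairs:
  "us \<in> tuples (dom_set Delta R [X 1]) [FieldS, FieldS] \<Longrightarrow> \<exists>a b. us = [[C a], [C b]]"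
  "us \<in> tuples (dom_set Delta R [X 1]) [NatS, NatS] \<Longrightarrow> \<exists>i j. us = [[X (int i)], [X (int j)]]"
  by (auto simp: in_tuples_Cons dom_set_Delta)

lemma realizes_Delta_X:
  "realizes list_lang Delta R [X 1] (list_super :: 'a::field super_model) decode"
  unfolding realizes_def
proof (intro conjI allI ballI)
  fix s
  show "decode s ` dom_set Delta R [X 1] s = Carrier (list_super :: 'a super_model) s"
  proof (cases s)
    case FieldS
    have "Fld c \<in> decode FieldS ` dom_set Delta R [X 1] FieldS" for c :: 'a
      by (rule image_eqI[of _ _ "[C c]"]) (auto simp: dom_set_Delta)
    then have "decode FieldS ` dom_set Delta R [X 1] FieldS = range (Fld :: 'a \<Rightarrow> _)"
      by (auto simp: dom_set_Delta)
    then show ?thesis by (simp add: FieldS)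
  next
    case NatS
    have "(Num n :: 'a list_elem) \<in> decode NatS ` dom_set Delta R [X 1] NatS" for n
      by (rule image_eqI[of _ _ "[X (int n)]"]) (auto simp: dom_set_Delta)
    then have "decode NatS ` dom_set Delta R [X 1] NatS = range (Num :: nat \<Rightarrow> 'a list_elem)"
      by (auto simp: dom_set_Delta)
    then show ?thesis by (simp add: NatS)
  next
    case ListS
    have "Lst s \<in> decode ListS ` dom_set Delta R [X 1] ListS" for s :: "'a list"
    proof -
      obtain f h where "codes f h (length s)" "map (decoded f h) [1..<Suc (length s)] = s"
        using ex_codes by blast
      then show ?thesis
        by (intro image_eqI[of _ _ "[f, h, X (int (length s))]"]) (auto simp: dom_set_Delta simp del: upt_Suc)
    qed
    then have "decode ListS ` dom_set Delta R [X 1] ListS = range (Lst :: 'a list \<Rightarrow> _)"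
      by (auto simp: dom_set_Delta)
    then show ?thesis by (simp add: ListS)
  qed
next
  fix s and u v :: "'a laurent list"
  assume uv: "u \<in> dom_set Delta R [X 1] s" "v \<in> dom_set Delta R [X 1] s"
  show "sat R (u @ v @ [X 1]) (EquC Delta s) \<longleftrightarrow> decode s u = decode s v"
  proof (cases s)
    case FieldS
    then show ?thesis using uv by (auto simp: dom_set_Delta C_eq_iff)
  next
    case NatS
    then show ?thesis using uv by (auto simp: dom_set_Delta X_eq_iff)
  next
    case ListS
    then obtain f h n f' h' n' where e: "u = [f, h, X (int n)]" "codes f h n" "v = [f', h', X (int n')]" "codes f' h' n'"
      using uv unfolding ListS dom_set_Delta by blast
    have "sat R (u @ v @ [X 1]) (EquC Delta ListS) \<longleftrightarrow> n' = n \<and>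
        (\<forall>i\<in>{1..n}. \<forall>a. md h (int i) dvd f - C a \<longleftrightarrow> md h' (int i) dvd f' - C a)"
      by (simp add: e sat_same_list[of _ _ _ n] X_eq_iff)
    also have "\<dots> \<longleftrightarrow> n' = n \<and> (\<forall>i\<in>{1..n}. decoded f h i = decoded f' h' i)"
    proof (intro conj_cong refl ball_cong)
      fix i assume "n' = n" "i \<in> {1..n}"
      then show "(\<forall>a. md h (int i) dvd f - C a \<longleftrightarrow> md h' (int i) dvd f' - C a) \<longleftrightarrow> decoded f h i = decoded f' h' i"
        using codesD[OF e(2), of i] codesD[OF e(4), of i] by auto
    qed
    also have "\<dots> \<longleftrightarrow> decode ListS u = decode ListS v"
      unfolding e decode_simps list_elem.inject decoded_eq_iff ..
    finally show ?thesis by (simp only: ListS)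
  qed
next
  fix f and us :: "'a laurent list list" and v :: "'a laurent list"
  assume us: "us \<in> tuples (dom_set Delta R [X 1]) (fst (fun_type list_lang f))"
    and v: "v \<in> dom_set Delta R [X 1] (snd (fun_type list_lang f))"
  show "sat R (concat us @ v @ [X 1]) (FunC Delta f) \<longleftrightarrow>
      decode (snd (fun_type list_lang f)) v = FunI list_super f (map2 decode (fst (fun_type list_lang f)) us)"
  proof (cases f)
    case FZero
    then obtain c where "us = []" "v = [C c]"
      using us v dom_set_Delta(1)[of v] by (simp only: list_lang_simps fst_conv snd_conv tuples_Nil) blast
    then show ?thesis by (simp add: FZero )
  next
    case FOne
    then obtain c where "us = []" "v = [C c]"
      using us v dom_set_Delta(1)[of v] by (simp only: list_lang_simps fst_conv snd_conv tuples_Nil) blast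
    then show ?thesis by (simp add: FOne C_eq_1_iff)
  next
    case FAdd
    then obtain a b c where "us = [[C a], [C b]]" "v = [C c]"
      using us v dom_set_Delta_pairs(1)[of us] dom_set_Delta(1)[of v]
      by (simp only: list_lang_simps fst_conv snd_conv) blast
    then show ?thesis by (simp add: FAdd C_sum_iff)
  next
    case FMul
    then obtain a b c where "us = [[C a], [C b]]" "v = [C c]"
      using us v dom_set_Delta_pairs(1)[of us] dom_set_Delta(1)[of v]
      by (simp only: list_lang_simps fst_conv snd_conv) blast
    then show ?thesis by (simp add: FMul C_eq_iff monom_mult)
  next
    case NZero
    then obtain c where "us = []" "v = [X (int c)]"
      using us v dom_set_Delta(2)[of v] by (simp only: list_lang_simps fst_conv snd_conv tuples_Nil) blast
    then show ?thesis by (simp add: NZero X_eq_1_iff)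
  next
    case NOne
    then obtain c where "us = []" "v = [X (int c)]"
      using us v dom_set_Delta(2)[of v] by (simp only: list_lang_simps fst_conv snd_conv tuples_Nil) blast
    then show ?thesis by (simp add: NOne X_eq_iff)
  next
    case NAdd
    then obtain i j n where "us = [[X (int i)], [X (int j)]]" "v = [X (int n)]"
      using us v dom_set_Delta_pairs(2)[of us] dom_set_Delta(2)[of v]
      by (simp only: list_lang_simps fst_conv snd_conv) blast
    moreover have "int n = int i + int j \<longleftrightarrow> n = i + j" by linarith
    ultimately show ?thesis by (simp add: NAdd X_mult X_eq_iff)
  next
    case NMul
    then obtain i j n where e: "us = [[X (int i)], [X (int j)]]" "v = [X (int n)]"
      using us v dom_set_Delta_pairs(2)[of us] dom_set_Delta(2)[of v]
      by (simp only: list_lang_simps fst_conv snd_conv) blast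
    have "sat R [X (int i), X (int j), X (int n), X 1 :: 'a laurent] (mult_fm (Var 3) (Var 0) (Var 1) (Var 2)) \<longleftrightarrow>
        int n = int i * int j"
      by (rule sat_mult) simp_all
    then show ?thesis using NMul by (simp add: e) (metis of_nat_eq_iff of_nat_mult)
  next
    case Len
    then show ?thesis using us v by (auto simp: dom_set_Delta in_tuples_Cons X_eq_iff)
  qed
next
  fix f xs assume xs: "xs \<in> tuples (Carrier (list_super :: 'a super_model)) (fst (fun_type list_lang f))"
  show "FunI list_super f xs \<in> Carrier (list_super :: 'a super_model) (snd (fun_type list_lang f))"
    using xs by (cases f) (auto simp: in_tuples_Cons)
next
  fix r and us :: "'a laurent list list" assume "us \<in> tuples (dom_set Delta R [X 1]) (rel_type list_lang r)"
  then obtain f h n c i where e: "us = [[f, h, X (int n)], [C c], [X (int i)]]" "codes f h n"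
    by (auto simp: in_tuples_Cons dom_set_Delta)
  have "sat R (concat us @ [X 1]) (RelC Delta r) \<longleftrightarrow> i \<in> {1..n} \<and> md h (int i) dvd f - C c"
    by (simp add: e sat_index[of _ _ _ n] sat_value[of _ _ "int i"] X_eq_iff)
  also have "\<dots> \<longleftrightarrow> i \<in> {1..n} \<and> c = decoded f h i"
    using codesD[OF e(2)] by blast
  also have "\<dots> \<longleftrightarrow> RelI list_super r (map2 decode (rel_type list_lang r) us)"
    by (cases r) (auto simp: e simp del: upt_Suc)
  finally show "sat R (concat us @ [X 1]) (RelC Delta r) \<longleftrightarrow>
      RelI list_super r (map2 decode (rel_type list_lang r) us)" .
qed

section \<open>Arbitrary admissible parameters\<close>

lemma tval_twist:
  assumes c: "c \<noteq> 0" and "has_sort ring_lang \<Sigma> t s" and "length xs = length \<Sigma>"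
  shows "tval R (map (twist \<epsilon> c) xs) t = twist \<epsilon> c (tval R xs t)"
  using assms(2,3)
proof (induction t arbitrary: s)
  case (App f ts)
  then have ts: "list_all2 (has_sort ring_lang \<Sigma>) ts (fst (fun_type ring_lang f))" by simp
  show ?case
  proof (cases f)
    case RAdd
    then obtain a b where "ts = [a, b]" using ts by (auto simp: list_all2_Cons2)
    then show ?thesis using App RAdd by (auto simp: twist_add[OF c])
  next
    case RMul
    then obtain a b where "ts = [a, b]" using ts by (auto simp: list_all2_Cons2)
    then show ?thesis using App RMul by (auto simp: twist_mult[OF c])
  qed (use ts in \<open>simp_all add: twist_0[OF c] twist_1[OF c]\<close>)
qed simp

text \<open>Injectivity of the automorphism settles equations, surjectivity the quantifier.\<close>

lemma sat_twist:
  assumes c: "c \<noteq> 0" and \<epsilon>: "\<epsilon> = 1 \<or> \<epsilon> = - 1" and "wff ring_lang \<Sigma> \<phi>" and "length xs = length \<Sigma>"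
  shows "sat R (map (twist \<epsilon> c) xs) \<phi> \<longleftrightarrow> sat R xs \<phi>"
  using assms(3,4)
proof (induction \<phi> arbitrary: \<Sigma> xs)
  case (Eq s t u)
  then show ?case
    using tval_twist[OF c, of \<Sigma> t s xs \<epsilon>] tval_twist[OF c, of \<Sigma> u s xs \<epsilon>] twist_twist[OF c \<epsilon>]
    by (simp del: tval.simps) metis
next
  case (Exi s \<phi>)
  have "(\<exists>x. sat R (x # map (twist \<epsilon> c) xs) \<phi>) \<longleftrightarrow> (\<exists>x. sat R (map (twist \<epsilon> c) (x # xs)) \<phi>)"
    using twist_inverse[OF c \<epsilon>] by (metis list.simps(9))
  also have "\<dots> \<longleftrightarrow> (\<exists>x. sat R (x # xs) \<phi>)"
  proof -
    have "sat R (map (twist \<epsilon> c) (x # xs)) \<phi> \<longleftrightarrow> sat R (x # xs) \<phi>" for x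
      using Exi.prems by (intro Exi.IH[of "s # \<Sigma>"]) simp_all
    then show ?thesis by (simp only:)
  qed
  finally show ?case by simp
next
  case (And \<phi> \<psi>)
  then have "wff ring_lang \<Sigma> \<phi>" "wff ring_lang \<Sigma> \<psi>" by simp_all
  with And.IH And.prems(2) show ?case unfolding sat.simps by blast
qed auto

definition \<psi>_gen :: ring_fm where "\<psi>_gen = gen_fm (Var 0)"

lemma wff_gen': "wff ring_lang [()] \<psi>_gen"
  by (simp add: \<psi>_gen_def)

lemma sat_gen_X: "sat R [X 1 :: 'a::field laurent] \<psi>_gen"
proof -
  have "(X 1 :: 'a laurent) dvd 1" unfolding laurent_unit_iff using one_neq_zero by blast
  moreover have "X 1 \<noteq> C c" for c :: 'a using monom_eq_iff[of 1 1 0 c] by simp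
  moreover have "\<forall>f :: 'a laurent. \<exists>a. X 1 - 1 dvd f - C a" using X_generator by blast
  ultimately show ?thesis by (simp add: \<psi>_gen_def sat_gen)
qed

text \<open>Every admissible parameter is the image of x under an automorphism, so verification at x
  will be enough.\<close>

lemma sat_genE:
  assumes "sat R [t :: 'a::field laurent] \<psi>_gen"
  obtains c \<epsilon> where "c \<noteq> 0" "\<epsilon> = 1 \<or> \<epsilon> = - 1" "t = twist \<epsilon> c (X 1)"
proof -
  have "t dvd 1" "\<And>a. t \<noteq> C a" "\<And>f. \<exists>a. t - 1 dvd f - C a"
    using assms unfolding \<psi>_gen_def sat_gen by simp_all
  then obtain c \<epsilon> where "c \<noteq> 0" "\<epsilon> = 1 \<or> \<epsilon> = - 1" "t = monom \<epsilon> c" by (rule generator_imp)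
  then show ?thesis using that by (simp add: twist_monom)
qed

context
  fixes c :: "'a::field" and \<epsilon> :: int
  assumes c: "c \<noteq> 0" and \<epsilon>: "\<epsilon> = 1 \<or> \<epsilon> = - 1"
begin

abbreviation "\<sigma> \<equiv> twist \<epsilon> c"
abbreviation "\<tau> \<equiv> twist \<epsilon> (c powi (- \<epsilon>))"

lemma sat_\<sigma>: "wff ring_lang \<Sigma> \<phi> \<Longrightarrow> xs \<in> tuples (Carrier R) \<Sigma> \<Longrightarrow> sat R (map \<sigma> xs) \<phi> \<longleftrightarrow> sat R xs \<phi>"
  by (rule sat_twist[OF c \<epsilon>]) (auto dest: length_tuples)

lemma dom_set_\<sigma>:
  assumes "wf_code L ring_lang \<Delta>" "q \<in> tuples (Carrier R) (params \<Delta>)"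
  shows "u \<in> dom_set \<Delta> R (map \<sigma> q) s \<longleftrightarrow> map \<tau> u \<in> dom_set \<Delta> R q s"
  by (rule dom_set_transfer[OF assms twist_twist[OF c \<epsilon>] twist_inverse[OF c \<epsilon>] _ _ sat_\<sigma>]) simp_all

lemma realizes_\<sigma>:
  assumes "wf_code L ring_lang \<Delta>" "realizes L \<Delta> R q B \<nu>" "q \<in> tuples (Carrier R) (params \<Delta>)"
  shows "realizes L \<Delta> R (map \<sigma> q) B (\<lambda>s u. \<nu> s (map \<tau> u))"
  by (rule realizes_transfer[OF assms twist_twist[OF c \<epsilon>] twist_inverse[OF c \<epsilon>] _ _ sat_\<sigma>]) simp_all

lemma realizes_Delta: "realizes list_lang Delta R [\<sigma> (X 1)] list_super (\<lambda>s u. decode s (map \<tau> u))"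
  using realizes_\<sigma>[OF wf_Delta realizes_Delta_X] by simp

text \<open>Moving the parameter by \<open>\<sigma>\<close> precomposes the coordinate map with
  \<open>\<tau>\<close>, whereas the graph defined by a formula also has its values moved; following
  by \<open>\<sigma>\<close> makes the two agree.\<close>

lemma realizes_post_\<sigma>:
  assumes "realizes ring_lang \<Gamma> B p R \<mu>"
  shows "realizes ring_lang \<Gamma> B p R (\<lambda>s u. \<sigma> (\<mu> s u))"
  unfolding realizes_def
proof (intro conjI allI ballI)
  fix s
  have "(\<lambda>u. \<sigma> (\<mu> s u)) ` dom_set \<Gamma> B p s = \<sigma> ` (\<mu> s ` dom_set \<Gamma> B p s)" by (simp add: image_image)
  also have "\<dots> = range \<sigma>" by (simp only: realizes_image[OF assms] laurent_ring_simps)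
  also have "\<dots> = Carrier R s" using twist_inverse[OF c \<epsilon>] by (auto intro: range_eqI[OF sym])
  finally show "(\<lambda>u. \<sigma> (\<mu> s u)) ` dom_set \<Gamma> B p s = Carrier R s" .
next
  fix s u v assume "u \<in> dom_set \<Gamma> B p s" "v \<in> dom_set \<Gamma> B p s"
  then have "sat B (u @ v @ p) (EquC \<Gamma> s) \<longleftrightarrow> \<mu> s u = \<mu> s v" by (rule realizes_Equ[OF assms])
  also have "\<dots> \<longleftrightarrow> \<sigma> (\<mu> s u) = \<sigma> (\<mu> s v)" using twist_twist[OF c \<epsilon>] by metis
  finally show "sat B (u @ v @ p) (EquC \<Gamma> s) \<longleftrightarrow> \<sigma> (\<mu> s u) = \<sigma> (\<mu> s v)" .
next
  fix f us v
  assume us: "us \<in> tuples (dom_set \<Gamma> B p) (fst (fun_type ring_lang f))"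
    and v: "v \<in> dom_set \<Gamma> B p (snd (fun_type ring_lang f))"
  have "sat B (concat us @ v @ p) (FunC \<Gamma> f) \<longleftrightarrow>
      \<mu> (snd (fun_type ring_lang f)) v = FunI R f (map2 \<mu> (fst (fun_type ring_lang f)) us)"
    by (rule realizes_Fun[OF assms _ us v]) simp
  also have "\<dots> \<longleftrightarrow> \<sigma> (\<mu> (snd (fun_type ring_lang f)) v) = \<sigma> (FunI R f (map2 \<mu> (fst (fun_type ring_lang f)) us))"
    using twist_twist[OF c \<epsilon>] by metis
  also have "\<sigma> (FunI R f (map2 \<mu> (fst (fun_type ring_lang f)) us)) =
      FunI R f (map2 (\<lambda>s u. \<sigma> (\<mu> s u)) (fst (fun_type ring_lang f)) us)"
    using us by (cases rule: ring_fun_cases) (simp_all add: twist_0[OF c] twist_1[OF c] twist_add[OF c] twist_mult[OF c])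
  finally show "sat B (concat us @ v @ p) (FunC \<Gamma> f) \<longleftrightarrow> \<sigma> (\<mu> (snd (fun_type ring_lang f)) v) =
      FunI R f (map2 (\<lambda>s u. \<sigma> (\<mu> s u)) (fst (fun_type ring_lang f)) us)" .
qed auto

end

lemma realizes_imp_interpretation:
  "realizes L \<Gamma> B p A \<mu> \<Longrightarrow> well_defined L \<Gamma> B p \<and> (\<exists>h. is_iso L (interp L \<Gamma> B p) A h)"
  using realizes_imp_coordinate_map unfolding coordinate_map_def by blast

lemma regular_Gamma0:
  "regular_interpretation ring_lang (R :: 'a::field laurent_model)
     list_lang (S :: 'a super_model) Gamma0 Tru"
proof -
  have "well_defined ring_lang Gamma0 (S :: 'a super_model) [] \<and> (\<exists>h. is_iso ring_lang (interp ring_lang Gamma0 (S :: 'a super_model) [])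
      (R :: 'a laurent_model) h)"
    by (rule realizes_imp_interpretation[OF realizes_Gamma0])
  then show ?thesis unfolding regular_interpretation_def using wf_Gamma0 by simp
qed

lemma regular_Delta:
  "regular_interpretation list_lang (S :: 'a::field super_model) 
     ring_lang (R :: 'a laurent_model) Delta \<psi>_gen"
  unfolding regular_interpretation_def
proof (intro conjI ballI impI)
  show "wf_code list_lang ring_lang Delta" by (rule wf_Delta)
  show "wff ring_lang (params Delta) \<psi>_gen" using wff_gen' by simp
  show "\<exists>p\<in>tuples (Carrier R) (params Delta). sat (R :: 'a laurent_model) p \<psi>_gen"
    by (rule bexI[of _ "[X 1]"]) (simp_all add: sat_gen_X)
next
  fix p :: "'a laurent list"
  assume "p \<in> tuples (Carrier R) (params Delta)" and sat: "sat R p \<psi>_gen"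
  then obtain t where p: "p = [t]" by (auto simp: in_tuples_Cons)
  obtain c \<epsilon> where "c \<noteq> 0" "\<epsilon> = 1 \<or> \<epsilon> = - 1" "t = twist \<epsilon> c (X 1)"
    using sat unfolding p by (rule sat_genE)
  from realizes_imp_interpretation[OF realizes_Delta[OF this(1,2)]] this(3)
  show "well_defined list_lang Delta R p" "\<exists>h. is_iso list_lang (interp list_lang Delta R p)
      (S :: 'a super_model) h"
    by (simp_all add: p)
qed

section \<open>The coordinate map of the ring in itself\<close>

text \<open>Free variables \<open>p, \<alpha>, c\<close>: Horner's scheme for the polynomial with coefficients \<open>p\<close> at
  \<open>\<alpha>\<close> yields \<open>c\<close>; the tuple \<open>s\<close> records the intermediate results.\<close>

definition horner_fm :: list_fm where
  "horner_fm = Exi ListS (Ands [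
     Eq NatS (App Len [Var 0]) (n_succ (App Len [Var 1])),
     Rel At [Var 0, Var 3, App NOne []],
     Rel At [Var 0, App FZero [], App Len [Var 0]],
     Fall NatS (Fall FieldS (Imp (Rel At [Var 3, Var 0, Var 1])
       (Exi FieldS (And (Rel At [Var 3, Var 0, n_succ (Var 2)])
         (Rel At [Var 3, App FAdd [Var 1, App FMul [Var 5, Var 0]], Var 2])))))])"

definition horner :: "'a::field list \<Rightarrow> 'a \<Rightarrow> 'a" where
  "horner p \<alpha> = foldr (\<lambda>a b. a + \<alpha> * b) p 0"

text \<open>Induction on the list: removing the head of \<open>s\<close> leaves a record for the
  tail of \<open>p\<close>, whose first entry is the Horner value of that tail.\<close>

lemma ex_horner:
  "(\<exists>s. length s = Suc (length p) \<and> s ! 0 = c \<and> s ! length p = 0 \<and>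
      (\<forall>i<length p. s ! i = p ! i + \<alpha> * s ! Suc i)) \<longleftrightarrow> c = horner p \<alpha>"
proof (induction p arbitrary: c)
  case Nil
  have "(\<exists>s. length s = Suc 0 \<and> s ! 0 = c \<and> s ! 0 = 0) \<longleftrightarrow> c = 0"
    by (auto intro: exI[of _ "[0]"])
  then show ?case by (simp add: horner_def)
next
  case (Cons a p)
  have "(\<exists>s. length s = Suc (Suc (length p)) \<and> s ! 0 = c \<and> s ! Suc (length p) = 0 \<and>
      (\<forall>i<Suc (length p). s ! i = (a # p) ! i + \<alpha> * s ! Suc i)) \<longleftrightarrow>
    (\<exists>s. length s = Suc (length p) \<and> s ! length p = 0 \<and> c = a + \<alpha> * s ! 0 \<and>
      (\<forall>i<length p. s ! i = p ! i + \<alpha> * s ! Suc i))" (is "?l \<longleftrightarrow> ?r")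
  proof
    assume ?l
    then obtain s where s: "length s = Suc (Suc (length p))" "s ! 0 = c" "s ! Suc (length p) = 0"
      "\<forall>i<Suc (length p). s ! i = (a # p) ! i + \<alpha> * s ! Suc i" by blast
    obtain x s' where e: "s = x # s'" using s(1) by (cases s) auto
    have "s' ! i = p ! i + \<alpha> * s' ! Suc i" if "i < length p" for i
      using s(4)[rule_format, of "Suc i"] that by (simp add: e)
    then show ?r using s(1-3) s(4)[rule_format, of 0] by (intro exI[of _ s']) (auto simp: e)
  next
    assume ?r
    then obtain s where s: "length s = Suc (length p)" "s ! length p = 0" "c = a + \<alpha> * s ! 0"
      "\<forall>i<length p. s ! i = p ! i + \<alpha> * s ! Suc i" by blast
    then show ?l by (intro exI[of _ "c # s"]) (auto simp: less_Suc_eq_0_disj)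
  qed
  also have "\<dots> \<longleftrightarrow> (\<exists>d. c = a + \<alpha> * d \<and> (\<exists>s. length s = Suc (length p) \<and> s ! 0 = d \<and> s ! length p = 0 \<and>
      (\<forall>i<length p. s ! i = p ! i + \<alpha> * s ! Suc i)))"
    by auto
  also have "\<dots> \<longleftrightarrow> c = a + \<alpha> * horner p \<alpha>"
    unfolding Cons.IH by simp
  finally show ?case by (simp add: horner_def)
qed

lemma wff_horner: "wff list_lang [ListS, FieldS, FieldS] horner_fm"
  by (simp add: horner_fm_def)

text \<open>Components are numbered from 1 in the formula, so its indices j and j + 1 are positions
  j - 1 and j of the recorded list.\<close>

lemma sat_horner: "sat S [Lst p, Fld \<alpha>, Fld c] horner_fm \<longleftrightarrow> c = horner p \<alpha>"
proof -
  have "sat S [Lst p, Fld \<alpha>, Fld c] horner_fm \<longleftrightarrow> (\<exists>s. length s = Suc (length p) \<and> s ! 0 = c \<and> s ! length p = 0 \<and>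
      (\<forall>j a. 1 \<le> j \<and> j \<le> length p \<and> p ! (j - 1) = a \<longrightarrow> s ! (j - 1) = a + \<alpha> * s ! j))"
    by (auto simp: horner_fm_def)
  also have "\<dots> \<longleftrightarrow> (\<exists>s. length s = Suc (length p) \<and> s ! 0 = c \<and> s ! length p = 0 \<and>
      (\<forall>i<length p. s ! i = p ! i + \<alpha> * s ! Suc i))"
  proof -
    have "(\<forall>j a. 1 \<le> j \<and> j \<le> length p \<and> p ! (j - 1) = a \<longrightarrow> s ! (j - 1) = a + \<alpha> * s ! j) \<longleftrightarrow>
        (\<forall>i<length p. s ! i = p ! i + \<alpha> * s ! Suc i)" for s
    proof (intro iffI allI impI)
      fix i assume *: "\<forall>j a. 1 \<le> j \<and> j \<le> length p \<and> p ! (j - 1) = a \<longrightarrow> s ! (j - 1) = a + \<alpha> * s ! j" "i < length p"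
      then show "s ! i = p ! i + \<alpha> * s ! Suc i" using *(1)[rule_format, of "Suc i"] by simp
    next
      fix j a assume *: "\<forall>i<length p. s ! i = p ! i + \<alpha> * s ! Suc i" "1 \<le> j \<and> j \<le> length p \<and> p ! (j - 1) = a"
      then show "s ! (j - 1) = a + \<alpha> * s ! j" using *(1)[rule_format, of "j - 1"] by auto
    qed
    then show ?thesis by simp
  qed
  also have "\<dots> \<longleftrightarrow> c = horner p \<alpha>" by (rule ex_horner)
  finally show ?thesis .
qed

lemma horner_sum: "horner p \<alpha> = (\<Sum>i<length p. p ! i * \<alpha> ^ i)"
proof (induction p)
  case (Cons a p)
  have "(\<Sum>i<Suc (length p). (a # p) ! i * \<alpha> ^ i) = a + (\<Sum>i<length p. p ! i * (\<alpha> * \<alpha> ^ i))"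
    by (subst sum.lessThan_Suc_shift) simp
  then show ?case using Cons by (simp add: horner_def sum_distrib_left mult_ac)
qed (simp add: horner_def)

text \<open>The second tuple starts at exponent -1, hence the extra factor \<beta> in front of its
  Horner value.\<close>

lemma ev_laurent_of:
  assumes "\<alpha> * \<beta> = (1::'a::field)"
  shows "ev \<alpha> (laurent_of [Lst p, Lst q]) = horner p \<alpha> + \<beta> * horner q \<beta>"
proof -
  have \<alpha>: "\<alpha> \<noteq> 0" and \<beta>: "\<beta> = inverse \<alpha>" using assms by (auto simp: inverse_unique)
  have "\<alpha> powi (- int (j + 1)) = \<beta> * \<beta> ^ j" for j
    unfolding \<beta> by (simp only: power_int_minus power_int_of_nat power_inverse[symmetric]) (simp add: power_inverse)
  then show ?thesis
    unfolding laurent_of.simps ev_add[OF \<alpha>] ev_sum[OF \<alpha>] ev_monom[OF \<alpha>] horner_sum sum_distrib_left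
    by (simp add: mult_ac)
qed

section \<open>The composite interpretation of the ring in itself\<close>

abbreviation XiA :: "(unit, ring_fun, unit, unit, ring_fun, unit) code" where
  "XiA \<equiv> comp_code ring_lang list_lang Gamma0 Delta"

lemma comp_code_sel:
  "coord (comp_code LA LB \<Gamma> \<Delta>) s = coords \<Delta> (coord \<Gamma> s)"
  "params (comp_code LA LB \<Gamma> \<Delta>) = coords \<Delta> (params \<Gamma>) @ params \<Delta>"
  by (simp_all add: comp_code_def)

lemma wf_XiA: "wf_code ring_lang ring_lang XiA"
  by (rule wf_comp_code[OF wf_Gamma0 wf_Delta])

interpretation RX: realization list_lang ring_lang Delta R "[X 1]" list_super decode
  by unfold_locales (simp_all add: wf_Delta realizes_Delta_X)

text \<open>Transfers the Horner computation to the ring, where tuples are present only through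
  their codes.\<close>

definition horner_Delta :: ring_fm where
  "horner_Delta = translate list_lang Delta [ListS, FieldS, FieldS] horner_fm"

lemma wff_horner_Delta: "wff ring_lang [(), (), (), (), (), ()] horner_Delta"
  using wff_translate[OF wf_Delta wff_horner] by (simp add: horner_Delta_def)

lemma sat_horner_Delta:
  assumes "[f, h, w] \<in> dom_set Delta R [X 1] ListS" "decode ListS [f, h, w] = Lst p"
  shows "sat R [f, h, w, C \<alpha>, C c, X 1] horner_Delta \<longleftrightarrow> c = horner p \<alpha>"
proof -
  have "sat R (concat [[f, h, w], [C \<alpha>], [C c]] @ [X 1]) horner_Delta \<longleftrightarrow>
      [[f, h, w], [C \<alpha>], [C c]] \<in> tuples RX.D [ListS, FieldS, FieldS] \<and>
      sat S (map2 decode [ListS, FieldS, FieldS] [[f, h, w], [C \<alpha>], [C c]]) horner_fm"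
    unfolding horner_Delta_def by (rule RX.sat_translate[OF wff_horner]) simp
  then show ?thesis using assms by (simp add: dom_set_Delta(1) sat_horner C_eq_iff)
qed

text \<open>A congruence modulo t - \<alpha> replaces the evaluation of y at t = \<alpha>. Under the
  four quantifiers, variables 0 to 3 are the Horner values of the second and the first tuple, then
  \<beta> = 1/\<alpha> and \<alpha>; the six coordinates are 4 to 9, y is 10 and t is 11.\<close>

definition thetaA :: ring_fm where
  "thetaA = And (inst [0, 1, 2, 3, 4, 5, 7] (DomC XiA ()))
     (Fall () (Fall () (Imp (And (And (const_fm (Var 0)) (const_fm (Var 1))) (Eq () (ti (Var 1) (Var 0)) to))
       (Exi () (Exi () (And (And (const_fm (Var 0)) (const_fm (Var 1)))
         (And (And (inst [4, 5, 6, 3, 1, 11] horner_Delta) (inst [7, 8, 9, 2, 0, 11] horner_Delta))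
           (diff_dvd_fm (Var 11) (Var 3) (Var 10) (pl (Var 1) (ti (Var 2) (Var 0)))))))))))"

lemma wff_DomA: "wff ring_lang [(), (), (), (), (), (), ()] (DomC XiA ())"
  using wf_code_Dom[OF wf_XiA, of "()"] by (simp add: comp_code_sel)

lemma wff_thetaA: "wff ring_lang [(), (), (), (), (), (), (), ()] thetaA"
  by (simp add: thetaA_def wff_inst[OF wff_DomA] wff_inst[OF wff_horner_Delta])

abbreviation muA :: "unit \<Rightarrow> 'a::field laurent list \<Rightarrow> 'a laurent" where
  "muA \<equiv> comp_map Gamma0 (\<lambda>_. laurent_of) Delta decode"

lemma realizes_XiA: "realizes ring_lang XiA R [X 1] (R :: 'a::field laurent_model) muA"
  using RX.realizes_comp_code[OF wf_Gamma0 realizes_Gamma0, where ps = "[]"] by simp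

text \<open>The pairs with \<alpha> \<beta> = 1 range over all nonzero \<alpha>, and agreement at
  all of these identifies y because the field is infinite.\<close>

lemma sat_thetaA:
  assumes inf: "infinite (UNIV :: 'a::field set)" and u: "u \<in> tuples (Carrier R) (coord XiA ())"
  shows "sat R (u @ [y] @ [X 1 :: 'a laurent]) thetaA \<longleftrightarrow> u \<in> dom_set XiA R [X 1] () \<and> muA () u = y"
proof -
  obtain f h w f' h' w' where ue: "u = [f, h, w, f', h', w']"
    using u by (auto simp: comp_code_sel in_tuples_Cons)
  have dom: "sat R (u @ [y] @ [X 1]) (inst [0, 1, 2, 3, 4, 5, 7] (DomC XiA ())) \<longleftrightarrow> u \<in> dom_set XiA R [X 1] ()"
    using u by (simp add: sat_inst[OF wff_DomA] ue dom_set_def)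
  show ?thesis
  proof (cases "u \<in> dom_set XiA R [X 1] ()")
    case True
    have "\<exists>us\<in>tuples RX.D (coord Gamma0 ()). u = concat us \<and>
        map2 decode (coord Gamma0 ()) us \<in> dom_set Gamma0 list_super [] ()"
      using True RX.dom_set_comp[OF wf_Gamma0 realizes_Gamma0, where ps = "[]" and u = u and s = "()"] by simp
    then obtain u1 u2 where us: "u = u1 @ u2" "u1 \<in> RX.D ListS" "u2 \<in> RX.D ListS"
      by (auto simp: in_tuples_Cons)
    then have e: "u1 = [f, h, w]" "u2 = [f', h', w']"
      using length_dom_set[OF us(2)] length_dom_set[OF us(3)] by (simp_all add: ue append_eq_conv_conj[symmetric] length_Suc_conv) auto
    obtain p q where pq: "decode ListS [f, h, w] = Lst p" "decode ListS [f', h', w'] = Lst q"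
      by (simp add: decode.simps)
    have mu: "muA () u = laurent_of [Lst p, Lst q]"
      by (simp add: comp_map_def ue pq)
    let ?v = "\<lambda>d c \<beta> \<alpha>. C d # C c # C \<beta> # C \<alpha> # u @ [y, X 1]"
    have h1: "sat R (?v d c \<beta> \<alpha>) (inst [4, 5, 6, 3, 1, 11] horner_Delta) \<longleftrightarrow> c = horner p \<alpha>" for d c \<beta> \<alpha>
      using us(2) pq sat_horner_Delta[of f h w p \<alpha> c] by (simp add: sat_inst[OF wff_horner_Delta] ue e)
    have h2: "sat R (?v d c \<beta> \<alpha>) (inst [7, 8, 9, 2, 0, 11] horner_Delta) \<longleftrightarrow> d = horner q \<beta>" for d c \<beta> \<alpha>
      using us(3) pq sat_horner_Delta[of f' h' w' q \<beta> d] by (simp add: sat_inst[OF wff_horner_Delta] ue e)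
    have "sat R (u @ [y] @ [X 1]) thetaA \<longleftrightarrow>
      (\<forall>\<alpha> \<beta>. \<alpha> * \<beta> = 1 \<longrightarrow> (\<exists>c d. c = horner p \<alpha> \<and> d = horner q \<beta> \<and> X 1 - C \<alpha> dvd y - C (c + \<beta> * d)))"
      (is "_ \<longleftrightarrow> ?rhs")
    proof -
      let ?body = "\<lambda>\<alpha> \<beta>. (\<exists>c d. c = horner p \<alpha> \<and> d = horner q \<beta> \<and> X 1 - C \<alpha> dvd y - C (c + \<beta> * d))"
      have body: "(\<exists>x. (\<exists>z. ((\<exists>d. z = C d) \<and> (\<exists>c. x = C c)) \<and>
          (sat R (z # x # C \<beta> # C \<alpha> # u @ [y, X 1]) (inst [4, 5, 6, 3, 1, 11] horner_Delta) \<and>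
           sat R (z # x # C \<beta> # C \<alpha> # u @ [y, X 1]) (inst [7, 8, 9, 2, 0, 11] horner_Delta)) \<and>
          X 1 - C \<alpha> dvd y - (x + C \<beta> * z))) \<longleftrightarrow> ?body \<alpha> \<beta>" for \<alpha> \<beta>
      proof
        assume "\<exists>x. (\<exists>z. ((\<exists>d. z = C d) \<and> (\<exists>c. x = C c)) \<and>
          (sat R (z # x # C \<beta> # C \<alpha> # u @ [y, X 1]) (inst [4, 5, 6, 3, 1, 11] horner_Delta) \<and>
           sat R (z # x # C \<beta> # C \<alpha> # u @ [y, X 1]) (inst [7, 8, 9, 2, 0, 11] horner_Delta)) \<and>
          X 1 - C \<alpha> dvd y - (x + C \<beta> * z))"
        then obtain c d where "sat R (?v d c \<beta> \<alpha>) (inst [4, 5, 6, 3, 1, 11] horner_Delta)"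
          "sat R (?v d c \<beta> \<alpha>) (inst [7, 8, 9, 2, 0, 11] horner_Delta)"
          "X 1 - C \<alpha> dvd y - (C c + C \<beta> * C d)" by blast
        then show "?body \<alpha> \<beta>" unfolding h1 h2 by (simp add: monom_mult single_add[symmetric])
      next
        assume "?body \<alpha> \<beta>"
        then obtain c d where "c = horner p \<alpha>" "d = horner q \<beta>" "X 1 - C \<alpha> dvd y - (C c + C \<beta> * C d)"
          by (auto simp: monom_mult single_add[symmetric])
        then show "\<exists>x. (\<exists>z. ((\<exists>d. z = C d) \<and> (\<exists>c. x = C c)) \<and>
          (sat R (z # x # C \<beta> # C \<alpha> # u @ [y, X 1]) (inst [4, 5, 6, 3, 1, 11] horner_Delta) \<and>
           sat R (z # x # C \<beta> # C \<alpha> # u @ [y, X 1]) (inst [7, 8, 9, 2, 0, 11] horner_Delta)) \<and>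
          X 1 - C \<alpha> dvd y - (x + C \<beta> * z))"
          using h1[of d c \<beta> \<alpha>] h2[of d c \<beta> \<alpha>]
          by (intro exI[of _ "C c"] exI[of _ "C d"] conjI) blast+
      qed
      have "sat R (u @ [y] @ [X 1]) thetaA \<longleftrightarrow>
        (\<forall>a b. ((\<exists>\<beta>. b = C \<beta>) \<and> (\<exists>\<alpha>. a = C \<alpha>)) \<and> a * b = 1 \<longrightarrow>
          (\<exists>x z. ((\<exists>d. z = C d) \<and> (\<exists>c. x = C c)) \<and>
          (sat R (z # x # b # a # u @ [y, X 1]) (inst [4, 5, 6, 3, 1, 11] horner_Delta) \<and>
           sat R (z # x # b # a # u @ [y, X 1]) (inst [7, 8, 9, 2, 0, 11] horner_Delta)) \<and>
          X 1 - a dvd y - (x + b * z)))"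
        using dom True by (simp add: thetaA_def ue)
      also have "\<dots> \<longleftrightarrow> (\<forall>\<alpha> \<beta>. C \<alpha> * C \<beta> = 1 \<longrightarrow> ?body \<alpha> \<beta>)"
      proof -
        have gen: "(\<forall>a b. ((\<exists>\<beta>. b = C \<beta>) \<and> (\<exists>\<alpha>. a = C \<alpha>)) \<and> a * b = 1 \<longrightarrow> Q a b) \<longleftrightarrow>
            (\<forall>\<alpha> \<beta>. C \<alpha> * C \<beta> = 1 \<longrightarrow> Q (C \<alpha>) (C \<beta>))" for Q :: "'a laurent \<Rightarrow> 'a laurent \<Rightarrow> bool"
          by blast
        show ?thesis unfolding gen body ..
      qed
      also have "\<dots> \<longleftrightarrow> ?rhs"
        by (simp add: monom_mult C_eq_1_iff)
      finally show ?thesis .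
    qed
    also have "\<dots> \<longleftrightarrow> (\<forall>\<alpha> \<beta>. \<alpha> * \<beta> = 1 \<longrightarrow> ev \<alpha> y = ev \<alpha> (laurent_of [Lst p, Lst q]))"
    proof -
      have "X 1 - C \<alpha> dvd y - C (horner p \<alpha> + \<beta> * horner q \<beta>) \<longleftrightarrow> ev \<alpha> y = ev \<alpha> (laurent_of [Lst p, Lst q])"
        if "\<alpha> * \<beta> = 1" for \<alpha> \<beta>
      proof -
        have "\<alpha> \<noteq> 0" using that by auto
        then show ?thesis using ev_eq_iff[of \<alpha> y] ev_laurent_of[OF that, of p q] by simp
      qed
      then show ?thesis by simp
    qed
    also have "\<dots> \<longleftrightarrow> laurent_of [Lst p, Lst q] = y"
    proof
      assume *: "\<forall>\<alpha> \<beta>. \<alpha> * \<beta> = 1 \<longrightarrow> ev \<alpha> y = ev \<alpha> (laurent_of [Lst p, Lst q])"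
      show "laurent_of [Lst p, Lst q] = y"
        by (rule laurent_eq_by_ev[OF inf]) (use *[rule_format, OF right_inverse] in simp)
    qed simp
    finally show ?thesis using True mu by simp
  next
    case False
    then show ?thesis using dom unfolding thetaA_def sat.simps by blast
  qed
qed

lemma defines_A:
  assumes inf: "infinite (UNIV :: 'a::field set)"
  shows "defines_coordinate_maps ring_lang (R :: 'a laurent_model) XiA
     (comp_adm list_lang Gamma0 Tru Delta \<psi>_gen) (\<lambda>_. thetaA)"
  unfolding defines_coordinate_maps_def
proof (intro conjI allI ballI impI)
  fix s
  show "wff ring_lang (coord XiA s @ [s] @ params XiA) thetaA"
    using wff_thetaA by (simp add: comp_code_sel)
next
  fix r :: "'a laurent list"
  assume r: "r \<in> tuples (Carrier R) (params XiA)" and adm: "sat R r (comp_adm list_lang Gamma0 Tru Delta \<psi>_gen)"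
  obtain t where t: "r = [t]" using r by (auto simp: comp_code_sel in_tuples_Cons)
  have "sat R [t] \<psi>_gen"
    using adm by (simp add: comp_adm_def t sat_inst[OF wff_gen'])
  then obtain c \<epsilon> where c: "c \<noteq> 0" and \<epsilon>: "\<epsilon> = 1 \<or> \<epsilon> = - 1" and te: "t = twist \<epsilon> c (X 1)" by (rule sat_genE)
  let ?\<sigma> = "twist \<epsilon> c" and ?\<tau> = "twist \<epsilon> (c powi (- \<epsilon>))"
  have X1: "[X 1] \<in> tuples (Carrier R) (params XiA)" by (simp add: comp_code_sel)
  have "realizes ring_lang XiA R [t] R (\<lambda>s u. ?\<sigma> (muA s (map ?\<tau> u)))"
    using realizes_post_\<sigma>[OF c \<epsilon> realizes_\<sigma>[OF c \<epsilon> wf_XiA realizes_XiA X1]] by (simp add: te)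
  then have cm: "coordinate_map ring_lang XiA R r R (\<lambda>s u. ?\<sigma> (muA s (map ?\<tau> u)))"
    unfolding t by (rule realizes_imp_coordinate_map)
  moreover have "sat R (u @ [y] @ r) thetaA \<longleftrightarrow> u \<in> dom_set XiA R r s \<and> ?\<sigma> (muA s (map ?\<tau> u)) = y"
    if u: "u \<in> tuples (Carrier R) (coord XiA s)" for s u y
  proof -
    have inv: "map ?\<sigma> (map ?\<tau> v) = v" for v
      by (simp add: comp_def twist_inverse[OF c \<epsilon>])
    have u': "map ?\<tau> u \<in> tuples (Carrier R) (coord XiA ())"
      using u by (simp add: tuples_def list.rel_map)
    \<comment> \<open>Invariance under the automorphism brings the parameter back to x.\<close>
    have "sat R (map ?\<sigma> (map ?\<tau> u @ [?\<tau> y] @ [X 1])) thetaA \<longleftrightarrow> sat R (map ?\<tau> u @ [?\<tau> y] @ [X 1]) thetaA"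
      using length_tuples[OF u] by (intro sat_twist[OF c \<epsilon> wff_thetaA]) (simp add: comp_code_sel)
    also have "map ?\<sigma> (map ?\<tau> u @ [?\<tau> y] @ [X 1]) = u @ [y] @ r"
      unfolding map_append inv by (simp add: t te twist_inverse[OF c \<epsilon>])
    also have "sat R (map ?\<tau> u @ [?\<tau> y] @ [X 1]) thetaA \<longleftrightarrow>
        map ?\<tau> u \<in> dom_set XiA R [X 1] () \<and> muA () (map ?\<tau> u) = ?\<tau> y"
      by (rule sat_thetaA[OF inf u'])
    also have "map ?\<tau> u \<in> dom_set XiA R [X 1] () \<longleftrightarrow> u \<in> dom_set XiA R r s"
      using dom_set_\<sigma>[OF c \<epsilon> wf_XiA X1, of u "()"] by (simp add: t te)
    also have "muA () (map ?\<tau> u) = ?\<tau> y \<longleftrightarrow> ?\<sigma> (muA s (map ?\<tau> u)) = y"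
      using twist_twist[OF c \<epsilon>] twist_inverse[OF c \<epsilon>] by (metis (full_types) old.unit.exhaust)
    finally show ?thesis .
  qed
  ultimately show "\<exists>\<mu>. coordinate_map ring_lang XiA R r R \<mu> \<and>
      (\<forall>s. \<forall>u\<in>tuples (Carrier R) (coord XiA s). \<forall>x\<in>Carrier R s.
         sat R (u @ [x] @ r) thetaA \<longleftrightarrow> u \<in> dom_set XiA R r s \<and> \<mu> s u = x)"
    by (intro exI[of _ "\<lambda>s u. ?\<sigma> (muA s (map ?\<tau> u))"] conjI allI ballI) blast+
qed

section \<open>The coordinate map of the list superstructure in itself\<close>

abbreviation XiB :: "(list_sort, list_fun, list_rel, list_sort, list_fun, list_rel) code" where
  "XiB \<equiv> comp_code list_lang ring_lang Delta Gamma0"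

lemma wf_XiB: "wf_code list_lang list_lang XiB"
  by (rule wf_comp_code[OF wf_Delta wf_Gamma0])

lemma wff_XiB:
  "wff list_lang [ListS, ListS, ListS, ListS] (DomC XiB FieldS)"
  "wff list_lang [ListS, ListS, ListS, ListS] (DomC XiB NatS)"
  "wff list_lang [ListS, ListS, ListS, ListS, ListS, ListS, ListS, ListS] (DomC XiB ListS)"
  "wff list_lang [ListS, ListS, ListS, ListS, ListS, ListS, ListS, ListS, ListS, ListS] (FunC XiB Len)"
  "wff list_lang [ListS, ListS, ListS, ListS, ListS, ListS, ListS, ListS, ListS, ListS, ListS, ListS] (RelC XiB At)"
  using wf_code_Dom[OF wf_XiB, of FieldS] wf_code_Dom[OF wf_XiB, of NatS] wf_code_Dom[OF wf_XiB, of ListS]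
    wf_code_Fun[OF wf_XiB, of Len] wf_code_Rel[OF wf_XiB, of At]
  by (simp_all add: comp_code_sel)

text \<open>In the first two formulas the free variables are a pair of tuples representing \<open>u\<close>, then the
  value, and a pair representing the parameter \<open>t = c x\<^sup>\<epsilon>\<close>. If \<open>u = t\<^sup>n\<close>, the number \<open>n\<close> can be read
  off from the support of \<open>u\<close>.\<close>

definition theta_field :: list_fm where
  "theta_field = And (inst [0, 1, 3, 4] (DomC XiB FieldS)) (Exi NatS (inst [1, 2, 0, 0, 3] coeff_fm))"

definition theta_nat :: list_fm where
  "theta_nat = And (inst [0, 1, 3, 4] (DomC XiB NatS))
     (Exi NatS (Exi NatS (And (And (Eq NatS (Var 0) (App NZero [])) (Eq NatS (Var 1) (App NOne [])))
       (Exi FieldS (Exi FieldS (And (And (Neg (Eq FieldS (Var 0) (App FZero []))) (Neg (Eq FieldS (Var 1) (App FZero []))))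
         (Or (And (inst [7, 8, 3, 2, 1] coeff_fm) (inst [4, 5, 6, 2, 0] coeff_fm))
           (And (inst [7, 8, 2, 3, 1] coeff_fm) (inst [4, 5, 2, 6, 0] coeff_fm)))))))))"

text \<open>The composite code's own length and component relations are used: representatives of the
  true length, index and component are singled out by \<open>theta_nat\<close> and
  \<open>theta_field\<close> and then tested against the coordinates.\<close>

definition theta_list :: list_fm where
  "theta_list = And (inst [0, 1, 2, 3, 4, 5, 7, 8] (DomC XiB ListS)) (And
     (Exi ListS (Exi ListS (Exi NatS (And (Eq NatS (Var 0) (App Len [Var 9]))
       (And (inst [2, 1, 0, 10, 11] theta_nat) (inst [3, 4, 5, 6, 7, 8, 2, 1, 10, 11] (FunC XiB Len)))))))
     (Fall NatS (Fall FieldS (Imp (Rel At [Var 8, Var 0, Var 1])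
       (Exi ListS (Exi ListS (Exi ListS (Exi ListS (And
         (And (inst [3, 2, 4, 13, 14] theta_field) (inst [1, 0, 5, 13, 14] theta_nat))
         (inst [6, 7, 8, 9, 10, 11, 3, 2, 1, 0, 13, 14] (RelC XiB At)))))))))))"

definition thetaB :: "list_sort \<Rightarrow> list_fm" where
  "thetaB s = (case s of FieldS \<Rightarrow> theta_field | NatS \<Rightarrow> theta_nat | ListS \<Rightarrow> theta_list)"

lemma wff_theta_field: "wff list_lang [ListS, ListS, FieldS, ListS, ListS] theta_field"
  by (simp add: theta_field_def wff_inst[OF wff_XiB(1)] wff_inst[OF wff_coeff])

lemma wff_theta_nat: "wff list_lang [ListS, ListS, NatS, ListS, ListS] theta_nat"
  by (simp add: theta_nat_def wff_inst[OF wff_XiB(2)] wff_inst[OF wff_coeff])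

lemma wff_theta_list:
  "wff list_lang [ListS, ListS, ListS, ListS, ListS, ListS, ListS, ListS, ListS] theta_list"
  by (simp add: theta_list_def wff_inst[OF wff_XiB(3)] wff_inst[OF wff_XiB(4)] wff_inst[OF wff_XiB(5)]
      wff_inst[OF wff_theta_field] wff_inst[OF wff_theta_nat])

section \<open>Correctness at a parameter representing c x^\<epsilon>\<close>

context
  fixes c :: "'a::field" and \<epsilon> :: int and p0 q0 :: "'a list"
  assumes c: "c \<noteq> 0" and \<epsilon>: "\<epsilon> = 1 \<or> \<epsilon> = - 1" and t: "laurent_of [Lst p0, Lst q0] = twist \<epsilon> c (X 1)"
    and p0: "p0 \<noteq> []"
begin

interpretation RG: realization ring_lang list_lang Gamma0 "S :: 'a super_model" "[]" R "\<lambda>_. laurent_of"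
  by unfold_locales (simp_all add: wf_Gamma0 realizes_Gamma0)

abbreviation "r0 \<equiv> [Lst p0, Lst q0]"
abbreviation "muB \<equiv> comp_map Delta (\<lambda>s u. decode s (map (twist \<epsilon> (c powi (- \<epsilon>))) u)) Gamma0 (\<lambda>_. laurent_of)"

lemma r0: "[r0] \<in> tuples RG.D (params Delta)"
  using p0 by (simp add: dom_set_Gamma0)

lemma p_r0: "[twist \<epsilon> c (X 1)] = map2 (\<lambda>_. laurent_of) (params Delta) [r0]"
  by (simp add: t)

lemma realizes_XiB: "realizes list_lang XiB S r0 (S :: 'a super_model) muB"
  using RG.realizes_comp_code[OF wf_Delta realizes_Delta[OF c \<epsilon>] r0 p_r0] by simp

lemma dom_set_XiB:
  "u \<in> dom_set XiB S r0 s \<longleftrightarrow> (\<exists>us\<in>tuples RG.D (coord Delta s). u = concat us \<and>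
     map (twist \<epsilon> (c powi (- \<epsilon>))) (map2 (\<lambda>_. laurent_of) (coord Delta s) us) \<in> dom_set Delta R [X 1] s)"
  using RG.dom_set_comp[OF wf_Delta realizes_Delta[OF c \<epsilon>] r0 p_r0, of u s] dom_set_\<sigma>[OF c \<epsilon> wf_Delta, of "[X 1]"] by simp

text \<open>Constants are fixed by every \<open>twist\<close>, so undoing the automorphism does not
  affect the field element read off.\<close>

lemma muB_field:
  assumes "[Lst p, Lst q] \<in> dom_set XiB S r0 FieldS"
  shows "muB FieldS [Lst p, Lst q] = Fld (cf (laurent_of [Lst p, Lst q]) 0)"
proof -
  have "[twist \<epsilon> (c powi (- \<epsilon>)) (laurent_of [Lst p, Lst q])] \<in> dom_set Delta R [X 1] FieldS"
    using assms unfolding dom_set_XiB by (auto simp: in_tuples_Cons)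
  then obtain a where a: "twist \<epsilon> (c powi (- \<epsilon>)) (laurent_of [Lst p, Lst q]) = C a" by (auto simp: dom_set_Delta)
  then have "laurent_of [Lst p, Lst q] = C a"
    using twist_inverse[OF c \<epsilon>, of "laurent_of [Lst p, Lst q]"] by (simp add: twist_monom[OF c])
  then show ?thesis using a by (simp add: comp_map_def)
qed

text \<open>Undoing the automorphism yields x^n, so the element itself is the power (c
  x^\<epsilon>)^n.\<close>

lemma muB_nat:
  assumes "[Lst p, Lst q] \<in> dom_set XiB S r0 NatS"
  obtains n where "muB NatS [Lst p, Lst q] = Num n" "laurent_of [Lst p, Lst q] = monom (\<epsilon> * int n) (c ^ n)"
proof -
  have "[twist \<epsilon> (c powi (- \<epsilon>)) (laurent_of [Lst p, Lst q])] \<in> dom_set Delta R [X 1] NatS"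
    using assms unfolding dom_set_XiB by (auto simp: in_tuples_Cons)
  then obtain n where n: "twist \<epsilon> (c powi (- \<epsilon>)) (laurent_of [Lst p, Lst q]) = X (int n)" by (auto simp: dom_set_Delta)
  then have "laurent_of [Lst p, Lst q] = monom (\<epsilon> * int n) (c ^ n)"
    using twist_inverse[OF c \<epsilon>, of "laurent_of [Lst p, Lst q]"] by (simp add: twist_monom[OF c])
  then show ?thesis using n that by (simp add: comp_map_def)
qed

lemma sat_theta_field:
  "sat S [Lst p, Lst q, Fld x, Lst p0, Lst q0] theta_field \<longleftrightarrow>
    [Lst p, Lst q] \<in> dom_set XiB S r0 FieldS \<and> muB FieldS [Lst p, Lst q] = Fld x"
proof -
  have "sat S [Lst p, Lst q, Fld x, Lst p0, Lst q0] theta_field \<longleftrightarrow>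
      [Lst p, Lst q] \<in> dom_set XiB S r0 FieldS \<and> x = cf (laurent_of [Lst p, Lst q]) 0"
    by (auto simp: theta_field_def sat_inst[OF wff_XiB(1)] sat_inst[OF wff_coeff] sat_coeff dom_set_def comp_code_sel)
  then show ?thesis using muB_field by auto
qed

text \<open>The parameter has its only nonzero coefficient at \<epsilon>, which selects the disjunct
  with the right sign; the scalar c^n is nonzero and therefore invisible in the support.\<close>

lemma sat_theta_nat:
  "sat S [Lst p, Lst q, Num m, Lst p0, Lst q0] theta_nat \<longleftrightarrow>
    [Lst p, Lst q] \<in> dom_set XiB S r0 NatS \<and> muB NatS [Lst p, Lst q] = Num m"
proof -
  let ?u = "laurent_of [Lst p, Lst q]" and ?t = "laurent_of [Lst p0, Lst q0]"
  have "sat S [Lst p, Lst q, Num m, Lst p0, Lst q0] theta_nat \<longleftrightarrow>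
      [Lst p, Lst q] \<in> dom_set XiB S r0 NatS \<and>
      (cf ?t 1 \<noteq> 0 \<and> cf ?u (int m) \<noteq> 0 \<or> cf ?t (- 1) \<noteq> 0 \<and> cf ?u (- int m) \<noteq> 0)"
    by (auto simp: theta_nat_def sat_inst[OF wff_XiB(2)] sat_inst[OF wff_coeff] sat_coeff dom_set_def comp_code_sel)
  moreover have "(cf ?t 1 \<noteq> 0 \<and> cf ?u (int m) \<noteq> 0 \<or> cf ?t (- 1) \<noteq> 0 \<and> cf ?u (- int m) \<noteq> 0) \<longleftrightarrow>
      muB NatS [Lst p, Lst q] = Num m" if dom: "[Lst p, Lst q] \<in> dom_set XiB S r0 NatS"
  proof -
    obtain n where n: "muB NatS [Lst p, Lst q] = Num n" "?u = monom (\<epsilon> * int n) (c ^ n)"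
      using dom by (rule muB_nat)
    have te: "?t = monom \<epsilon> c" by (simp add: t twist_monom[OF c])
    show ?thesis unfolding n te using c \<epsilon> by (auto simp: cf_monom)
  qed
  ultimately show ?thesis by blast
qed

text \<open>With equal lengths one implication suffices, because each position carries exactly one
  component.\<close>

lemma nth_eq_by_At:
  "s' = s \<longleftrightarrow> length s' = length s \<and> (\<forall>i a. super_rel At [Lst s, Fld a, Num i] \<longrightarrow> super_rel At [Lst s', Fld a, Num i])"
proof
  assume *: "length s' = length s \<and> (\<forall>i a. super_rel At [Lst s, Fld a, Num i] \<longrightarrow> super_rel At [Lst s', Fld a, Num i])"
  show "s' = s"
  proof (rule nth_equalityI)
    fix i assume "i < length s'"
    then show "s' ! i = s ! i" using *[THEN conjunct2, rule_format, of "s ! i" "Suc i"] * by simp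
  qed (use * in simp)
qed simp

lemma sat_theta_list:
  assumes u: "u = [Lst u0, Lst u1, Lst u2, Lst u3, Lst u4, Lst u5]"
  shows "sat S (u @ [Lst s] @ r0) theta_list \<longleftrightarrow> u \<in> dom_set XiB S r0 ListS \<and> muB ListS u = Lst s"
proof -
  have dom: "sat S (u @ [Lst s] @ r0) (inst [0, 1, 2, 3, 4, 5, 7, 8] (DomC XiB ListS)) \<longleftrightarrow> u \<in> dom_set XiB S r0 ListS"
    by (simp add: u sat_inst[OF wff_XiB(3)] dom_set_def comp_code_sel)
  show ?thesis
  proof (cases "u \<in> dom_set XiB S r0 ListS")
    case True
    then obtain s' where s': "muB ListS u = Lst s'"
      using realizes_image[OF realizes_XiB, of ListS] by auto
    \<comment> \<open>Surjectivity of the composite coordinate map supplies a representing pair for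
      every number, as the existential quantifiers of \<open>theta_list\<close> require.\<close>
    have nat_ex: "\<exists>p q. [Lst p, Lst q] \<in> dom_set XiB S r0 NatS \<and> muB NatS [Lst p, Lst q] = Num n" for n
    proof -
      have "Num n \<in> muB NatS ` dom_set XiB S r0 NatS" unfolding realizes_image[OF realizes_XiB] by simp
      then obtain v where v: "v \<in> dom_set XiB S r0 NatS" "muB NatS v = Num n" by auto
      then have "v \<in> tuples (Carrier S) [ListS, ListS]" using dom_set_tuples[OF v(1)] by (simp add: comp_code_sel)
      then show ?thesis using v by (auto simp: in_tuples_Cons)
    qed
    have field_ex: "\<exists>p q. [Lst p, Lst q] \<in> dom_set XiB S r0 FieldS \<and> muB FieldS [Lst p, Lst q] = Fld a" for a
    proof -
      have "Fld a \<in> muB FieldS ` dom_set XiB S r0 FieldS" unfolding realizes_image[OF realizes_XiB] by simp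
      then obtain v where v: "v \<in> dom_set XiB S r0 FieldS" "muB FieldS v = Fld a" by auto
      then have "v \<in> tuples (Carrier S) [ListS, ListS]" using dom_set_tuples[OF v(1)] by (simp add: comp_code_sel)
      then show ?thesis using v by (auto simp: in_tuples_Cons)
    qed
    have len: "sat S (u @ [Lst p, Lst q] @ r0) (FunC XiB Len) \<longleftrightarrow> muB NatS [Lst p, Lst q] = Num (length s')"
      if "[Lst p, Lst q] \<in> dom_set XiB S r0 NatS" for p q
      using realizes_Fun[OF realizes_XiB, of Len "[u]" "[Lst p, Lst q]"] that True s' by simp
    have at: "sat S (u @ [Lst p, Lst q, Lst p', Lst q'] @ r0) (RelC XiB At) \<longleftrightarrow> super_rel At [Lst s', Fld a, Num i]"
      if "[Lst p, Lst q] \<in> dom_set XiB S r0 FieldS" "muB FieldS [Lst p, Lst q] = Fld a"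
        "[Lst p', Lst q'] \<in> dom_set XiB S r0 NatS" "muB NatS [Lst p', Lst q'] = Num i" for p q p' q' a i
      using realizes_Rel[OF realizes_XiB, of At "[u, [Lst p, Lst q], [Lst p', Lst q']]"] that True s' by simp
    have "sat S (u @ [Lst s] @ r0) theta_list \<longleftrightarrow>
      (\<exists>p q. sat S [Lst p, Lst q, Num (length s), Lst p0, Lst q0] theta_nat \<and>
         sat S (u @ [Lst p, Lst q] @ r0) (FunC XiB Len)) \<and>
      (\<forall>i a. super_rel At [Lst s, Fld a, Num i] \<longrightarrow>
         (\<exists>p q p' q'. (sat S [Lst p, Lst q, Fld a, Lst p0, Lst q0] theta_field \<and>
           sat S [Lst p', Lst q', Num i, Lst p0, Lst q0] theta_nat) \<and>
           sat S (u @ [Lst p, Lst q, Lst p', Lst q'] @ r0) (RelC XiB At)))"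
      using dom True
      by (simp add: theta_list_def u sat_inst[OF wff_XiB(4)] sat_inst[OF wff_XiB(5)]
          sat_inst[OF wff_theta_field] sat_inst[OF wff_theta_nat] del: super_rel.simps)
    also have "\<dots> \<longleftrightarrow> length s' = length s \<and>
      (\<forall>i a. super_rel At [Lst s, Fld a, Num i] \<longrightarrow> super_rel At [Lst s', Fld a, Num i])"
    proof -
      have "(\<exists>p q. sat S [Lst p, Lst q, Num (length s), Lst p0, Lst q0] theta_nat \<and>
         sat S (u @ [Lst p, Lst q] @ r0) (FunC XiB Len)) \<longleftrightarrow> length s' = length s"
        unfolding sat_theta_nat using len nat_ex[of "length s"] by (metis list_elem.inject(3))
      moreover have "(\<exists>p q p' q'. (sat S [Lst p, Lst q, Fld a, Lst p0, Lst q0] theta_field \<and>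
           sat S [Lst p', Lst q', Num i, Lst p0, Lst q0] theta_nat) \<and>
           sat S (u @ [Lst p, Lst q, Lst p', Lst q'] @ r0) (RelC XiB At)) \<longleftrightarrow>
         super_rel At [Lst s', Fld a, Num i]" for a i
        unfolding sat_theta_nat sat_theta_field using at[of _ _ a _ _ i] nat_ex[of i] field_ex[of a] by blast
      ultimately show ?thesis by simp
    qed
    also have "\<dots> \<longleftrightarrow> s' = s" by (rule nth_eq_by_At[symmetric])
    finally show ?thesis using True s' by simp
  next
    case False
    then show ?thesis using dom unfolding theta_list_def sat.simps by blast
  qed
qed

lemma sat_thetaB:
  assumes u: "u \<in> tuples (Carrier S) (coord XiB s)"
    and x: "x \<in> Carrier (S :: 'a super_model) s"
  shows "sat S (u @ [x] @ r0) (thetaB s) \<longleftrightarrow> u \<in> dom_set XiB S r0 s \<and> muB s u = x"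
proof (cases s)
  case FieldS
  then obtain p q a where "u = [Lst p, Lst q]" "x = Fld a" using u x by (auto simp: comp_code_sel in_tuples_Cons)
  then show ?thesis using sat_theta_field by (simp add: FieldS thetaB_def)
next
  case NatS
  then obtain p q n where "u = [Lst p, Lst q]" "x = Num n" using u x by (auto simp: comp_code_sel in_tuples_Cons)
  then show ?thesis using sat_theta_nat by (simp add: NatS thetaB_def)
next
  case ListS
  then obtain u0 u1 u2 u3 u4 u5 s' where "u = [Lst u0, Lst u1, Lst u2, Lst u3, Lst u4, Lst u5]" "x = Lst s'"
    using u x by (auto simp: comp_code_sel in_tuples_Cons)
  then show ?thesis using sat_theta_list by (simp add: ListS thetaB_def)
qed

end

lemma defines_B:
  "defines_coordinate_maps list_lang (S :: 'a::field super_model) XiB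
     (comp_adm ring_lang Delta \<psi>_gen Gamma0 Tru) thetaB"
  unfolding defines_coordinate_maps_def
proof (intro conjI allI ballI impI)
  fix s
  show "wff list_lang (coord XiB s @ [s] @ params XiB) (thetaB s)"
    by (cases s) (simp_all add: thetaB_def comp_code_sel wff_theta_field wff_theta_nat wff_theta_list)
next
  fix r :: "'a list_elem list"
  assume r: "r \<in> tuples (Carrier S) (params XiB)" and adm: "sat S r (comp_adm ring_lang Delta \<psi>_gen Gamma0 Tru)"
  interpret RG: realization ring_lang list_lang Gamma0 "S :: 'a super_model" "[]" R "\<lambda>_. laurent_of"
    by unfold_locales (simp_all add: wf_Gamma0 realizes_Gamma0)
  obtain p0 q0 where r0: "r = [Lst p0, Lst q0]" using r by (auto simp: comp_code_sel in_tuples_Cons)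
  \<comment> \<open>By the reduction theorem, admissibility of \<open>r\<close> says that the pair
    represents a generator of the ring.\<close>
  have "sat S (concat [r] @ []) (translate ring_lang Gamma0 [()] \<psi>_gen)"
    using adm by (simp add: comp_adm_def)
  then have dom: "[r] \<in> tuples RG.D [()]" and "sat R (map2 (\<lambda>_. laurent_of) [()] [r]) \<psi>_gen"
    using RG.sat_translate[OF wff_gen', of "[r]"] by (simp_all add: r0)
  then have "sat R [laurent_of [Lst p0, Lst q0]] \<psi>_gen" by (simp add: r0)
  then obtain c \<epsilon> where ce: "c \<noteq> 0" "\<epsilon> = 1 \<or> \<epsilon> = - 1" "laurent_of [Lst p0, Lst q0] = twist \<epsilon> c (X 1)" by (rule sat_genE)
  have p0: "p0 \<noteq> []" using dom by (simp add: dom_set_Gamma0 r0)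
  have "coordinate_map list_lang XiB S r (S :: 'a super_model) (muB c \<epsilon>)"
    unfolding r0 by (rule realizes_imp_coordinate_map[OF realizes_XiB[OF ce p0]])
  moreover have "sat S (u @ [x] @ r) (thetaB s) \<longleftrightarrow> u \<in> dom_set XiB S r s \<and> muB c \<epsilon> s u = x"
    if "u \<in> tuples (Carrier S) (coord XiB s)" "x \<in> Carrier (S :: 'a super_model) s" for s u x
    unfolding r0 by (rule sat_thetaB[OF ce p0 that])
  ultimately show "\<exists>\<mu>. coordinate_map list_lang XiB S r (S :: 'a super_model) \<mu> \<and>
      (\<forall>s. \<forall>u\<in>tuples (Carrier S) (coord XiB s). \<forall>x\<in>Carrier S s.
         sat S (u @ [x] @ r) (thetaB s) \<longleftrightarrow> u \<in> dom_set XiB S r s \<and> \<mu> s u = x)"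
    by (intro exI[of _ "muB c \<epsilon>"] conjI allI ballI) blast+
qed

theorem theorem5p7:
  assumes "infinite (UNIV :: 'a::field set)"
  shows "coordinate_map ring_lang Gamma0 (list_super :: (list_sort, list_fun, list_rel, 'a list_elem) model) []
           (laurent_ring :: (unit, ring_fun, unit, int \<Rightarrow>\<^sub>0 'a) model) (\<lambda>_. laurent_of)
       \<and> (\<exists>\<Delta> \<psi> \<theta>A \<theta>B.
            regular_bi_interpretation
              ring_lang (laurent_ring :: (unit, ring_fun, unit, int \<Rightarrow>\<^sub>0 'a) model)
              list_lang (list_super :: (list_sort, list_fun, list_rel, 'a list_elem) model)
              Gamma0 Tru \<Delta> \<psi> \<theta>A \<theta>B)"
proof (intro conjI exI)
  show "coordinate_map ring_lang Gamma0 (list_super :: (list_sort, list_fun, list_rel, 'a list_elem) model) []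
      (laurent_ring :: (unit, ring_fun, unit, int \<Rightarrow>\<^sub>0 'a) model) (\<lambda>_. laurent_of)"
    by (rule realizes_imp_coordinate_map[OF realizes_Gamma0])
  show "regular_bi_interpretation
      ring_lang (laurent_ring :: (unit, ring_fun, unit, int \<Rightarrow>\<^sub>0 'a) model)
      list_lang (list_super :: (list_sort, list_fun, list_rel, 'a list_elem) model)
      Gamma0 Tru Delta \<psi>_gen (\<lambda>_. thetaA) thetaB"
    unfolding regular_bi_interpretation_def
    by (intro conjI regular_Gamma0 regular_Delta defines_A[OF assms] defines_B)
qed

end
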